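(* Let $n\ge 2$, let $\Omega,\Omega^*\subset\mathbb{R}^n$ be bounded domains, let $f\in C^{1,1}(\Omega)$ and $g\in C^{1,1}(\Omega^* )$ have positive upper and lower bounds, and suppose $\int_\Omega f(x)\,dx=\int_{\Omega^*}g(y)\,dy$. For $\varepsilon\in(0,1]$ let $c_\varepsilon(x,y)=\sqrt{\varepsilon^2+|x-y|^2}$, and let $u\in C^{3,1}(\Omega)$ be a $c_\varepsilon$-concave solution of $$\det (w_{ij})=\frac{\varepsilon^2}{L^{n+2}}\,\frac{f}{g\circ T}\quad\text{in }\Omega ,$$ where $L$, $T:\Omega\to\Omega^*$, $w_{ij}$ are built from $u$ and $\varepsilon$ as in the context. Let $\lambda_1,\dots,\lambda_n$ be the eigenvalues (which are all positive real numbers) of the Jacobian matrix $DT$. Then for any $\Omega'\subset\subset\Omega$, $$C^{-1}\le\min_i\lambda_i\le\max_i\lambda_i\le C\quad\text{in }\Omega',$$ where $C$ depends on $n$, $\mathrm{dist}(\Omega',\partial\Omega)$, $f$ and $g$ (and on their domains $\Omega,\Omega^*$), but is independent of $\varepsilon\in(0,1]$ and of $u$.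
   Context: A function $u:\Omega\to\mathbb{R}$ is $c_\varepsilon$-concave if $u(x)=\inf_{y\in\Omega^*}\{c_\varepsilon(x,y)-\psi(y)\}$ for some function $\psi$ on $\Omega^*$. For differentiable $c_\varepsilon$-concave $u$ one has $|Du|<1$, and one sets $$L(x)=\frac{\varepsilon}{\sqrt{1-|Du(x)|^2}},\qquad T(x)=x-L(x)Du(x),$$ so that $L(x)=\sqrt{\varepsilon^2+|x-T(x)|^2}$. $T$ is the optimal mapping, with values in $\Omega^*$. Further, $$A_{ij}=\frac1L(\delta_{ij}-D_iu\,D_ju),\qquad w_{ij}=A_{ij}-D^2_{ij}u .$$ The matrix $(A_{ij})$ is positive definite with inverse $A^{ij}=L\big(\delta_{ij}+\frac{L^2}{\varepsilon^2}D_iu\,D_ju\big)$; $(w_{ij})$ is symmetric and nonnegative; and $\partial_jT^i=\sum_kA^{ik}w_{kj}$. $C^{1,1}$ means continuously differentiable with bounded, Lipschitz first derivatives; $C^{3,1}(\Omega)$ means $C^3$ with locally Lipschitz third derivatives. *)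

theory Defs
  imports "HOL-Analysis.Analysis"
begin

definition bounded_domain :: "(real^'n) set \<Rightarrow> bool" where
  "bounded_domain S \<longleftrightarrow> open S \<and> connected S \<and> bounded S \<and> S \<noteq> {}"

(* All derivatives below are only ever used at points of an open set, so the values of
   the functions outside that set are irrelevant. *)

definition partial_deriv :: "'n \<Rightarrow> (real^'n \<Rightarrow> real) \<Rightarrow> real^'n \<Rightarrow> real" where
  "partial_deriv i h x = frechet_derivative h (at x) (axis i 1)"

definition grad :: "(real^'n \<Rightarrow> real) \<Rightarrow> real^'n \<Rightarrow> real^'n" where
  "grad h x = (\<chi> i. partial_deriv i h x)"

definition hessian :: "(real^'n \<Rightarrow> real) \<Rightarrow> real^'n \<Rightarrow> real^'n^'n" where
  "hessian h x = (\<chi> i j. partial_deriv i (partial_deriv j h) x)"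

primrec Ck_on :: "nat \<Rightarrow> (real^'n) set \<Rightarrow> (real^'n \<Rightarrow> real) \<Rightarrow> bool" where
  "Ck_on 0 S h \<longleftrightarrow> continuous_on S h"
| "Ck_on (Suc k) S h \<longleftrightarrow>
     (\<forall>x\<in>S. h differentiable (at x)) \<and> (\<forall>i. Ck_on k S (partial_deriv i h))"

definition locally_lipschitz_on :: "'a::metric_space set \<Rightarrow> ('a \<Rightarrow> 'b::metric_space) \<Rightarrow> bool" where
  "locally_lipschitz_on S h \<longleftrightarrow> (\<forall>x\<in>S. \<exists>r>0. \<exists>K. K-lipschitz_on (ball x r \<inter> S) h)"

definition C11_on :: "(real^'n) set \<Rightarrow> (real^'n \<Rightarrow> real) \<Rightarrow> bool" where
  "C11_on S h \<longleftrightarrow> Ck_on 1 S h \<and>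
     (\<forall>i. bounded (partial_deriv i h ` S) \<and> (\<exists>K. K-lipschitz_on S (partial_deriv i h)))"

definition C31_on :: "(real^'n) set \<Rightarrow> (real^'n \<Rightarrow> real) \<Rightarrow> bool" where
  "C31_on S h \<longleftrightarrow> Ck_on 3 S h \<and>
     (\<forall>i j k. locally_lipschitz_on S (partial_deriv i (partial_deriv j (partial_deriv k h))))"

definition cost :: "real \<Rightarrow> real^'n \<Rightarrow> real^'n \<Rightarrow> real" where
  "cost \<epsilon> x y = sqrt (\<epsilon>\<^sup>2 + (norm (x - y))\<^sup>2)"

(* Boundedness below is what makes the real-valued infimum a genuine one. *)
definition c_concave_on ::
    "real \<Rightarrow> (real^'n) set \<Rightarrow> (real^'n) set \<Rightarrow> (real^'n \<Rightarrow> real) \<Rightarrow> bool" where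
  "c_concave_on \<epsilon> \<Omega> \<Omega>s u \<longleftrightarrow>
     (\<exists>\<psi> :: real^'n \<Rightarrow> real. \<forall>x\<in>\<Omega>.
        bdd_below ((\<lambda>y. cost \<epsilon> x y - \<psi> y) ` \<Omega>s) \<and>
        u x = (INF y\<in>\<Omega>s. cost \<epsilon> x y - \<psi> y))"

definition L_fun :: "real \<Rightarrow> (real^'n \<Rightarrow> real) \<Rightarrow> real^'n \<Rightarrow> real" where
  "L_fun \<epsilon> u x = \<epsilon> / sqrt (1 - (norm (grad u x))\<^sup>2)"

definition T_map :: "real \<Rightarrow> (real^'n \<Rightarrow> real) \<Rightarrow> real^'n \<Rightarrow> real^'n" where
  "T_map \<epsilon> u x = x - L_fun \<epsilon> u x *\<^sub>R grad u x"

definition A_mat :: "real \<Rightarrow> (real^'n \<Rightarrow> real) \<Rightarrow> real^'n \<Rightarrow> real^'n^'n" where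
  "A_mat \<epsilon> u x = (\<chi> i j. (1 / L_fun \<epsilon> u x) *
     ((if i = j then 1 else 0) - grad u x $ i * grad u x $ j))"

definition w_mat :: "real \<Rightarrow> (real^'n \<Rightarrow> real) \<Rightarrow> real^'n \<Rightarrow> real^'n^'n" where
  "w_mat \<epsilon> u x = A_mat \<epsilon> u x - hessian u x"

(* Complex eigenvalues: the Jacobian of the transport map is in general not symmetric,
   so that its spectrum is real is part of the claim. *)
definition eigenvals :: "real^'n^'n \<Rightarrow> complex set" where
  "eigenvals M = {z. \<exists>v :: complex^'n. v \<noteq> 0 \<and> map_matrix complex_of_real M *v v = z *s v}"

end

(* In Minkowski space R^(n,1) the graph of u is spacelike, and (T x, u x - L x) is its point (x, u x) moved
   by eps along the unit normal; hence DT = A^(-1) w is symmetric for the induced metric I - Du Du^T, and its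
   eigenvalues l_i are 1 - eps * (principal curvatures), with product f / (g o T). One maximises
   eta(x) * w(xi,xi) / A(xi,xi) for a cutoff eta over x and xi, and freezes the optimal xi. At the maximum point
   all third derivatives of u cancel, and the Gauss curvature terms leave
      l_max^2 * (sum of 1 / l_i over the other eigenvalues) <= C * (l_max^2 + (l_max / eta) * (1 + same sum))
   with C independent of eps, because both sides scale like eps^(-2) and L is bounded. Since the product of
   the l_i is bounded, a large eta * l_max would force a small eigenvalue and contradict this. *)

theory Submission
  imports Defs
begin

section \<open>Linear algebra of symmetric matrices\<close>

definition sym_mat :: "real^'n^'n \<Rightarrow> bool" where
  "sym_mat M \<longleftrightarrow> transpose M = M"

definition pos_def :: "real^'n^'n \<Rightarrow> bool" where
  "pos_def M \<longleftrightarrow> sym_mat M \<and> (\<forall>x. x \<noteq> 0 \<longrightarrow> x \<bullet> (M *v x) > 0)"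

lemma sym_mat_inner: "sym_mat M \<Longrightarrow> x \<bullet> (M *v y) = y \<bullet> (M *v (x::real^'n))"
  unfolding sym_mat_def by (metis dot_lmul_matrix inner_commute vector_transpose_matrix)

lemma quadratic_nonneg_imp_linear_zero:
  fixes b c :: real
  assumes "\<And>t. 2 * t * b + t\<^sup>2 * c \<ge> 0"
  shows "b = 0"
proof (rule ccontr)
  assume "b \<noteq> 0"
  \<comment> \<open>The sign is opposite to that of \<open>b\<close>, and the size is small enough
    that the quadratic term cannot compensate the linear one; \<open>\<bar>c\<bar> + 1\<close> keeps
    the denominator positive.\<close>
  define t where "t = - b / (\<bar>c\<bar> + 1)"
  have "2 * t * b + t\<^sup>2 * c = (b\<^sup>2 / (\<bar>c\<bar> + 1)\<^sup>2) * (c - 2 * (\<bar>c\<bar> + 1))"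
  proof -
    have "\<bar>c\<bar> + 1 \<noteq> 0" by linarith
    then show ?thesis unfolding t_def by (simp add: divide_simps power2_eq_square) (simp add: algebra_simps)
  qed
  moreover have "\<dots> < 0"
    using \<open>b \<noteq> 0\<close> by (intro mult_pos_neg) (auto intro!: divide_pos_pos)
  ultimately show False using assms[of t] by linarith
qed

text \<open>Along \<open>x + t *\<^sub>R y\<close> the form is a nonnegative quadratic in
  \<open>t\<close> without constant term, so its linear coefficient vanishes. The version relative
  to a subspace is what the diagonalisation needs, where semidefiniteness is only known on a
  complement of the vectors already found.\<close>

lemma pos_semidef_kernel:
  fixes M :: "real^'n^'n"
  assumes "sym_mat M" "subspace V" "\<And>y. y \<in> V \<Longrightarrow> y \<bullet> (M *v y) \<ge> 0"
    and "x \<in> V" "x \<bullet> (M *v x) = 0" "y \<in> V"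
  shows "y \<bullet> (M *v x) = 0"
proof (rule quadratic_nonneg_imp_linear_zero)
  fix t :: real
  have "x + t *\<^sub>R y \<in> V"
    using assms by (simp add: subspace_add subspace_scale)
  then have "0 \<le> (x + t *\<^sub>R y) \<bullet> (M *v (x + t *\<^sub>R y))"
    using assms by blast
  also have "\<dots> = 2 * t * (y \<bullet> (M *v x)) + t\<^sup>2 * (y \<bullet> (M *v y))"
    using assms(5) sym_mat_inner[OF assms(1), of x y]
    by (simp add: matrix_vector_right_distrib matrix_vector_mult_scaleR inner_add_left inner_add_right
        power2_eq_square algebra_simps)
  finally show "0 \<le> 2 * t * (y \<bullet> (M *v x)) + t\<^sup>2 * (y \<bullet> (M *v y))" .
qed

text \<open>The next vector maximises the Rayleigh quotient of \<open>w\<close> against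
  \<open>G\<close> on the \<open>G\<close>-orthogonal complement of the earlier ones. Induction runs
  over sets of indices, so that the frame is finally numbered by the index type of the coordinates
  itself.\<close>

lemma simultaneous_diagonalization_aux:
  fixes G w :: "real^'n^'n"
  assumes G: "pos_def G" and w: "sym_mat w"
  shows "\<exists>e \<mu>. (\<forall>i\<in>(F::'n set). \<forall>j\<in>F. e i \<bullet> (G *v e j) = (if i = j then 1 else 0)) \<and>
     (\<forall>i\<in>F. w *v e i = \<mu> i *\<^sub>R (G *v (e i :: real^'n)))"
proof (induction F rule: finite_induct[OF finite])
  case 1 then show ?case by simp
next
  case (2 k F)
  then obtain e \<mu> where e: "\<And>i j. i \<in> F \<Longrightarrow> j \<in> F \<Longrightarrow> e i \<bullet> (G *v e j) = (if i = j then 1 else 0)"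
    and mu: "\<And>i. i \<in> F \<Longrightarrow> w *v e i = \<mu> i *\<^sub>R (G *v (e i :: real^'n))" by blast
  have Gs: "sym_mat G" and Gp: "\<And>x. x \<noteq> 0 \<Longrightarrow> x \<bullet> (G *v x) > 0"
    using G by (auto simp: pos_def_def)
  define V where "V = {x. \<forall>i\<in>F. (G *v e i) \<bullet> x = 0}"
  have V: "subspace V"
    unfolding V_def subspace_def by (auto simp: inner_add_right)
  have "closed V"
    using V by (rule closed_subspace)
  have "dim ((\<lambda>i. G *v e i) ` F) \<le> card ((\<lambda>i. G *v e i) ` F)"
    by (rule dim_le_card) (auto simp: span_superset)
  also have "\<dots> \<le> card F" by (rule card_image_le) simp
  also have "\<dots> < CARD('n)"
    using 2 by (metis card_seteq finite_class.finite_UNIV iso_tuple_UNIV_I not_le subset_UNIV)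
  finally have dim: "dim ((\<lambda>i. G *v e i) ` F) < DIM(real^'n)" by simp
  obtain z where z: "z \<noteq> 0" "\<And>y. y \<in> span ((\<lambda>i. G *v e i) ` F) \<Longrightarrow> orthogonal z y"
    by (rule orthogonal_to_subspace_exists[OF dim], rule that)
  have zV: "z \<in> V"
    unfolding V_def
  proof (intro CollectI ballI)
    fix i assume "i \<in> F"
    then have "orthogonal z (G *v e i)" by (intro z(2) span_base imageI)
    then show "(G *v e i) \<bullet> z = 0" by (simp add: orthogonal_def inner_commute)
  qed
  \<comment> \<open>The quotient is homogeneous of degree 0, so the Euclidean unit sphere, which is
    compact, suffices for the maximum over \<open>V\<close>.\<close>
  let ?K = "V \<inter> sphere 0 1"
  have "compact ?K"
    using \<open>closed V\<close> by (simp add: closed_Int_compact)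
  moreover have "z /\<^sub>R norm z \<in> ?K"
    using z(1) zV V by (simp add: subspace_scale)
  then have "?K \<noteq> {}" by blast
  moreover have "continuous_on ?K (\<lambda>x. (x \<bullet> (w *v x)) / (x \<bullet> (G *v x)))"
  proof (intro continuous_intros matrix_vector_mult_linear_continuous_on ballI)
    fix x assume "x \<in> ?K"
    then have "x \<noteq> 0" by auto
    then show "x \<bullet> (G *v x) \<noteq> 0" using Gp[of x] by linarith
  qed
  ultimately obtain x0 where x0: "x0 \<in> ?K" 
    and max: "\<And>x. x \<in> ?K \<Longrightarrow> (x \<bullet> (w *v x)) / (x \<bullet> (G *v x)) \<le> (x0 \<bullet> (w *v x0)) / (x0 \<bullet> (G *v x0))"
    using continuous_attains_sup[of ?K] by blast
  define l where "l = (x0 \<bullet> (w *v x0)) / (x0 \<bullet> (G *v x0))"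
  define N where "N = l *\<^sub>R G - w"
  have Nv: "N *v x = l *\<^sub>R (G *v x) - w *v x" for x
    unfolding N_def by (simp add: matrix_vector_mult_diff_rdistrib scaleR_matrix_vector_assoc)
  have x00: "x0 \<noteq> 0" using x0 by auto
  have Nsym: "sym_mat N"
    using Gs w unfolding N_def sym_mat_def by (auto simp: transpose_def vec_eq_iff)
  have Npos: "x \<bullet> (N *v x) \<ge> 0" if "x \<in> V" for x
  proof (cases "x = 0")
    case False
    define y where "y = x /\<^sub>R norm x"
    have xy: "x = norm x *\<^sub>R y" using False by (simp add: y_def)
    have "y \<in> ?K" using that V False by (auto simp: y_def subspace_scale)
    then have "(y \<bullet> (w *v y)) / (y \<bullet> (G *v y)) \<le> l" using max l_def by blast
    moreover have "y \<noteq> 0" using \<open>y \<in> ?K\<close> by auto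
    then have "y \<bullet> (G *v y) > 0" by (rule Gp)
    ultimately have "y \<bullet> (w *v y) \<le> l * (y \<bullet> (G *v y))" by (simp add: pos_divide_le_eq)
    then have "y \<bullet> (N *v y) \<ge> 0" by (simp add: Nv inner_diff_right)
    moreover have "x \<bullet> (N *v x) = norm x * (norm x * (y \<bullet> (N *v y)))"
      using xy by (metis inner_scaleR_left inner_scaleR_right matrix_vector_mult_scaleR)
    ultimately show ?thesis by simp
  qed simp
  have N0: "x0 \<bullet> (N *v x0) = 0"
    using Gp[OF x00] by (simp add: Nv inner_diff_right l_def)
  have x0V: "x0 \<in> V" using x0 by simp
  have Nz: "y \<bullet> (N *v x0) = 0" for y
  proof -
    \<comment> \<open>Split \<open>y\<close> into its \<open>G\<close>-projection on the earlier
      vectors and the rest \<open>v\<close>. The rest pairs to zero with \<open>N *v x0\<close>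
      because \<open>x0\<close> is a zero of the semidefinite form on \<open>V\<close>; the earlier
      vectors do so because they are eigenvectors and \<open>x0\<close> is
      \<open>G\<close>-orthogonal to them.\<close>
    define v where "v = y - (\<Sum>i\<in>F. ((G *v e i) \<bullet> y) *\<^sub>R e i)"
    have "v \<in> V"
      unfolding V_def
    proof safe
      fix j assume j: "j \<in> F"
      have "(G *v e j) \<bullet> (\<Sum>i\<in>F. ((G *v e i) \<bullet> y) *\<^sub>R e i) 
         = (\<Sum>i\<in>F. ((G *v e i) \<bullet> y) * (if i = j then 1 else 0))"
        unfolding inner_sum_right by (rule sum.cong) (use e j in \<open>auto simp: inner_commute\<close>)
      also have "\<dots> = (G *v e j) \<bullet> y" using j by (simp add: if_distrib cong: if_cong)
      finally show "(G *v e j) \<bullet> v = 0" by (simp add: v_def inner_diff_right)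
    qed
    then have "v \<bullet> (N *v x0) = 0"
      using pos_semidef_kernel[OF Nsym V Npos x0V N0] by blast
    moreover have "e i \<bullet> (N *v x0) = 0" if "i \<in> F" for i
    proof -
      have "e i \<bullet> (N *v x0) = x0 \<bullet> (N *v e i)" by (rule sym_mat_inner[OF Nsym])
      also have "\<dots> = (l - \<mu> i) * ((G *v e i) \<bullet> x0)"
        using mu[OF that] by (simp add: Nv inner_diff_right algebra_simps inner_commute)
      also have "\<dots> = 0" using x0V that by (simp add: V_def)
      finally show ?thesis .
    qed
    moreover have "y \<bullet> (N *v x0) = v \<bullet> (N *v x0) + (\<Sum>i\<in>F. ((G *v e i) \<bullet> y) * (e i \<bullet> (N *v x0)))"
      by (simp add: v_def inner_diff_left inner_sum_left)
    ultimately show ?thesis by simp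
  qed
  have "N *v x0 = 0" using Nz[of "N *v x0"] by (simp only: inner_eq_zero_iff)
  then have wx0: "w *v x0 = l *\<^sub>R (G *v x0)" by (simp add: Nv)
  define a where "a = 1 / sqrt (x0 \<bullet> (G *v x0))"
  have "a * a = 1 / (x0 \<bullet> (G *v x0))"
    using less_imp_le[OF Gp[OF x00]] by (simp add: a_def)
  then have a: "a * (a * (x0 \<bullet> (G *v x0))) = 1"
    using Gp[OF x00] by (simp add: mult.assoc[symmetric])
  define e' where "e' = (\<lambda>i. if i = k then a *\<^sub>R x0 else e i)"
  define \<mu>' where "\<mu>' = (\<lambda>i. if i = k then l else \<mu> i)"
  have x0e: "e i \<bullet> (G *v x0) = 0" "x0 \<bullet> (G *v e i) = 0" if "i \<in> F" for i
    using x0V that sym_mat_inner[OF Gs, of "e i" x0] by (auto simp: V_def inner_commute)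
  have k: "i \<noteq> k" "k \<noteq> i" if "i \<in> F" for i using 2(2) that by blast+
  have "\<forall>i\<in>insert k F. \<forall>j\<in>insert k F. e' i \<bullet> (G *v e' j) = (if i = j then 1 else 0)"
    unfolding ball_simps e'_def using k x0e a
    by (simp add: e matrix_vector_mult_scaleR)
  moreover have "\<forall>i\<in>insert k F. w *v e' i = \<mu>' i *\<^sub>R (G *v (e' i :: real^'n))"
    unfolding ball_simps e'_def \<mu>'_def using k wx0
    by (simp add: mu matrix_vector_mult_scaleR)
  ultimately show ?case by blast
qed

section \<open>Determinant, inverse and trace in a simultaneously diagonalising frame\<close>

lemma matrix_eqI_axis: "(\<And>i. M *v axis i 1 = N *v axis i (1::real)) \<Longrightarrow> M = (N :: real^'n^'m)"
  by (simp add: matrix_vector_mult_basis column_def vec_eq_iff)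

text \<open>A \<open>G\<close>-orthonormal frame of generalised eigenvectors of \<open>w\<close>. It
  is used with \<open>G\<close> the identity (spectral theorem), with two positive definite matrices
  (comparison of determinants), and with the induced metric of the graph, where the
  \<open>\<mu> i\<close> become the eigenvalues of DT up to the factor L.\<close>

locale diag_basis =
  fixes G w :: "real^'n^'n" and e :: "'n \<Rightarrow> real^'n" and \<mu> :: "'n \<Rightarrow> real"
  assumes orthonormal: "e i \<bullet> (G *v e j) = (if i = j then 1 else 0)"
    and eigen: "w *v e i = \<mu> i *\<^sub>R (G *v e i)"
begin

definition E :: "real^'n^'n" where "E = (\<chi> a b. e b $ a)"

lemma E_axis: "E *v axis i 1 = e i"
  by (simp add: E_def vec_eq_iff matrix_vector_mult_basis column_def)

lemma E_mult: "E *v x = (\<Sum>i\<in>UNIV. x $ i *\<^sub>R e i)"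
  by (simp add: E_def vec_eq_iff matrix_vector_mult_def sum_component mult.commute)

lemma transpose_E: "(x v* E) $ i = e i \<bullet> x"
  by (simp add: E_def vector_matrix_mult_def inner_vec_def mult.commute)

lemma EGE: "transpose E ** (G ** E) = mat 1"
proof (rule matrix_eqI_axis)
  fix i
  show "(transpose E ** (G ** E)) *v axis i 1 = mat 1 *v axis i 1"
    by (simp flip: matrix_vector_mul_assoc add: E_axis vec_eq_iff transpose_E orthonormal)
      (simp add: axis_def)
qed

lemma wE: "w ** E = (G ** E) ** (\<chi> i j. if i = j then \<mu> i else 0)"
proof (rule matrix_eqI_axis)
  fix i
  have "(\<chi> i j. if i = j then \<mu> i else 0) *v axis i 1 = \<mu> i *\<^sub>R (axis i 1 :: real^'n)"
    by (simp add: vec_eq_iff matrix_vector_mult_basis column_def) (simp add: axis_def)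
  then show "(w ** E) *v axis i 1 = ((G ** E) ** (\<chi> i j. if i = j then \<mu> i else 0)) *v axis i 1"
    by (simp flip: matrix_vector_mul_assoc add: E_axis eigen matrix_vector_mult_scaleR)
qed

lemma GEE: "(G ** E) ** transpose E = mat 1"
  using EGE matrix_left_right_inverse by blast

lemma EEG: "E ** (transpose E ** G) = mat 1"
  using EGE matrix_left_right_inverse by (metis matrix_mul_assoc)

lemma expand: "x = (\<Sum>i\<in>UNIV. (e i \<bullet> (G *v x)) *\<^sub>R e i)"
proof -
  have "x = E *v (transpose E *v (G *v x))"
    by (simp only: matrix_vector_mul_assoc EEG[unfolded matrix_mul_assoc] matrix_mul_assoc matrix_vector_mul_lid)
  then show ?thesis by (simp only: E_mult transpose_E transpose_matrix_vector)
qed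

lemma expand_dual: "x = (\<Sum>i\<in>UNIV. (e i \<bullet> x) *\<^sub>R (G *v e i))"
proof -
  have "x = G *v (E *v (transpose E *v x))"
    by (simp only: matrix_vector_mul_assoc GEE[unfolded matrix_mul_assoc] matrix_mul_assoc matrix_vector_mul_lid)
  then show ?thesis by (simp only: E_mult transpose_E transpose_matrix_vector linear_sum[OF matrix_vector_mul_linear] matrix_vector_mult_scaleR)
qed

text \<open>Take determinants in \<open>EGE\<close> and \<open>wE\<close>; the first shows that
  \<open>det E\<close> is nonzero and may be cancelled.\<close>

lemma det_eq: "det w = det G * (\<Prod>i\<in>UNIV. \<mu> i)"
proof -
  have "det E * det G * det E = 1"
    using arg_cong[OF EGE, of det] by (simp add: det_mul mult.assoc)
  then have "det E \<noteq> 0" by auto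
  moreover have "det w * det E = det G * det E * (\<Prod>i\<in>UNIV. \<mu> i)"
    using arg_cong[OF wE, of det] by (simp add: det_mul det_diagonal)
  ultimately show ?thesis by simp
qed

lemma inverse_mult:
  assumes "\<And>i. \<mu> i \<noteq> 0" "W ** w = mat 1"
  shows "W *v x = (\<Sum>i\<in>UNIV. (e i \<bullet> x / \<mu> i) *\<^sub>R e i)"
proof -
  have W: "W *v (G *v e i) = (1 / \<mu> i) *\<^sub>R e i" for i
  proof -
    have "e i = W *v (w *v e i)" using assms(2) by (simp add: matrix_vector_mul_assoc)
    also have "\<dots> = \<mu> i *\<^sub>R (W *v (G *v e i))" by (simp add: eigen matrix_vector_mult_scaleR)
    finally have "(1 / \<mu> i) *\<^sub>R e i = (1 / \<mu> i) *\<^sub>R \<mu> i *\<^sub>R (W *v (G *v e i))" by simp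
    then show ?thesis using assms(1)[of i] by simp
  qed
  have "W *v x = W *v (\<Sum>i\<in>UNIV. (e i \<bullet> x) *\<^sub>R (G *v e i))" using expand_dual[of x] by (rule arg_cong)
  then show ?thesis by (simp add: linear_sum[OF matrix_vector_mul_linear] matrix_vector_mult_scaleR W)
qed

text \<open>The inverse of \<open>w\<close> is the sum of the rank one matrices of
  \<open>e i\<close> divided by \<open>\<mu> i\<close>. This turns every trace against the
  linearised operator into a sum over the frame.\<close>

lemma trace_inverse_mult:
  assumes "\<And>i. \<mu> i \<noteq> 0" "W ** w = mat 1"
  shows "trace (W ** X) = (\<Sum>i\<in>UNIV. e i \<bullet> (X *v e i) / \<mu> i)"
proof -
  have "trace (W ** X) = (\<Sum>a\<in>UNIV. (W *v (X *v axis a 1)) $ a)"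
    unfolding trace_def
    by (rule sum.cong[OF refl])
      (simp only: matrix_vector_mul_assoc, simp only: matrix_vector_mult_basis column_def vec_lambda_beta)
  also have "\<dots> = (\<Sum>a\<in>UNIV. \<Sum>i\<in>UNIV. (e i $ a / \<mu> i) * (e i \<bullet> (X *v axis a 1)))"
    unfolding inverse_mult[OF assms] by (simp add: mult.commute)
  also have "\<dots> = (\<Sum>i\<in>UNIV. \<Sum>a\<in>UNIV. (e i $ a / \<mu> i) * (e i \<bullet> (X *v axis a 1)))"
    by (rule sum.swap)
  also have "\<dots> = (\<Sum>i\<in>UNIV. e i \<bullet> (X *v e i) / \<mu> i)"
  proof (rule sum.cong[OF refl])
    fix i
    have "(\<Sum>a\<in>UNIV. (e i $ a / \<mu> i) * (e i \<bullet> (X *v axis a 1)))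
      = (e i \<bullet> (X *v (\<Sum>a\<in>UNIV. e i $ a *\<^sub>R axis a 1))) / \<mu> i"
      by (simp add: linear_sum[OF matrix_vector_mul_linear] matrix_vector_mult_scaleR inner_sum_right
          sum_divide_distrib)
    also have "(\<Sum>a\<in>UNIV. e i $ a *\<^sub>R axis a 1) = e i"
      using basis_expansion[of "e i"] by (simp add: scalar_mult_eq_scaleR)
    finally show "(\<Sum>a\<in>UNIV. (e i $ a / \<mu> i) * (e i \<bullet> (X *v axis a 1))) = e i \<bullet> (X *v e i) / \<mu> i" .
  qed
  finally show ?thesis .
qed

lemma quad_expand: "x \<bullet> (w *v x) = (\<Sum>i\<in>UNIV. \<mu> i * (e i \<bullet> (G *v x))\<^sup>2)" if "sym_mat G" "sym_mat w"
proof -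
  have "x \<bullet> (w *v x) = (w *v x) \<bullet> (\<Sum>i\<in>UNIV. (e i \<bullet> (G *v x)) *\<^sub>R e i)"
    using expand[of x] by (simp add: inner_commute)
  also have "\<dots> = (\<Sum>i\<in>UNIV. (e i \<bullet> (G *v x)) * (e i \<bullet> (w *v x)))"
    by (simp add: inner_sum_right inner_commute)
  also have "\<dots> = (\<Sum>i\<in>UNIV. \<mu> i * (e i \<bullet> (G *v x))\<^sup>2)"
  proof (rule sum.cong[OF refl])
    fix i
    have "e i \<bullet> (w *v x) = \<mu> i * (e i \<bullet> (G *v x))"
      by (metis eigen inner_scaleR_right sym_mat_inner that)
    then show "(e i \<bullet> (G *v x)) * (e i \<bullet> (w *v x)) = \<mu> i * (e i \<bullet> (G *v x))\<^sup>2"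
      by (simp add: power2_eq_square)
  qed
  finally show ?thesis .
qed

lemma quad_expand_G: "x \<bullet> (G *v x) = (\<Sum>i\<in>UNIV. (e i \<bullet> (G *v x))\<^sup>2)"
proof -
  have "x \<bullet> (G *v x) = (G *v x) \<bullet> (\<Sum>i\<in>UNIV. (e i \<bullet> (G *v x)) *\<^sub>R e i)"
    using expand[of x] by (simp add: inner_commute)
  also have "\<dots> = (\<Sum>i\<in>UNIV. (e i \<bullet> (G *v x)) * (e i \<bullet> (G *v x)))"
    by (simp add: inner_sum_right inner_commute)
  finally show ?thesis by (simp add: power2_eq_square)
qed

lemma eigen_form: "e i \<bullet> (w *v e j) = (if i = j then \<mu> i else 0)"
  by (auto simp: eigen orthonormal)

lemma pos_def_eigen: "pos_def w \<Longrightarrow> \<mu> i > 0"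
proof -
  assume "pos_def w"
  moreover have "e i \<noteq> 0" using orthonormal[of i i] by auto
  ultimately show ?thesis using eigen_form[of i i] by (auto simp: pos_def_def)
qed

end

section \<open>Concavity of the logarithm of the determinant, continuity of the inverse\<close>

lemma simultaneous_diagonalization:
  fixes G w :: "real^'n^'n"
  assumes "pos_def G" "sym_mat w"
  obtains e \<mu> where "diag_basis G w e \<mu>"
  using simultaneous_diagonalization_aux[OF assms, of UNIV] by (auto simp: diag_basis_def)

lemma pos_def_mat1: "pos_def (mat 1 :: real^'n^'n)"
  by (simp add: pos_def_def sym_mat_def transpose_mat)

lemma pos_def_det: "pos_def w \<Longrightarrow> det w > 0"
proof -
  assume w: "pos_def w"
  obtain e \<mu> where "diag_basis (mat 1) w e \<mu>"
    using simultaneous_diagonalization[OF pos_def_mat1] w pos_def_def by blast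
  then interpret diag_basis "mat 1" w e \<mu> .
  show ?thesis using det_eq pos_def_eigen[OF w] by (simp add: prod_pos)
qed

lemma trace_inverse_nonneg:
  assumes w: "pos_def w" and "W ** w = mat 1" and "\<And>x. x \<bullet> (X *v x) \<ge> 0"
  shows "trace (W ** X) \<ge> 0"
proof -
  obtain e \<mu> where "diag_basis (mat 1) w e \<mu>"
    using simultaneous_diagonalization[OF pos_def_mat1] w pos_def_def by blast
  then interpret diag_basis "mat 1" w e \<mu> .
  have p: "\<mu> i > 0" for i by (rule pos_def_eigen[OF w])
  then have "\<mu> i \<noteq> 0" for i by (metis less_irrefl)
  from trace_inverse_mult[OF this assms(2)] show ?thesis
    using p assms(3) by (simp add: sum_nonneg less_imp_le)
qed

text \<open>Concavity of the logarithm of the determinant, in the form of a tangent plane from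
  above: relative to \<open>w0\<close>, the matrix \<open>w1\<close> is diagonal, and the claim
  becomes \<open>ln \<mu> \<le> \<mu> - 1\<close> for each eigenvalue.\<close>

lemma ln_det_tangent:
  assumes w0: "pos_def w0" and w1: "pos_def w1" and W: "W ** w0 = mat 1"
  shows "ln (det w1) - ln (det w0) \<le> trace (W ** (w1 - w0))"
proof -
  obtain e \<mu> where "diag_basis w0 w1 e \<mu>"
    using simultaneous_diagonalization[OF w0] w1 pos_def_def by blast
  then interpret diag_basis w0 w1 e \<mu> .
  have p: "\<mu> i > 0" for i by (rule pos_def_eigen[OF w1])
  \<comment> \<open>The same frame diagonalises \<open>w0\<close> against itself with all
    eigenvalues 1, which evaluates traces against the inverse of \<open>w0\<close>.\<close>
  interpret D: diag_basis w0 w0 e "\<lambda>_. 1"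
    by unfold_locales (auto simp: orthonormal)
  have "ln (det w1) - ln (det w0) = (\<Sum>i\<in>UNIV. ln (\<mu> i))"
    using pos_def_det[OF w0] p by (simp add: det_eq ln_mult prod_pos ln_prod less_imp_neq[symmetric] prod_zero_iff)
  also have "\<dots> \<le> (\<Sum>i\<in>UNIV. \<mu> i - 1)"
    by (intro sum_mono ln_le_minus_one p)
  also have "\<dots> = trace (W ** (w1 - w0))"
    using D.trace_inverse_mult[OF _ W]
    by (simp add: matrix_vector_mult_diff_rdistrib inner_diff_right eigen orthonormal)
  finally show ?thesis .
qed

lemma pos_def_invertible:
  assumes "pos_def w"
  obtains W where "W ** w = mat 1" "w ** W = mat 1"
proof -
  have "det w \<noteq> 0" using pos_def_det[OF assms] by simp
  then have "invertible w" by (simp add: invertible_det_nz)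
  then show ?thesis using that unfolding invertible_def by blast
qed

lemma tendsto_det:
  fixes M :: "'b \<Rightarrow> real^'n^'n"
  assumes "(M \<longlongrightarrow> N) F"
  shows "((\<lambda>x. det (M x)) \<longlongrightarrow> det N) F"
  unfolding det_def by (intro tendsto_intros assms)

text \<open>By Cramer's rule the entries of the inverse are quotients of determinants of matrices
  that depend continuously on the given one.\<close>

lemma tendsto_inverse_matrix:
  fixes w W :: "'b \<Rightarrow> real^'n^'n"
  assumes w: "(w \<longlongrightarrow> w0) F" and W: "\<And>x. w x ** W x = mat 1" and W0: "w0 ** W0 = mat 1"
  shows "(W \<longlongrightarrow> W0) F"
proof -
  have cram: "A ** B = mat 1 \<Longrightarrow> B $ i $ j = det (\<chi> a b. if b = i then axis j 1 $ a else A $ a $ b) / det A"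
    for A B :: "real^'n^'n" and i j
  proof -
    assume AB: "A ** B = mat 1"
    then have "det A \<noteq> 0"
      by (metis det_I det_mul mult_zero_left zero_neq_one)
    moreover have "A *v (B *v axis j 1) = axis j 1"
      by (simp add: matrix_vector_mul_assoc AB)
    ultimately have "B *v axis j 1 = (\<chi> k. det (\<chi> a b. if b = k then axis j 1 $ a else A $ a $ b) / det A)"
      by (simp add: cramer)
    moreover have "B $ i $ j = (B *v axis j 1) $ i" by (simp add: matrix_vector_mult_basis column_def)
    ultimately show ?thesis by simp
  qed
  have d: "det w0 \<noteq> 0"
    using W0 by (metis det_I det_mul mult_zero_left zero_neq_one)
  have "((\<lambda>x. det (\<chi> a b. if b = i then axis j 1 $ a else w x $ a $ b) / det (w x)) \<longlongrightarrow> 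
         det (\<chi> a b. if b = i then axis j 1 $ a else w0 $ a $ b) / det w0) F" for i j
    by (intro tendsto_divide tendsto_det w d vec_tendstoI) (auto intro!: tendsto_intros w)
  then show ?thesis
    by (intro vec_tendstoI) (simp add: cram[OF W] cram[OF W0])
qed

section \<open>Second differences and mixed partial derivatives\<close>

text \<open>Values lie in an arbitrary real vector space, since second differences are taken of
  scalar functions, of the map T and of matrices alike.\<close>

definition sdiff :: "('a::real_vector \<Rightarrow> 'b::real_vector) \<Rightarrow> 'a \<Rightarrow> 'a \<Rightarrow> 'b" where
  "sdiff F x v = F (x + v) + F (x - v) - 2 *\<^sub>R F x"

lemma line_derivative:
  fixes F :: "'a::real_normed_vector \<Rightarrow> real"
  assumes "(F has_derivative F') (at (x + t *\<^sub>R v))"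
  shows "((\<lambda>s. F (x + s *\<^sub>R v)) has_real_derivative F' v) (at t)"
proof -
  have "((\<lambda>s. x + s *\<^sub>R v) has_derivative (\<lambda>s. s *\<^sub>R v)) (at t)"
    by (auto intro!: derivative_eq_intros)
  then have "((\<lambda>s. F (x + s *\<^sub>R v)) has_derivative (\<lambda>s. F' (s *\<^sub>R v))) (at t)"
    by (rule has_derivative_compose[where g=F]) (rule assms)
  moreover have "F' (s *\<^sub>R v) = F' v * s" for s
    using linear_scale[OF has_derivative_linear[OF assms]] by simp
  ultimately show ?thesis by (simp add: has_field_derivative_def)
qed

text \<open>Second order Maclaurin formula for
  \<open>t \<mapsto> F (x + t v) + F (x - t v) - 2 F x\<close>, whose value and slope vanish at 0.
  One intermediate parameter gives the two points \<open>y\<close> and \<open>z\<close>, symmetric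
  about \<open>x\<close>; only their closeness to \<open>x\<close> is recorded.\<close>

lemma sdiff_mean:
  fixes F :: "'a::real_normed_vector \<Rightarrow> real"
  assumes h: "h > 0" and U: "cball x (h * norm v) \<subseteq> U"
    and d1: "\<And>y. y \<in> U \<Longrightarrow> (F has_derivative F' y) (at y)"
    and d2: "\<And>y. y \<in> U \<Longrightarrow> ((\<lambda>y. F' y v) has_derivative F'' y) (at y)"
  obtains y z where "y \<in> cball x (h * norm v)" "z \<in> cball x (h * norm v)"
    "sdiff F x (h *\<^sub>R v) = h\<^sup>2 * ((F'' y v + F'' z v) / 2)"
proof -
  have seg: "x + t *\<^sub>R v \<in> cball x (h * norm v)" if "\<bar>t\<bar> \<le> h" for t
    using that by (simp add: dist_norm mult_right_mono)
  define g where "g = (\<lambda>t. F (x + t *\<^sub>R v) + F (x + t *\<^sub>R (- v)) - 2 * F x)"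
  define g1 where "g1 = (\<lambda>t. F' (x + t *\<^sub>R v) v - F' (x + t *\<^sub>R (- v)) v)"
  define g2 where "g2 = (\<lambda>t. F'' (x + t *\<^sub>R v) v + F'' (x + t *\<^sub>R (- v)) v)"
  \<comment> \<open>Maclaurin's formula asks for a whole sequence of derivatives; only the orders 0,
    1 and 2 matter here.\<close>
  define diff where "diff = (\<lambda>m. if m = 0 then g else if m = Suc 0 then g1 else g2)"
  have mem: "x + t *\<^sub>R v \<in> U" "x + t *\<^sub>R (- v) \<in> U" if "0 \<le> t" "t \<le> h" for t
    using seg[of t] seg[of "- t"] U that by auto
  have lin1: "F' y (- v) = - F' y v" if "y \<in> U" for y
    using linear_neg[OF has_derivative_linear[OF d1[OF that]]] .
  have lin2: "F'' y (- v) = - F'' y v" if "y \<in> U" for y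
    using linear_neg[OF has_derivative_linear[OF d2[OF that]]] .
  have G: "DERIV g t :> g1 t" if "0 \<le> t" "t \<le> h" for t
    unfolding g_def g1_def
    by (rule derivative_eq_intros line_derivative d1 mem[OF that] refl)+ (use mem[OF that] in \<open>simp add: lin1\<close>)
  have G1: "DERIV g1 t :> g2 t" if "0 \<le> t" "t \<le> h" for t
    unfolding g1_def g2_def
    by (rule derivative_eq_intros line_derivative[where F="\<lambda>y. F' y v"] d2 mem[OF that] refl)+ (use mem[OF that] in \<open>simp add: lin2\<close>)
  have "\<exists>t>0. t < h \<and> g h = (\<Sum>m<2. diff m 0 / fact m * h ^ m) + diff 2 t / fact 2 * h ^ 2"
    by (rule Maclaurin[OF h]) (auto simp: diff_def less_Suc_eq numeral_2_eq_2 G G1)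
  then obtain t where t: "0 < t" "t < h" and "g h = g 0 + g1 0 * h + g2 t / 2 * h\<^sup>2"
    by (auto simp: diff_def numeral_2_eq_2)
  then have "sdiff F x (h *\<^sub>R v) = h\<^sup>2 * ((F'' (x + t *\<^sub>R v) v + F'' (x + (-t) *\<^sub>R v) v) / 2)"
    by (simp add: sdiff_def g_def g1_def g2_def)
  then show ?thesis using that[OF seg[of t] seg[of "-t"]] t by simp
qed

text \<open>The centres \<open>xs k\<close> move with the step size. This is forced by the viscosity
  argument, where the second differences are evaluated at minimum points that merely converge to
  \<open>x0\<close>.\<close>

lemma sdiff_tendsto:
  fixes F :: "'a::real_normed_vector \<Rightarrow> real"
  assumes U: "open U" "x0 \<in> U"
    and d1: "\<And>y. y \<in> U \<Longrightarrow> (F has_derivative F' y) (at y)"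
    and d2: "\<And>y. y \<in> U \<Longrightarrow> ((\<lambda>y. F' y v) has_derivative F'' y) (at y)"
    and cont: "isCont (\<lambda>y. F'' y v) x0"
    and xs: "xs \<longlonglongrightarrow> x0" and hs: "hs \<longlonglongrightarrow> 0" and pos: "\<And>k::nat. hs k > 0"
  shows "(\<lambda>k. sdiff F (xs k) (hs k *\<^sub>R v) / (hs k)\<^sup>2) \<longlonglongrightarrow> F'' x0 v"
proof (rule tendstoI)
  fix e :: real assume "e > 0"
  then obtain d where d: "d > 0" "\<And>y. dist y x0 < d \<Longrightarrow> dist (F'' y v) (F'' x0 v) < e"
    using cont unfolding continuous_at_eps_delta by blast
  obtain r where r: "r > 0" "cball x0 r \<subseteq> U" using U open_contains_cball by blast
  have "(\<lambda>k. dist (xs k) x0 + hs k * norm v) \<longlonglongrightarrow> 0 + 0 * norm v"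
    by (intro tendsto_add tendsto_mult tendsto_const hs iffD1[OF tendsto_dist_iff xs])
  then have "\<forall>\<^sub>F k in sequentially. dist (xs k) x0 + hs k * norm v < min d r"
    by (rule order_tendstoD) (use d r in auto)
  then show "\<forall>\<^sub>F k in sequentially. dist (sdiff F (xs k) (hs k *\<^sub>R v) / (hs k)\<^sup>2) (F'' x0 v) < e"
  proof eventually_elim
    fix k assume k: "dist (xs k) x0 + hs k * norm v < min d r"
    have near: "dist y x0 < min d r" if "y \<in> cball (xs k) (hs k * norm v)" for y
      using that k dist_triangle[of y x0 "xs k"] by (simp add: dist_commute)
    then have sub: "cball (xs k) (hs k * norm v) \<subseteq> U"
      using r by (force simp: dist_commute)
    obtain y z where yz: "y \<in> cball (xs k) (hs k * norm v)" "z \<in> cball (xs k) (hs k * norm v)"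
      "sdiff F (xs k) (hs k *\<^sub>R v) = (hs k)\<^sup>2 * ((F'' y v + F'' z v) / 2)"
      using sdiff_mean[OF pos sub d1 d2] by blast
    then have eq: "sdiff F (xs k) (hs k *\<^sub>R v) / (hs k)\<^sup>2 = (F'' y v + F'' z v) / 2"
      using pos[of k] by simp
    have "\<bar>F'' y v - F'' x0 v\<bar> < e" "\<bar>F'' z v - F'' x0 v\<bar> < e"
      using d(2)[of y] d(2)[of z] near yz by (auto simp: dist_real_def)
    then show "dist (sdiff F (xs k) (hs k *\<^sub>R v) / (hs k)\<^sup>2) (F'' x0 v) < e"
      unfolding eq dist_real_def by (simp add: abs_less_iff field_simps)
  qed
qed

lemma second_derivative_test:
  fixes g G :: "real \<Rightarrow> real"
  assumes d: "d > 0" and min: "\<And>t. \<bar>t\<bar> < d \<Longrightarrow> g 0 \<le> g t"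
    and g: "\<And>t. \<bar>t\<bar> < d \<Longrightarrow> DERIV g t :> G t" and G: "DERIV G 0 :> c"
  shows "c \<ge> 0"
proof (rule ccontr)
  assume "\<not> c \<ge> 0"
  then have "c < 0" by simp
  have G0: "G 0 = 0"
    by (rule DERIV_local_min[OF g d]) (use d min in auto)
  obtain d' where d': "d' > 0" "\<And>h. h > 0 \<Longrightarrow> h < d' \<Longrightarrow> G h < 0"
    using DERIV_neg_dec_right[OF G \<open>c < 0\<close>] G0 by auto
  define h where "h = min d d' / 2"
  have h: "0 < h" "h < d" "h < d'" using d d' by (auto simp: h_def)
  obtain z where z: "0 < z" "z < h" "g h - g 0 = (h - 0) * G z"
    using MVT2[OF h(1), of g G] g h by force
  have "h * G z < 0" using d'(2)[of z] z h by (simp add: mult_less_0_iff)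
  then show False using z min[of h] h by auto
qed

section \<open>Gradients in coordinates, symmetry of second derivatives\<close>

lemma has_derivative_grad:
  assumes "h differentiable (at x)"
  shows "(h has_derivative (\<lambda>v. grad h x \<bullet> v)) (at x)"
proof -
  let ?D = "frechet_derivative h (at x)"
  have D: "(h has_derivative ?D) (at x)" using assms frechet_derivative_works by blast
  have "?D v = grad h x \<bullet> v" for v
  proof -
    have "?D v = ?D (\<Sum>i\<in>UNIV. v $ i *\<^sub>R axis i 1)"
      using basis_expansion[of v] by (simp add: scalar_mult_eq_scaleR)
    also have "\<dots> = (\<Sum>i\<in>UNIV. v $ i * ?D (axis i 1))"
      using has_derivative_linear[OF D] by (simp add: linear_sum linear_scale)
    finally show ?thesis by (simp add: grad_def partial_deriv_def inner_vec_def mult.commute)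
  qed
  then have "?D = (\<lambda>v. grad h x \<bullet> v)" by blast
  then show ?thesis using D by simp
qed

lemma partial_deriv_eqI:
  assumes "(h has_derivative h') (at x)"
  shows "partial_deriv i h x = h' (axis i 1)"
  unfolding partial_deriv_def using frechet_derivative_at[OF assms] by simp

lemma partial_deriv_cong_open:
  assumes "open S" "x \<in> S" "\<And>y. y \<in> S \<Longrightarrow> f y = g y" "f differentiable (at x)"
  shows "partial_deriv i f x = partial_deriv i g x"
proof -
  have "(f has_derivative frechet_derivative f (at x)) (at x)"
    using assms(4) frechet_derivative_works by blast
  moreover have "(g has_derivative frechet_derivative f (at x)) (at x)"
    using has_derivative_transform_within_open[OF calculation assms(1,2)] assms(3) by blast
  ultimately show ?thesis using partial_deriv_eqI by metis
qed

text \<open>Two applications of the mean value theorem: along axis \<open>i\<close> to the increment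
  in direction \<open>j\<close>, then along axis \<open>j\<close> to the partial derivative
  obtained. Only the derivative in this one order enters, so that the two orders can be compared
  afterwards.\<close>

lemma mixed_difference_tendsto:
  fixes F :: "real^'n \<Rightarrow> real"
  assumes S: "open S" "x \<in> S" and F: "\<And>y. y \<in> S \<Longrightarrow> F differentiable (at y)"
    and Fi: "\<And>y. y \<in> S \<Longrightarrow> partial_deriv i F differentiable (at y)"
    and cont: "continuous_on S (partial_deriv j (partial_deriv i F))"
    and hs: "hs \<longlonglongrightarrow> 0" and pos: "\<And>k::nat. hs k > 0"
  shows "(\<lambda>k. (F (x + hs k *\<^sub>R axis i 1 + hs k *\<^sub>R axis j 1) - F (x + hs k *\<^sub>R axis i 1)
     - F (x + hs k *\<^sub>R axis j 1) + F x) / (hs k)\<^sup>2) \<longlonglongrightarrow> partial_deriv j (partial_deriv i F) x"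
proof (rule tendstoI)
  let ?D = "partial_deriv j (partial_deriv i F)"
  fix e :: real assume "e > 0"
  have "isCont ?D x" using cont S by (simp add: continuous_on_eq_continuous_at)
  then obtain d where d: "d > 0" "\<And>y. dist y x < d \<Longrightarrow> dist (?D y) (?D x) < e"
    using \<open>e > 0\<close> unfolding continuous_at_eps_delta by blast
  obtain r where r: "r > 0" "cball x r \<subseteq> S" using S open_contains_cball by blast
  have "\<forall>\<^sub>F k in sequentially. hs k < min d r / 2"
    by (rule order_tendstoD[OF hs]) (use d r in auto)
  then show "\<forall>\<^sub>F k in sequentially. dist ((F (x + hs k *\<^sub>R axis i 1 + hs k *\<^sub>R axis j 1) - F (x + hs k *\<^sub>R axis i 1)
     - F (x + hs k *\<^sub>R axis j 1) + F x) / (hs k)\<^sup>2) (?D x) < e"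
  proof eventually_elim
    fix k assume k: "hs k < min d r / 2"
    define h where "h = hs k"
    have h: "h > 0" "h < min d r / 2" using k pos by (auto simp: h_def)
    let ?a = "axis i 1 :: real^'n" and ?b = "axis j 1 :: real^'n"
    have near: "dist (x + s *\<^sub>R ?a + t *\<^sub>R ?b) x < min d r" if "0 \<le> s" "s \<le> h" "0 \<le> t" "t \<le> h" for s t
    proof -
      have "dist (x + s *\<^sub>R ?a + t *\<^sub>R ?b) x = norm (s *\<^sub>R ?a + t *\<^sub>R ?b)" by (simp add: dist_norm)
      also have "\<dots> \<le> s + t" using norm_triangle_ineq[of "s *\<^sub>R ?a" "t *\<^sub>R ?b"] that by (simp add: norm_axis_1)
      also have "\<dots> < min d r" using that h by linarith
      finally show ?thesis .
    qed
    have inS: "x + s *\<^sub>R ?a + t *\<^sub>R ?b \<in> S" if "0 \<le> s" "s \<le> h" "0 \<le> t" "t \<le> h" for s t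
      using near[OF that] r(2) by (force simp: dist_commute)
    define \<phi> where "\<phi> = (\<lambda>s. F ((x + h *\<^sub>R ?b) + s *\<^sub>R ?a) - F (x + s *\<^sub>R ?a))"
    define \<phi>' where "\<phi>' = (\<lambda>s. partial_deriv i F ((x + h *\<^sub>R ?b) + s *\<^sub>R ?a) - partial_deriv i F (x + s *\<^sub>R ?a))"
    have pd: "(G has_derivative frechet_derivative G (at y)) (at y)" if "G differentiable (at y)" for G :: "real^'n \<Rightarrow> real" and y
      using that frechet_derivative_works by blast
    have "DERIV \<phi> s :> \<phi>' s" if "0 \<le> s" "s \<le> h" for s
      unfolding \<phi>_def \<phi>'_def partial_deriv_def
      by (intro derivative_intros line_derivative pd F)
        (use inS[of s h] inS[of s 0] that h in \<open>auto simp: ac_simps\<close>)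
    then obtain s where s: "0 < s" "s < h" "\<phi> h - \<phi> 0 = (h - 0) * \<phi>' s"
      using MVT2[OF h(1), of \<phi> \<phi>'] by blast
    define \<omega> where "\<omega> = (\<lambda>t. partial_deriv i F ((x + s *\<^sub>R ?a) + t *\<^sub>R ?b))"
    have "DERIV \<omega> t :> ?D ((x + s *\<^sub>R ?a) + t *\<^sub>R ?b)" if "0 \<le> t" "t \<le> h" for t
      unfolding \<omega>_def partial_deriv_def[of j]
      by (intro line_derivative pd Fi) (use inS[of s t] that s in auto)
    then obtain t where t: "0 < t" "t < h" "\<omega> h - \<omega> 0 = (h - 0) * ?D ((x + s *\<^sub>R ?a) + t *\<^sub>R ?b)"
      using MVT2[OF h(1), of \<omega> "\<lambda>t. ?D ((x + s *\<^sub>R ?a) + t *\<^sub>R ?b)"] by blast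
    have "\<phi>' s = \<omega> h - \<omega> 0" by (simp add: \<phi>'_def \<omega>_def ac_simps)
    then have "F (x + h *\<^sub>R ?a + h *\<^sub>R ?b) - F (x + h *\<^sub>R ?a) - F (x + h *\<^sub>R ?b) + F x
       = h\<^sup>2 * ?D (x + s *\<^sub>R ?a + t *\<^sub>R ?b)"
      using s(3) t(3) by (simp add: \<phi>_def power2_eq_square ac_simps)
    then have "(F (x + h *\<^sub>R ?a + h *\<^sub>R ?b) - F (x + h *\<^sub>R ?a) - F (x + h *\<^sub>R ?b) + F x) / h\<^sup>2
       = ?D (x + s *\<^sub>R ?a + t *\<^sub>R ?b)" using h by simp
    then show "dist ((F (x + hs k *\<^sub>R axis i 1 + hs k *\<^sub>R axis j 1) - F (x + hs k *\<^sub>R axis i 1)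
     - F (x + hs k *\<^sub>R axis j 1) + F x) / (hs k)\<^sup>2) (?D x) < e"
      using d(2)[of "x + s *\<^sub>R ?a + t *\<^sub>R ?b"] near[of s t] s t by (simp add: h_def)
  qed
qed

text \<open>The mixed difference is symmetric in the two axes and converges to both iterated
  derivatives.\<close>

lemma partial_deriv_commute:
  fixes F :: "real^'n \<Rightarrow> real"
  assumes S: "open S" "x \<in> S" and F: "Ck_on 2 S F"
  shows "partial_deriv j (partial_deriv i F) x = partial_deriv i (partial_deriv j F) x"
proof -
  have d: "\<And>y. y \<in> S \<Longrightarrow> F differentiable (at y)"
    "\<And>i y. y \<in> S \<Longrightarrow> partial_deriv i F differentiable (at y)"
    "\<And>i j. continuous_on S (partial_deriv j (partial_deriv i F))"
    using F by (auto simp: numeral_2_eq_2)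
  define hs where "hs = (\<lambda>k::nat. inverse (real (Suc k)))"
  have hs: "hs \<longlonglongrightarrow> 0" "\<And>k. hs k > 0" unfolding hs_def by (rule LIMSEQ_inverse_real_of_nat) simp
  have "(\<lambda>k. (F (x + hs k *\<^sub>R axis j 1 + hs k *\<^sub>R axis i 1) - F (x + hs k *\<^sub>R axis j 1)
     - F (x + hs k *\<^sub>R axis i 1) + F x) / (hs k)\<^sup>2) = (\<lambda>k. (F (x + hs k *\<^sub>R axis i 1 + hs k *\<^sub>R axis j 1) - F (x + hs k *\<^sub>R axis i 1)
     - F (x + hs k *\<^sub>R axis j 1) + F x) / (hs k)\<^sup>2)"
    by (simp add: algebra_simps)
  then show ?thesis
    using mixed_difference_tendsto[OF S d(1) d(2) d(3) hs, of j i]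
      LIMSEQ_unique[OF _ mixed_difference_tendsto[OF S d(1) d(2) d(3) hs, of i j]]
    by simp
qed

section \<open>Functions of class C3 and the viscosity inequality\<close>

text \<open>A coordinate-free record of the derivatives of \<open>u\<close>: gradient
  \<open>p\<close>, Hessian \<open>H\<close>, and \<open>D x v a\<close>, the derivative of
  \<open>H x *v a\<close> in direction \<open>v\<close>. \<open>D_commute\<close> and
  \<open>D_sym\<close> together make \<open>D x v a \<bullet> b\<close> a totally symmetric
  trilinear form.\<close>

locale C3_function =
  fixes S :: "(real^'n) set" and u :: "real^'n \<Rightarrow> real" and p :: "real^'n \<Rightarrow> real^'n"
    and H :: "real^'n \<Rightarrow> real^'n^'n" and D :: "real^'n \<Rightarrow> real^'n \<Rightarrow> real^'n \<Rightarrow> real^'n"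
  assumes open_S: "open S"
    and u_deriv: "x \<in> S \<Longrightarrow> (u has_derivative (\<lambda>v. p x \<bullet> v)) (at x)"
    and p_deriv: "x \<in> S \<Longrightarrow> (p has_derivative (\<lambda>v. H x *v v)) (at x)"
    and H_sym: "x \<in> S \<Longrightarrow> sym_mat (H x)"
    and H_deriv: "x \<in> S \<Longrightarrow> ((\<lambda>y. H y *v a) has_derivative (\<lambda>v. D x v a)) (at x)"
    and D_commute: "x \<in> S \<Longrightarrow> D x v a = D x a v"
    and D_sym: "x \<in> S \<Longrightarrow> D x v a \<bullet> b = D x v b \<bullet> a"
    and D_cont: "continuous_on S (\<lambda>x. D x v a)"

lemma has_derivative_vec_lambda:
  fixes f :: "'a::real_normed_vector \<Rightarrow> real^'n"
  assumes "\<And>i. ((\<lambda>x. f x $ i) has_derivative (\<lambda>v. f' v $ i)) (at x)"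
  shows "(f has_derivative f') (at x)"
proof -
  have "((\<lambda>x. f x \<bullet> b) has_derivative (\<lambda>v. f' v \<bullet> b)) (at x)" if b: "b \<in> Basis" for b
  proof -
    obtain i where "b = axis i 1" using b by (auto simp: Basis_vec_def)
    then show ?thesis using assms[of i] by (simp add: inner_axis)
  qed
  then show ?thesis using has_derivative_componentwise_within[of f f' x UNIV] by simp
qed

lemma C31_imp_C3_function:
  fixes S :: "(real^'n) set"
  assumes S: "open S" and u: "Ck_on 3 S u"
  obtains D where "C3_function S u (grad u) (hessian u) D"
proof -
  let ?d2 = "\<lambda>i j. partial_deriv i (partial_deriv j u)"
  let ?d3 = "\<lambda>k i j. partial_deriv k (partial_deriv i (partial_deriv j u))"
  have d: "\<And>y. y \<in> S \<Longrightarrow> u differentiable (at y)"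
    "\<And>i y. y \<in> S \<Longrightarrow> partial_deriv i u differentiable (at y)"
    "\<And>i j y. y \<in> S \<Longrightarrow> ?d2 i j differentiable (at y)"
    "\<And>i j k. continuous_on S (?d3 k i j)"
    using u by (auto simp: numeral_3_eq_3)
  have diffc: "continuous_on S f" if "\<And>y. y \<in> S \<Longrightarrow> f differentiable (at y)" for f :: "real^'n \<Rightarrow> real"
    by (intro continuous_at_imp_continuous_on ballI differentiable_imp_continuous_within that)
  have C2: "Ck_on 2 S u" and C2': "Ck_on 2 S (partial_deriv j u)" for j
    using d diffc by (auto simp: numeral_2_eq_2)
  have s1: "?d2 i j x = ?d2 j i x" if "x \<in> S" for x i j
    by (rule partial_deriv_commute[OF S that C2])
  \<comment> \<open>\<open>s2\<close> exchanges the two outer derivatives of a first derivative,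
    \<open>s3\<close> differentiates the symmetry of the Hessian; these two transpositions generate
    all permutations of the three indices.\<close>
  have s2: "?d3 k i j x = ?d3 i k j x" if "x \<in> S" for x i j k
    by (rule partial_deriv_commute[OF S that C2'])
  have s3: "?d3 k i j x = ?d3 k j i x" if "x \<in> S" for x i j k
    by (rule partial_deriv_cong_open[OF S that s1 d(3)[OF that]])
  define D where "D = (\<lambda>x v a. (\<chi> i. \<Sum>j\<in>UNIV. \<Sum>k\<in>UNIV. v $ k * a $ j * ?d3 k i j x) :: real^'n)"
  have "C3_function S u (grad u) (hessian u) D"
  proof
    show "open S" by fact
    fix x v a b assume x: "x \<in> S"
    show "(u has_derivative (\<lambda>v. grad u x \<bullet> v)) (at x)" by (rule has_derivative_grad[OF d(1)[OF x]])
    show "sym_mat (hessian u x)"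
      unfolding sym_mat_def hessian_def transpose_def using s1[OF x] by (simp add: vec_eq_iff)
    show "(grad u has_derivative (\<lambda>v. hessian u x *v v)) (at x)"
    proof (rule has_derivative_vec_lambda)
      fix i
      have "grad (partial_deriv i u) x \<bullet> v = (hessian u x *v v) $ i" for v
        unfolding grad_def hessian_def matrix_vector_mult_def inner_vec_def using s1[OF x] by simp
      then show "((\<lambda>x. grad u x $ i) has_derivative (\<lambda>v. (hessian u x *v v) $ i)) (at x)"
        using has_derivative_grad[OF d(2)[OF x, of i]] by (simp add: grad_def)
    qed
    show "((\<lambda>y. hessian u y *v a) has_derivative (\<lambda>v. D x v a)) (at x)"
    proof (rule has_derivative_vec_lambda)
      fix i
      have "((\<lambda>y. \<Sum>j\<in>UNIV. ?d2 i j y * a $ j) has_derivative (\<lambda>v. \<Sum>j\<in>UNIV. (grad (?d2 i j) x \<bullet> v) * a $ j)) (at x)"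
        by (intro has_derivative_sum has_derivative_mult_left has_derivative_grad d x)
      moreover have "(\<Sum>j\<in>UNIV. (grad (?d2 i j) x \<bullet> v) * a $ j) = D x v a $ i" for v
        by (simp add: D_def grad_def inner_vec_def sum_distrib_right sum_distrib_left mult_ac)
      ultimately show "((\<lambda>y. (hessian u y *v a) $ i) has_derivative (\<lambda>v. D x v a $ i)) (at x)"
        by (simp add: hessian_def matrix_vector_mult_def)
    qed
    have s23: "?d3 k i j x = ?d3 j i k x" for i j k
      by (metis s2[OF x] s3[OF x])
    show "D x v a = D x a v"
    proof -
      have "(\<Sum>j\<in>UNIV. \<Sum>k\<in>UNIV. v $ k * a $ j * ?d3 k i j x) = (\<Sum>j\<in>UNIV. \<Sum>k\<in>UNIV. a $ k * v $ j * ?d3 k i j x)" for i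
        by (subst sum.swap) (intro sum.cong refl, simp add: s23[of _ i] mult_ac)
      then show ?thesis by (simp add: D_def)
    qed
    show "D x v a \<bullet> b = D x v b \<bullet> a"
    proof -
      have "D x v a \<bullet> b = (\<Sum>i\<in>UNIV. \<Sum>j\<in>UNIV. \<Sum>k\<in>UNIV. v $ k * a $ j * b $ i * ?d3 k i j x)"
        by (simp add: D_def inner_vec_def sum_distrib_right sum_distrib_left mult_ac)
      also have "\<dots> = (\<Sum>i\<in>UNIV. \<Sum>j\<in>UNIV. \<Sum>k\<in>UNIV. v $ k * b $ j * a $ i * ?d3 k i j x)"
        by (subst sum.swap) (intro sum.cong refl, simp add: s3[OF x] mult_ac)
      also have "\<dots> = D x v b \<bullet> a"
        by (simp add: D_def inner_vec_def sum_distrib_right sum_distrib_left mult_ac)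
      finally show ?thesis .
    qed
  next
    fix v a
    show "continuous_on S (\<lambda>x. D x v a)"
      unfolding D_def by (intro continuous_intros d)
  qed
  then show ?thesis using that by blast
qed

section \<open>Traces, and the twice differentiated equation in the viscosity sense\<close>

lemma tendsto_trace:
  fixes M :: "'b \<Rightarrow> real^'n^'n"
  assumes "(M \<longlongrightarrow> N) F"
  shows "((\<lambda>x. trace (M x)) \<longlongrightarrow> trace N) F"
  unfolding trace_def by (intro tendsto_intros assms)

lemma tendsto_matrix_mult:
  fixes M N :: "'b \<Rightarrow> real^'n^'n"
  assumes "(M \<longlongrightarrow> A) F" "(N \<longlongrightarrow> B) F"
  shows "((\<lambda>x. M x ** N x) \<longlongrightarrow> A ** B) F"
  unfolding matrix_matrix_mult_def by (intro tendsto_intros tendsto_vec_lambda assms)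

lemma trace_mult_linear:
  fixes M A B :: "real^'n^'n"
  shows "trace (M ** (A + B)) = trace (M ** A) + trace (M ** B)"
    and "trace (M ** (A - B)) = trace (M ** A) - trace (M ** B)"
    and "trace (M ** (c *\<^sub>R A)) = c * trace (M ** A)"
  by (simp_all add: trace_def matrix_matrix_mult_def sum.distrib sum_subtractf sum_distrib_left algebra_simps)

context C3_function begin

lemma Hvv_deriv:
  assumes "x \<in> S"
  shows "((\<lambda>y. p y \<bullet> v) has_derivative (\<lambda>h. (H x *v v) \<bullet> h)) (at x)"
proof -
  have "((\<lambda>y. p y \<bullet> v) has_derivative (\<lambda>h. (H x *v h) \<bullet> v)) (at x)"
    by (intro has_derivative_inner_left p_deriv assms)
  moreover have "(H x *v h) \<bullet> v = (H x *v v) \<bullet> h" for h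
    using sym_mat_inner[OF H_sym[OF assms], of v h] by (simp add: inner_commute)
  ultimately show ?thesis by simp
qed

lemma continuous_Hv: "continuous_on S (\<lambda>x. H x *v a)"
  by (intro continuous_at_imp_continuous_on ballI has_derivative_continuous[OF H_deriv])

lemma H_mult_diff: "sdiff H x y *v a = sdiff (\<lambda>z. H z *v a) x y"
  by (simp add: sdiff_def matrix_vector_mult_add_rdistrib matrix_vector_mult_diff_rdistrib scaleR_matrix_vector_assoc)

text \<open>Fourth derivatives of \<^term>\<open>u\<close> need not exist, so the twice differentiated equation is used in the
  viscosity sense: second difference quotients of \<^term>\<open>u\<close> along \<^term>\<open>\<xi>\<close> are twice differentiable and
  satisfy a linear inequality by concavity of the logarithm of the determinant, which passes to the limit
  at a point where the second derivative along \<^term>\<open>\<xi>\<close> is touched from below.\<close>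

lemma viscosity_inequality:
  fixes a :: "real^'n \<Rightarrow> real^'n^'n" and \<xi> :: "real^'n" and N \<alpha> W0 :: "real^'n^'n"
  assumes x0: "x0 \<in> S"
    and w: "\<And>x. x \<in> S \<Longrightarrow> pos_def (a x - H x)"
    and acont: "continuous_on S a"
    and a2: "\<And>xs hs. xs \<longlonglongrightarrow> x0 \<Longrightarrow> hs \<longlonglongrightarrow> 0 \<Longrightarrow> (\<And>k::nat. hs k > 0) \<Longrightarrow>
        (\<lambda>k. sdiff a (xs k) (hs k *\<^sub>R \<xi>) /\<^sub>R (hs k)\<^sup>2) \<longlonglongrightarrow> \<alpha>"
    and psi: "\<And>x. x \<in> S \<Longrightarrow> \<psi> x = ln (det (a x - H x))"
    and psi2: "\<And>xs hs e. xs \<longlonglongrightarrow> x0 \<Longrightarrow> hs \<longlonglongrightarrow> 0 \<Longrightarrow> (\<And>k::nat. hs k > 0) \<Longrightarrow> e > 0 \<Longrightarrow>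
        \<forall>\<^sub>F k in sequentially. sdiff \<psi> (xs k) (hs k *\<^sub>R \<xi>) / (hs k)\<^sup>2 \<ge> \<beta> - e"
    and touch: "\<And>\<delta>. \<delta> > 0 \<Longrightarrow> \<forall>\<^sub>F x in nhds x0. \<xi> \<bullet> (H x *v \<xi>) \<ge> \<xi> \<bullet> (H x0 *v \<xi>) + b \<bullet> (x - x0)
         + (x - x0) \<bullet> (N *v (x - x0)) / 2 - \<delta> * (norm (x - x0))\<^sup>2"
    and W0: "W0 ** (a x0 - H x0) = mat 1"
  shows "trace (W0 ** (\<alpha> - N)) \<ge> \<beta>"
proof (rule field_le_epsilon)
  fix e' :: real assume e': "e' > 0"
  define w where "w = (\<lambda>x. a x - H x)"
  define e where "e = e' / 2"
  \<comment> \<open>The final error is split in halves: \<open>e\<close> for the second differences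
    of \<open>\<psi>\<close>, and \<open>4 * \<delta> * trace W0 \<le> e\<close> for the
    perturbation of the test function.\<close>
  define \<delta> where "\<delta> = e' / (8 * (\<bar>trace W0\<bar> + 1))"
  have e: "e > 0" "\<delta> > 0" using e' by (auto simp: e_def \<delta>_def intro!: divide_pos_pos)
  define q where "q = (\<lambda>x. \<xi> \<bullet> (H x0 *v \<xi>) + b \<bullet> (x - x0) + (x - x0) \<bullet> (N *v (x - x0)) / 2)"
  obtain r1 where r1: "r1 > 0" "\<And>x. dist x x0 < r1 \<Longrightarrow> \<xi> \<bullet> (H x *v \<xi>) \<ge> q x - \<delta> * (norm (x - x0))\<^sup>2"
    using touch[OF e(2)] unfolding eventually_nhds_metric q_def by blast
  obtain r2 where r2: "r2 > 0" "cball x0 r2 \<subseteq> S" using open_S x0 open_contains_cball by blast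
  define r where "r = min r1 r2 / 3"
  have r: "r > 0" "\<And>x. x \<in> cball x0 (2 * r) \<Longrightarrow> x \<in> S" "\<And>x. x \<in> cball x0 (2 * r) \<Longrightarrow> dist x x0 < r1"
    using r1 r2 by (auto simp: r_def dist_commute subset_iff)
  \<comment> \<open>Steps tending to 0, scaled so that a shift by
    \<open>hs k *\<^sub>R \<xi>\<close> has length at most \<open>r\<close> and leads from
    \<open>cball x0 r\<close> into \<open>cball x0 (2 * r)\<close>.\<close>
  define hs where "hs = (\<lambda>k::nat. (r / (norm \<xi> + 1)) * inverse (real (Suc k)))"
  have hpos: "hs k > 0" for k
    using r unfolding hs_def by (intro mult_pos_pos divide_pos_pos) (auto simp: add_nonneg_pos)
  have hlim: "hs \<longlonglongrightarrow> 0"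
    unfolding hs_def using tendsto_mult_right_zero[OF LIMSEQ_inverse_real_of_nat] by blast
  have hle: "hs k * norm \<xi> \<le> r" for k
  proof -
    have "hs k \<le> r / (norm \<xi> + 1)"
      unfolding hs_def using r by (intro mult_left_le) (auto simp: field_simps intro!: divide_nonneg_pos add_nonneg_pos)
    then have "hs k * norm \<xi> \<le> r / (norm \<xi> + 1) * (norm \<xi> + 1)"
      using hpos[of k] r by (intro mult_mono) auto
    also have "\<dots> = r" by (simp add: add_nonneg_eq_0_iff)
    finally show ?thesis .
  qed
  \<comment> \<open>Touching holds up to an error \<open>\<delta>\<close> times the squared
    distance. Adding twice this amount leaves a strict minimum at \<open>x0\<close> in the limit and
    so forces the minimum points of \<open>f k\<close> to converge to \<open>x0\<close>.\<close>
  define f where "f = (\<lambda>k x. sdiff u x (hs k *\<^sub>R \<xi>) / (hs k)\<^sup>2 - q x + 2 * \<delta> * (norm (x - x0))\<^sup>2)"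
  have shift: "x + hs k *\<^sub>R \<xi> \<in> S" "x - hs k *\<^sub>R \<xi> \<in> S" "x \<in> S" "cball x (hs k * norm \<xi>) \<subseteq> cball x0 (2 * r)"
    if "x \<in> cball x0 r" for x k
  proof -
    show sub: "cball x (hs k * norm \<xi>) \<subseteq> cball x0 (2 * r)"
      using that hle[of k] by (intro cball_subset_cball_iff[THEN iffD2]) (auto simp: dist_commute)
    have "x + hs k *\<^sub>R \<xi> \<in> cball x (hs k * norm \<xi>)" "x - hs k *\<^sub>R \<xi> \<in> cball x (hs k * norm \<xi>)"
      using hpos[of k] by (auto simp: dist_norm)
    then show "x + hs k *\<^sub>R \<xi> \<in> S" "x - hs k *\<^sub>R \<xi> \<in> S" using sub r(2) by blast+
    show "x \<in> S" using that r by auto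
  qed
  have ucont: "continuous_on S u"
    by (intro continuous_at_imp_continuous_on ballI has_derivative_continuous[OF u_deriv])
  have "continuous_on (cball x0 r) (f k)" for k
    unfolding f_def sdiff_def q_def
    by (intro continuous_intros continuous_on_compose2[OF ucont] matrix_vector_mult_linear_continuous_on
        continuous_on_compose2[OF matrix_vector_mult_linear_continuous_on[of UNIV N]])
      (use shift hpos in \<open>auto simp: less_imp_neq[symmetric]\<close>)
  moreover have "compact (cball x0 r)" "cball x0 r \<noteq> {}" using r by auto
  ultimately have "\<exists>x. x \<in> cball x0 r \<and> (\<forall>y\<in>cball x0 r. f k x \<le> f k y)" for k
    using continuous_attains_inf[of "cball x0 r" "f k"] by blast
  then obtain xs where xs: "\<And>k. xs k \<in> cball x0 r" "\<And>k y. y \<in> cball x0 r \<Longrightarrow> f k (xs k) \<le> f k y"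
    by metis
  have xlim: "xs \<longlonglongrightarrow> x0"
  proof (rule metric_LIMSEQ_I)
    fix \<eta> :: real assume \<eta>: "\<eta> > 0"
    \<comment> \<open>Uniform tolerance between the second difference quotient of \<open>u\<close>
      and its second derivative; it is spent once at \<open>x0\<close> and once at
      \<open>xs k\<close>, and \<open>2 * \<omega>\<close> is less than
      \<open>\<delta> * \<eta>\<^sup>2\<close>.\<close>
    define \<omega> where "\<omega> = \<delta> * \<eta>\<^sup>2 / 4"
    have \<omega>: "\<omega> > 0" using e \<eta> by (simp add: \<omega>_def)
    have "uniformly_continuous_on (cball x0 (2*r)) (\<lambda>x. \<xi> \<bullet> (H x *v \<xi>))"
      by (intro compact_uniformly_continuous continuous_intros continuous_on_subset[OF continuous_Hv])
        (use r in auto)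
    then obtain d where d: "d > 0" "\<And>x y. x \<in> cball x0 (2*r) \<Longrightarrow> y \<in> cball x0 (2*r) \<Longrightarrow> dist y x < d \<Longrightarrow>
        dist (\<xi> \<bullet> (H y *v \<xi>)) (\<xi> \<bullet> (H x *v \<xi>)) < \<omega>"
      unfolding uniformly_continuous_on_def using \<omega> by metis
    have "(\<lambda>k. hs k * norm \<xi>) \<longlonglongrightarrow> 0" using tendsto_mult_right[OF hlim, of "norm \<xi>"] by simp
    then have "\<forall>\<^sub>F k in sequentially. hs k * norm \<xi> < d" using d order_tendstoD by blast
    then obtain K where K: "\<And>k. k \<ge> K \<Longrightarrow> hs k * norm \<xi> < d" unfolding eventually_sequentially by blast
    have "dist (xs k) x0 < \<eta>" if "k \<ge> K" for k
    proof -
      have close: "\<bar>sdiff u x (hs k *\<^sub>R \<xi>) / (hs k)\<^sup>2 - \<xi> \<bullet> (H x *v \<xi>)\<bar> < \<omega>" if x: "x \<in> cball x0 r" for x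
      proof -
        have "cball x (hs k * norm \<xi>) \<subseteq> S" using shift(4)[OF x, of k] r(2) by blast
        then obtain y z where yz: "y \<in> cball x (hs k * norm \<xi>)" "z \<in> cball x (hs k * norm \<xi>)"
          "sdiff u x (hs k *\<^sub>R \<xi>) = (hs k)\<^sup>2 * (((H y *v \<xi>) \<bullet> \<xi> + (H z *v \<xi>) \<bullet> \<xi>) / 2)"
          using sdiff_mean[OF hpos _ u_deriv Hvv_deriv, of x k \<xi>] by metis
        have "\<bar>\<xi> \<bullet> (H y *v \<xi>) - \<xi> \<bullet> (H x *v \<xi>)\<bar> < \<omega>" "\<bar>\<xi> \<bullet> (H z *v \<xi>) - \<xi> \<bullet> (H x *v \<xi>)\<bar> < \<omega>"
          using d(2)[of x y] d(2)[of x z] yz K[OF \<open>k \<ge> K\<close>] shift(4)[OF x, of k] x r(1)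
          by (auto simp: dist_real_def dist_commute subset_iff)
        moreover have "sdiff u x (hs k *\<^sub>R \<xi>) / (hs k)\<^sup>2 = (\<xi> \<bullet> (H y *v \<xi>) + \<xi> \<bullet> (H z *v \<xi>)) / 2"
          using yz(3) hpos[of k] by (simp add: inner_commute)
        ultimately show ?thesis by (simp add: abs_less_iff field_simps)
      qed
      have x0r: "x0 \<in> cball x0 r" using r by simp
      have "f k (xs k) \<le> f k x0" using xs(2) x0r by blast
      moreover have "f k x0 < \<omega>" using close[OF x0r] by (simp add: f_def q_def)
      moreover have "f k (xs k) > \<delta> * (norm (xs k - x0))\<^sup>2 - \<omega>"
      proof -
        have "\<xi> \<bullet> (H (xs k) *v \<xi>) \<ge> q (xs k) - \<delta> * (norm (xs k - x0))\<^sup>2"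
          using r1(2) r(3)[of "xs k"] xs(1)[of k] r(1) by auto
        then show ?thesis using close[OF xs(1)[of k]] by (simp add: f_def abs_less_iff)
      qed
      ultimately have "\<delta> * (norm (xs k - x0))\<^sup>2 < 2 * \<omega>" by linarith
      also have "\<dots> < \<delta> * \<eta>\<^sup>2" using e \<eta> by (simp add: \<omega>_def)
      finally have "(norm (xs k - x0))\<^sup>2 < \<eta>\<^sup>2" using e by simp
      then show ?thesis using \<eta> by (metis dist_norm less_imp_le power_less_imp_less_base)
    qed
    then show "\<exists>no. \<forall>n\<ge>no. dist (xs n) x0 < \<eta>" by blast
  qed
  define \<Delta> where "\<Delta> = (\<lambda>k. sdiff H (xs k) (hs k *\<^sub>R \<xi>) /\<^sub>R (hs k)\<^sup>2)"
  \<comment> \<open>As a quadratic form this is the second derivative of \<open>f k\<close> at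
    \<open>xs k\<close>: differentiating the second difference of \<open>u\<close> twice gives the
    second difference of \<open>H\<close>, so no fourth derivative appears. It is nonnegative at an
    interior minimum.\<close>
  define X where "X = (\<lambda>k. \<Delta> k - N + (4 * \<delta>) *\<^sub>R mat 1)"
  have Xpos: "v \<bullet> (X k *v v) \<ge> 0" if k: "dist (xs k) x0 < r" for k v
  proof -
    define d where "d = (r - dist (xs k) x0) / (norm v + 1)"
    have d: "d > 0" using k unfolding d_def by (intro divide_pos_pos) (auto simp: add_nonneg_pos)
    have seg: "xs k + t *\<^sub>R v \<in> cball x0 r" if "\<bar>t\<bar> < d" for t
    proof -
      have "\<bar>t\<bar> * norm v \<le> d * (norm v + 1)" using that by (intro mult_mono) auto
      also have "\<dots> = r - dist (xs k) x0" by (simp add: d_def add_nonneg_eq_0_iff)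
      finally have "norm (t *\<^sub>R v) \<le> r - dist (xs k) x0" by simp
      then show ?thesis using norm_triangle_ineq[of "xs k - x0" "t *\<^sub>R v"]
        by (simp add: dist_norm norm_minus_commute algebra_simps)
    qed
    define z where "z = xs k - x0"
    define g where "g = (\<lambda>t. f k (xs k + t *\<^sub>R v))"
    define G where "G = (\<lambda>t. sdiff (\<lambda>y. p y \<bullet> v) (xs k + t *\<^sub>R v) (hs k *\<^sub>R \<xi>) / (hs k)\<^sup>2 - 
        (b \<bullet> v + (v \<bullet> (N *v (z + t *\<^sub>R v)) + (z + t *\<^sub>R v) \<bullet> (N *v v)) / 2)
         + 2 * \<delta> * (2 * (z \<bullet> v + t * (v \<bullet> v))))"
    have f': "f k x = sdiff u x (hs k *\<^sub>R \<xi>) / (hs k)\<^sup>2 - q x + 2 * \<delta> * ((x - x0) \<bullet> (x - x0))" for x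
      by (simp add: f_def power2_norm_eq_inner)
    have q': "q (xs k + t *\<^sub>R v) = \<xi> \<bullet> (H x0 *v \<xi>) + b \<bullet> z + t * (b \<bullet> v) 
        + (z \<bullet> (N *v z) + t * (z \<bullet> (N *v v) + v \<bullet> (N *v z)) + t\<^sup>2 * (v \<bullet> (N *v v))) / 2" for t
    proof -
      have "xs k + t *\<^sub>R v - x0 = z + t *\<^sub>R v" by (simp add: z_def)
      then show ?thesis unfolding q_def
        by (simp add: matrix_vector_right_distrib matrix_vector_mult_scaleR inner_add_left inner_add_right
            power2_eq_square algebra_simps)
    qed
    have n': "(xs k + t *\<^sub>R v - x0) \<bullet> (xs k + t *\<^sub>R v - x0) = z \<bullet> z + 2 * t * (z \<bullet> v) + t\<^sup>2 * (v \<bullet> v)" for t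
    proof -
      have "xs k + t *\<^sub>R v - x0 = z + t *\<^sub>R v" by (simp add: z_def)
      then show ?thesis
        by (simp add: inner_add_left inner_add_right power2_eq_square inner_commute algebra_simps)
    qed
    have sd_deriv: "((\<lambda>s. sdiff F (xs k + s *\<^sub>R v) (hs k *\<^sub>R \<xi>) / (hs k)\<^sup>2) has_real_derivative 
        sdiff F' (xs k + t *\<^sub>R v) (hs k *\<^sub>R \<xi>) / (hs k)\<^sup>2) (at t)"
      if t: "\<bar>t\<bar> < d" and F: "\<And>y. y \<in> S \<Longrightarrow> (F has_derivative Fd y) (at y)" "\<And>y. y \<in> S \<Longrightarrow> Fd y v = F' y"
      for t F Fd F'
    proof -
      have "((\<lambda>s. F ((xs k + c) + s *\<^sub>R v)) has_real_derivative F' ((xs k + c) + t *\<^sub>R v)) (at t)"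
        if "xs k + t *\<^sub>R v + c \<in> S" for c
      proof -
        have eq: "xs k + t *\<^sub>R v + c = (xs k + c) + t *\<^sub>R v" by simp
        show ?thesis
          using line_derivative[of F "Fd ((xs k + c) + t *\<^sub>R v)" "xs k + c" t v] F that unfolding eq by simp
      qed
      note c = this
      have eq: "(xs k + c) + s *\<^sub>R v = xs k + s *\<^sub>R v + c" for s c by simp
      have "((\<lambda>s. F (xs k + s *\<^sub>R v + c)) has_real_derivative F' (xs k + t *\<^sub>R v + c)) (at t)"
        if "xs k + t *\<^sub>R v + c \<in> S" for c
        using c[OF that] unfolding eq .
      from DERIV_cdivide[OF DERIV_diff[OF DERIV_add[OF this[of "hs k *\<^sub>R \<xi>"] this[of "- (hs k *\<^sub>R \<xi>)"]]
         DERIV_cmult[OF this[of 0], of 2]], of "(hs k)\<^sup>2"]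
      show ?thesis using shift(1)[OF seg[OF t], of k] shift(2)[OF seg[OF t], of k] shift(3)[OF seg[OF t]]
        unfolding sdiff_def by simp
    qed
    have "(v \<bullet> (sdiff H (xs k) (hs k *\<^sub>R \<xi>) *v v)) / (hs k)\<^sup>2 - v \<bullet> (N *v v) + 4 * \<delta> * (v \<bullet> v) \<ge> 0"
    proof (rule second_derivative_test[OF d, of g G])
      show "g 0 \<le> g t" if "\<bar>t\<bar> < d" for t
        using xs(2)[OF seg[OF that]] by (simp add: g_def)
      show "DERIV g t :> G t" if t: "\<bar>t\<bar> < d" for t
        unfolding g_def f' G_def
      proof (rule DERIV_add[OF DERIV_diff[OF sd_deriv[OF t u_deriv refl]]])
        show "((\<lambda>t. q (xs k + t *\<^sub>R v)) has_real_derivative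
           b \<bullet> v + (v \<bullet> (N *v (z + t *\<^sub>R v)) + (z + t *\<^sub>R v) \<bullet> (N *v v)) / 2) (at t)"
          unfolding q' by (auto intro!: derivative_eq_intros
              simp: matrix_vector_right_distrib matrix_vector_mult_scaleR inner_add_left inner_add_right field_simps)
        show "((\<lambda>t. 2 * \<delta> * ((xs k + t *\<^sub>R v - x0) \<bullet> (xs k + t *\<^sub>R v - x0))) has_real_derivative
           2 * \<delta> * (2 * (z \<bullet> v + t * (v \<bullet> v)))) (at t)"
          unfolding n' by (auto intro!: derivative_eq_intros simp: algebra_simps)
      qed
      have "((\<lambda>s. sdiff (\<lambda>y. p y \<bullet> v) (xs k + s *\<^sub>R v) (hs k *\<^sub>R \<xi>) / (hs k)\<^sup>2) has_real_derivative 
          sdiff (\<lambda>y. v \<bullet> (H y *v v)) (xs k + 0 *\<^sub>R v) (hs k *\<^sub>R \<xi>) / (hs k)\<^sup>2) (at 0)"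
        by (rule sd_deriv[OF _ Hvv_deriv]) (use d in \<open>auto simp: inner_commute\<close>)
      moreover have "sdiff (\<lambda>y. v \<bullet> (H y *v v)) x y = v \<bullet> (sdiff H x y *v v)" for x y
        unfolding H_mult_diff by (simp add: sdiff_def inner_add_right inner_diff_right)
      ultimately have 1: "((\<lambda>s. sdiff (\<lambda>y. p y \<bullet> v) (xs k + s *\<^sub>R v) (hs k *\<^sub>R \<xi>) / (hs k)\<^sup>2) has_real_derivative 
          (v \<bullet> (sdiff H (xs k) (hs k *\<^sub>R \<xi>) *v v)) / (hs k)\<^sup>2) (at 0)" by simp
      show "DERIV G 0 :> (v \<bullet> (sdiff H (xs k) (hs k *\<^sub>R \<xi>) *v v)) / (hs k)\<^sup>2 - v \<bullet> (N *v v) + 4 * \<delta> * (v \<bullet> v)"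
        unfolding G_def
      proof (rule DERIV_add[OF DERIV_diff[OF 1]])
        show "((\<lambda>t. b \<bullet> v + (v \<bullet> (N *v (z + t *\<^sub>R v)) + (z + t *\<^sub>R v) \<bullet> (N *v v)) / 2) has_real_derivative v \<bullet> (N *v v)) (at 0)"
          unfolding matrix_vector_right_distrib matrix_vector_mult_scaleR inner_add_left inner_add_right
            inner_scaleR_left inner_scaleR_right
          by (auto intro!: derivative_eq_intros)
        show "((\<lambda>t. 2 * \<delta> * (2 * (z \<bullet> v + t * (v \<bullet> v)))) has_real_derivative 4 * \<delta> * (v \<bullet> v)) (at 0)"
          by (auto intro!: derivative_eq_intros)
      qed
    qed
    then show ?thesis
      unfolding X_def \<Delta>_def
      by (simp add: matrix_vector_mult_add_rdistrib matrix_vector_mult_diff_rdistrib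
         scaleR_matrix_vector_assoc[symmetric] inner_add_right inner_diff_right divide_inverse mult.commute)
  qed
  have "\<exists>W. W ** w (xs k) = mat 1 \<and> w (xs k) ** W = mat 1" for k
    using pos_def_invertible[OF w] xs(1)[of k] shift(3) unfolding w_def by metis
  then obtain W where W: "\<And>k. W k ** w (xs k) = mat 1" "\<And>k. w (xs k) ** W k = mat 1" by metis
  \<comment> \<open>Nonnegativity of \<open>X k\<close> allows replacing \<open>N\<close> by the
    second difference of \<open>H\<close>, which is that of \<open>a\<close> minus that of
    \<open>w\<close>. The latter is bounded by the tangent inequality at \<open>xs k\<close>,
    applied at both shifted points.\<close>
  have trle: "trace (W k ** (sdiff a (xs k) (hs k *\<^sub>R \<xi>) /\<^sub>R (hs k)\<^sup>2 - N + (4 * \<delta>) *\<^sub>R mat 1))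
     \<ge> sdiff \<psi> (xs k) (hs k *\<^sub>R \<xi>) / (hs k)\<^sup>2" if k: "dist (xs k) x0 < r" for k
  proof -
    note sh = shift(1)[OF xs(1)[of k], of k] shift(2)[OF xs(1)[of k], of k] shift(3)[OF xs(1)[of k]]
    have psi': "\<psi> y = ln (det (w y))" if "y \<in> S" for y using psi[OF that] by (simp add: w_def)
    have "0 \<le> trace (W k ** X k)"
      by (rule trace_inverse_nonneg[OF w W(1)[unfolded w_def] Xpos[OF k]]) (rule sh)
    moreover have "sdiff H (xs k) v = sdiff a (xs k) v - sdiff w (xs k) v" for v
      by (simp add: sdiff_def w_def algebra_simps)
    moreover have "sdiff \<psi> (xs k) (hs k *\<^sub>R \<xi>) \<le> trace (W k ** sdiff w (xs k) (hs k *\<^sub>R \<xi>))"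
    proof -
      have "ln (det (w y)) - ln (det (w (xs k))) \<le> trace (W k ** (w y - w (xs k)))" if "y \<in> S" for y
        unfolding w_def by (rule ln_det_tangent[OF w w W(1)[unfolded w_def]]) (use that sh in auto)
      from this[OF sh(1)] this[OF sh(2)] show ?thesis
        unfolding sdiff_def psi'[OF sh(1)] psi'[OF sh(2)] psi'[OF sh(3)]
        by (simp add: trace_mult_linear)
    qed
    then have "sdiff \<psi> (xs k) (hs k *\<^sub>R \<xi>) / (hs k)\<^sup>2 \<le> trace (W k ** sdiff w (xs k) (hs k *\<^sub>R \<xi>)) / (hs k)\<^sup>2"
      by (rule divide_right_mono) simp
    ultimately show ?thesis
      unfolding X_def \<Delta>_def
      by (simp add: trace_mult_linear scaleR_diff_right divide_inverse mult.commute)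
  qed
  have wlim: "(\<lambda>k. w (xs k)) \<longlonglongrightarrow> w x0"
  proof -
    have "isCont a x0" using acont open_S x0 continuous_on_eq_continuous_at by blast
    then have "(\<lambda>k. a (xs k)) \<longlonglongrightarrow> a x0" using xlim by (rule isCont_tendsto_compose)
    moreover have "(\<lambda>k. H (xs k)) \<longlonglongrightarrow> H x0"
    proof (intro vec_tendstoI)
      fix i j
      have "isCont (\<lambda>x. H x *v axis j 1) x0"
        using continuous_Hv open_S x0 continuous_on_eq_continuous_at by blast
      then have "(\<lambda>k. H (xs k) *v axis j 1) \<longlonglongrightarrow> H x0 *v axis j 1" using xlim by (rule isCont_tendsto_compose)
      then have "(\<lambda>k. (H (xs k) *v axis j 1) $ i) \<longlonglongrightarrow> (H x0 *v axis j 1) $ i" by (rule tendsto_vec_nth)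
      then show "(\<lambda>k. H (xs k) $ i $ j) \<longlonglongrightarrow> H x0 $ i $ j" 
        by (simp add: matrix_vector_mult_basis column_def)
    qed
    ultimately show ?thesis unfolding w_def by (rule tendsto_diff)
  qed
  have W0r: "w x0 ** W0 = mat 1" using W0 matrix_left_right_inverse unfolding w_def by blast
  have "W \<longlonglongrightarrow> W0" by (rule tendsto_inverse_matrix[OF wlim W(2) W0r])
  then have "(\<lambda>k. trace (W k ** (sdiff a (xs k) (hs k *\<^sub>R \<xi>) /\<^sub>R (hs k)\<^sup>2 - N + (4 * \<delta>) *\<^sub>R mat 1)))
     \<longlonglongrightarrow> trace (W0 ** (\<alpha> - N + (4 * \<delta>) *\<^sub>R mat 1))"
    by (intro tendsto_trace tendsto_matrix_mult tendsto_add tendsto_diff tendsto_const a2[OF xlim hlim hpos])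
  moreover have "\<forall>\<^sub>F k in sequentially. \<beta> - e \<le> trace (W k ** (sdiff a (xs k) (hs k *\<^sub>R \<xi>) /\<^sub>R (hs k)\<^sup>2 - N + (4 * \<delta>) *\<^sub>R mat 1))"
    using psi2[OF xlim hlim hpos e(1)] tendstoD[OF xlim r(1)]
    by eventually_elim (use trle in \<open>force intro: order_trans\<close>)
  ultimately have "\<beta> - e \<le> trace (W0 ** (\<alpha> - N + (4 * \<delta>) *\<^sub>R mat 1))"
    by (rule tendsto_lowerbound) simp
  also have "\<dots> = trace (W0 ** (\<alpha> - N)) + 4 * \<delta> * trace W0"
    by (simp add: trace_mult_linear)
  also have "4 * \<delta> * trace W0 \<le> e"
  proof -
    define t where "t = \<bar>trace W0\<bar> + 1"
    have t: "t > 0" "trace W0 \<le> t" by (auto simp: t_def)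
    have "4 * \<delta> * trace W0 \<le> 4 * \<delta> * t" using e t by (intro mult_left_mono) auto
    also have "\<dots> = e" using t by (simp add: \<delta>_def e_def t_def[symmetric])
    finally show ?thesis .
  qed
  finally show "\<beta> \<le> trace (W0 ** (\<alpha> - N)) + e'" by (simp add: e_def)
qed

end

section \<open>The matrix A and its derivatives\<close>

text \<open>The reciprocal Lorentz factor of a spacelike graph with gradient \<open>p\<close>; the
  function L of the problem is \<open>\<epsilon> / lapse p\<close>.\<close>

definition lapse :: "real^'n \<Rightarrow> real" where
  "lapse p = sqrt (1 - p \<bullet> p)"

text \<open>The metric that Minkowski space induces on a graph with gradient
  \<open>p\<close>.\<close>

definition G_mat :: "real^'n \<Rightarrow> real^'n^'n" where
  "G_mat p = (\<chi> i j. (if i = j then 1 else 0) - p $ i * p $ j)"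

text \<open>The matrix A as a function of the gradient alone, so that its derivatives in
  \<open>x\<close> come from the chain rule. It is the induced metric divided by L.\<close>

definition A_of :: "real \<Rightarrow> real^'n \<Rightarrow> real^'n^'n" where
  "A_of \<epsilon> p = (lapse p / \<epsilon>) *\<^sub>R G_mat p"

lemma has_derivative_cong_fun:
  assumes "(f has_derivative f') F" "\<And>x. f x = g x" "\<And>x. f' x = g' x"
  shows "(g has_derivative g') F"
proof -
  have "f = g" "f' = g'" using assms(2,3) by auto
  then show ?thesis using assms(1) by simp
qed

lemma lapse_pos: "p \<bullet> p < 1 \<Longrightarrow> lapse p > 0"
  and lapse_sq: "p \<bullet> p < 1 \<Longrightarrow> (lapse p)\<^sup>2 = 1 - p \<bullet> p"
  by (auto simp: lapse_def)

lemma G_mult: "G_mat p *v v = v - (p \<bullet> v) *\<^sub>R p"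
proof -
  have "(G_mat p *v v) $ i = v $ i - (p \<bullet> v) * p $ i" for i
  proof -
    have "(G_mat p *v v) $ i = (\<Sum>j\<in>UNIV. (if i = j then v $ j else 0) - p $ i * (p $ j * v $ j))"
      unfolding G_mat_def matrix_vector_mult_def by (auto simp: algebra_simps intro!: sum.cong)
    also have "\<dots> = v $ i - (p \<bullet> v) * p $ i"
      by (simp add: sum_subtractf inner_vec_def sum_distrib_left[symmetric] mult.commute)
    finally show ?thesis .
  qed
  then show ?thesis by (simp add: vec_eq_iff)
qed

lemma A_mult: "A_of \<epsilon> p *v v = (lapse p / \<epsilon>) *\<^sub>R (v - (p \<bullet> v) *\<^sub>R p)"
  by (simp add: A_of_def scaleR_matrix_vector_assoc[symmetric] G_mult)

lemma pos_def_G: assumes "p \<bullet> p < 1" shows "pos_def (G_mat p)"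
proof -
  have "x \<bullet> (G_mat p *v x) > 0" if "x \<noteq> 0" for x
  proof -
    have "(p \<bullet> x)\<^sup>2 \<le> (p \<bullet> p) * (x \<bullet> x)" by (rule Cauchy_Schwarz_ineq)
    also have "\<dots> < x \<bullet> x" using assms that by simp
    finally show ?thesis by (simp add: G_mult inner_diff_right power2_eq_square inner_commute)
  qed
  then show ?thesis
    unfolding pos_def_def sym_mat_def by (auto simp: G_mat_def transpose_def vec_eq_iff mult.commute)
qed

text \<open>In an orthonormal eigenframe, \<open>p\<close> is a multiple of every frame vector to
  which it is not orthogonal. So at most one eigenvalue differs from 1, and that one is
  \<open>1 - p \<bullet> p\<close>.\<close>

lemma det_G: assumes "p \<bullet> p < 1" shows "det (G_mat p) = 1 - p \<bullet> p"
proof -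
  have "sym_mat (G_mat p)" using pos_def_G[OF assms] by (simp add: pos_def_def)
  then obtain e \<mu> where "diag_basis (mat 1) (G_mat p) e \<mu>"
    using simultaneous_diagonalization[OF pos_def_mat1] by blast
  then interpret diag_basis "mat 1" "G_mat p" e \<mu> .
  have on: "e i \<bullet> e j = (if i = j then 1 else 0)" for i j using orthonormal[of i j] by simp
  have mu: "\<mu> i = 1 - (p \<bullet> e i)\<^sup>2" for i
    using eigen_form[of i i] on[of i i] by (simp add: G_mult inner_diff_right inner_commute power2_eq_square)
  have par: "(p \<bullet> e i) *\<^sub>R p = (p \<bullet> e i)\<^sup>2 *\<^sub>R e i" for i
    using eigen[of i] by (simp add: G_mult mu algebra_simps)
  have pp: "p \<bullet> p = (\<Sum>i\<in>UNIV. (p \<bullet> e i)\<^sup>2)"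
    using quad_expand_G[of p] by (simp add: inner_commute)
  show ?thesis
  proof (cases "\<exists>i. p \<bullet> e i \<noteq> 0")
    case True
    then obtain i where i: "p \<bullet> e i \<noteq> 0" by blast
    have "p = (p \<bullet> e i) *\<^sub>R e i"
      using par[of i] i by (simp add: power2_eq_square flip: scaleR_scaleR)
    then have z: "p \<bullet> e j = 0" if "j \<noteq> i" for j
      using on[of i j] that by (metis inner_scaleR_left mult_zero_right)
    have "(\<Sum>j\<in>UNIV. (p \<bullet> e j)\<^sup>2) = (\<Sum>j\<in>UNIV. if j = i then (p \<bullet> e i)\<^sup>2 else 0)"
      by (intro sum.cong) (auto simp: z)
    moreover have "(\<Prod>j\<in>UNIV. \<mu> j) = (\<Prod>j\<in>UNIV. if j = i then 1 - (p \<bullet> e i)\<^sup>2 else 1)"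
      by (intro prod.cong) (auto simp: z mu)
    ultimately show ?thesis by (simp add: det_eq pp)
  next
    case False
    then show ?thesis by (simp add: det_eq pp mu)
  qed
qed

text \<open>The quadratic form of \<open>A_of \<epsilon> p\<close> at a frozen vector
  \<open>v\<close>, regarded as a function of \<open>p\<close>; see \<open>quad_A\<close>.\<close>

definition Q :: "real \<Rightarrow> real^'n \<Rightarrow> real^'n \<Rightarrow> real" where
  "Q \<epsilon> v p = lapse p / \<epsilon> * (v \<bullet> v - (p \<bullet> v)\<^sup>2)"

text \<open>Below, the prefixes \<open>g\<close> and \<open>dg\<close> (respectively \<open>d\<close> and \<open>dd\<close>) mark first and second derivatives in
  the gradient variable \<open>p\<close>.\<close>

definition gQ :: "real \<Rightarrow> real^'n \<Rightarrow> real^'n \<Rightarrow> real^'n" where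
  "gQ \<epsilon> v p = (1 / \<epsilon>) *\<^sub>R (- ((v \<bullet> v - (p \<bullet> v)\<^sup>2) / lapse p) *\<^sub>R p - (2 * lapse p * (p \<bullet> v)) *\<^sub>R v)"

definition dgQ :: "real \<Rightarrow> real^'n \<Rightarrow> real^'n \<Rightarrow> real^'n \<Rightarrow> real^'n" where
  "dgQ \<epsilon> v p q = (1 / \<epsilon>) *\<^sub>R (- ((v \<bullet> v - (p \<bullet> v)\<^sup>2) / lapse p) *\<^sub>R q
     + (2 * (p \<bullet> v) * (q \<bullet> v) / lapse p - (v \<bullet> v - (p \<bullet> v)\<^sup>2) * (p \<bullet> q) / lapse p ^ 3) *\<^sub>R p
     + (2 * (p \<bullet> q) * (p \<bullet> v) / lapse p - 2 * lapse p * (q \<bullet> v)) *\<^sub>R v)"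

definition gl :: "real^'n \<Rightarrow> real^'n" where
  "gl p = (- 1 / (lapse p)\<^sup>2) *\<^sub>R p"

definition dgl :: "real^'n \<Rightarrow> real^'n \<Rightarrow> real^'n" where
  "dgl p q = (- 1 / (lapse p)\<^sup>2) *\<^sub>R q - (2 * (p \<bullet> q) / lapse p ^ 4) *\<^sub>R p"

text \<open>The displacement \<open>x - T x\<close> as a function of the gradient.\<close>

definition m_of :: "real \<Rightarrow> real^'n \<Rightarrow> real^'n" where
  "m_of \<epsilon> p = (\<epsilon> / lapse p) *\<^sub>R p"

text \<open>The derivative of \<open>m_of\<close> in \<open>p\<close>. As a linear map of
  \<open>q\<close> it is the inverse of \<open>A_of \<epsilon> p\<close>, which is why DT equals the
  inverse of A times \<open>w\<close>.\<close>

definition dm :: "real \<Rightarrow> real^'n \<Rightarrow> real^'n \<Rightarrow> real^'n" where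
  "dm \<epsilon> p q = (\<epsilon> / lapse p) *\<^sub>R q + (\<epsilon> * (p \<bullet> q) / lapse p ^ 3) *\<^sub>R p"

definition ddm :: "real \<Rightarrow> real^'n \<Rightarrow> real^'n \<Rightarrow> real^'n \<Rightarrow> real^'n" where
  "ddm \<epsilon> p r q = (\<epsilon> / lapse p ^ 3) *\<^sub>R ((p \<bullet> q) *\<^sub>R r + (p \<bullet> r) *\<^sub>R q + (q \<bullet> r + 3 * (p \<bullet> q) * (p \<bullet> r) / (lapse p)\<^sup>2) *\<^sub>R p)"

section \<open>Derivatives in the gradient variable\<close>

lemma quad_A: "v \<bullet> (A_of \<epsilon> p *v v) = Q \<epsilon> v p"
  by (simp add: A_mult Q_def inner_diff_right inner_commute power2_eq_square)

lemma lapse_deriv: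
  assumes "p \<bullet> p < 1"
  shows "(lapse has_derivative (\<lambda>q. - (p \<bullet> q) / lapse p)) (at p)"
proof -
  have "((\<lambda>p. sqrt (1 - p \<bullet> p)) has_derivative (\<lambda>q. - (p \<bullet> q) / sqrt (1 - p \<bullet> p))) (at p)"
    using assms by (auto intro!: derivative_eq_intros simp: field_simps inner_commute)
  then show ?thesis by (simp add: lapse_def[abs_def])
qed

lemma inv_lapse_deriv:
  assumes "p \<bullet> p < 1"
  shows "((\<lambda>p. 1 / lapse p) has_derivative (\<lambda>q. (p \<bullet> q) / lapse p ^ 3)) (at p)"
  using lapse_pos[OF assms]
  by (auto intro!: derivative_eq_intros lapse_deriv[OF assms] simp: field_simps power3_eq_cube)

lemma Q_deriv:
  assumes "p \<bullet> p < 1"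
  shows "(Q \<epsilon> v has_derivative (\<lambda>q. gQ \<epsilon> v p \<bullet> q)) (at p)"
proof -
  have X: "((\<lambda>p. v \<bullet> v - (p \<bullet> v) * (p \<bullet> v)) has_derivative (\<lambda>q. - ((p \<bullet> v) * (q \<bullet> v) + (q \<bullet> v) * (p \<bullet> v)))) (at p)"
    by (auto intro!: derivative_eq_intros)
  have "((\<lambda>p. (1/\<epsilon>) * (lapse p * (v \<bullet> v - (p \<bullet> v) * (p \<bullet> v)))) has_derivative
      (\<lambda>q. (1/\<epsilon>) * (lapse p * (- ((p \<bullet> v) * (q \<bullet> v) + (q \<bullet> v) * (p \<bullet> v))) + (- (p \<bullet> q) / lapse p) * (v \<bullet> v - (p \<bullet> v) * (p \<bullet> v))))) (at p)"
    by (intro has_derivative_mult_right has_derivative_mult lapse_deriv[OF assms] X)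
  moreover have "(1/\<epsilon>) * (lapse p * (v \<bullet> v - (p \<bullet> v) * (p \<bullet> v))) = Q \<epsilon> v p" for p
    by (simp add: Q_def power2_eq_square)
  moreover have "(1/\<epsilon>) * (lapse p * (- ((p \<bullet> v) * (q \<bullet> v) + (q \<bullet> v) * (p \<bullet> v))) + (- (p \<bullet> q) / lapse p) * (v \<bullet> v - (p \<bullet> v) * (p \<bullet> v)))
     = gQ \<epsilon> v p \<bullet> q" for q
    unfolding gQ_def inner_scaleR_left inner_diff_left inner_minus_left
    by (simp add: power2_eq_square inner_commute[of v q] algebra_simps diff_divide_distrib)
  ultimately show ?thesis by (rule has_derivative_cong_fun)
qed

lemma gQ_deriv:
  assumes "p \<bullet> p < 1"
  shows "(gQ \<epsilon> v has_derivative dgQ \<epsilon> v p) (at p)"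
proof -
  let ?X = "\<lambda>p. v \<bullet> v - (p \<bullet> v) * (p \<bullet> v)"
  have X: "(?X has_derivative (\<lambda>q. - ((p \<bullet> v) * (q \<bullet> v) + (q \<bullet> v) * (p \<bullet> v)))) (at p)"
    by (auto intro!: derivative_eq_intros)
  have pv: "((\<lambda>p. p \<bullet> v) has_derivative (\<lambda>q. q \<bullet> v)) (at p)"
    by (auto intro!: derivative_eq_intros)
  have "((\<lambda>p. (1 / \<epsilon>) *\<^sub>R (- ((1 / lapse p * ?X p) *\<^sub>R p) - (2 * (lapse p * (p \<bullet> v))) *\<^sub>R v)) has_derivative
     (\<lambda>q. (1 / \<epsilon>) *\<^sub>R (- ((1 / lapse p * ?X p) *\<^sub>R q + 
        (1 / lapse p * (- ((p \<bullet> v) * (q \<bullet> v) + (q \<bullet> v) * (p \<bullet> v))) + (p \<bullet> q) / lapse p ^ 3 * ?X p) *\<^sub>R p)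
       - (2 * (lapse p * (q \<bullet> v) + - (p \<bullet> q) / lapse p * (p \<bullet> v))) *\<^sub>R v))) (at p)"
    by (intro has_derivative_scaleR_right has_derivative_diff has_derivative_minus has_derivative_scaleR
        has_derivative_scaleR_left has_derivative_mult_right has_derivative_mult
        inv_lapse_deriv[OF assms] lapse_deriv[OF assms] X pv has_derivative_ident)
  moreover have "(1 / \<epsilon>) *\<^sub>R (- ((1 / lapse p * ?X p) *\<^sub>R p) - (2 * (lapse p * (p \<bullet> v))) *\<^sub>R v) = gQ \<epsilon> v p" for p
    by (simp add: gQ_def power2_eq_square mult.assoc)
  moreover have "(1 / \<epsilon>) *\<^sub>R (- ((1 / lapse p * ?X p) *\<^sub>R q + 
        (1 / lapse p * (- ((p \<bullet> v) * (q \<bullet> v) + (q \<bullet> v) * (p \<bullet> v))) + (p \<bullet> q) / lapse p ^ 3 * ?X p) *\<^sub>R p)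
       - (2 * (lapse p * (q \<bullet> v) + - (p \<bullet> q) / lapse p * (p \<bullet> v))) *\<^sub>R v) = dgQ \<epsilon> v p q" for q
  proof -
    have "- (1 / lapse p * (- ((p \<bullet> v) * (q \<bullet> v) + (q \<bullet> v) * (p \<bullet> v))) + (p \<bullet> q) / lapse p ^ 3 * ?X p)
       = 2 * (p \<bullet> v) * (q \<bullet> v) / lapse p - (v \<bullet> v - (p \<bullet> v)\<^sup>2) * (p \<bullet> q) / lapse p ^ 3"
      using lapse_pos[OF assms] by (simp add: power2_eq_square field_simps)
    moreover have "- (2 * (lapse p * (q \<bullet> v) + - (p \<bullet> q) / lapse p * (p \<bullet> v)))
       = 2 * (p \<bullet> q) * (p \<bullet> v) / lapse p - 2 * lapse p * (q \<bullet> v)" by (simp add: algebra_simps)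
    moreover have "- (1 / lapse p * ?X p) = - ((v \<bullet> v - (p \<bullet> v)\<^sup>2) / lapse p)" by (simp add: power2_eq_square)
    moreover have "- (a *\<^sub>R q + b *\<^sub>R p) - c *\<^sub>R v = (- a) *\<^sub>R q + (- b) *\<^sub>R p + (- c) *\<^sub>R v" for a b c by simp
    ultimately show ?thesis unfolding dgQ_def by metis
  qed
  ultimately show ?thesis by (rule has_derivative_cong_fun)
qed

lemma ln_lapse_deriv:
  assumes "p \<bullet> p < 1"
  shows "((\<lambda>p. ln (lapse p)) has_derivative (\<lambda>q. gl p \<bullet> q)) (at p)"
  using has_derivative_ln[OF lapse_pos[OF assms] lapse_deriv[OF assms]]
  by (rule has_derivative_cong_fun) (simp_all add: gl_def divide_inverse power2_eq_square)

lemma gl_deriv: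
  assumes "p \<bullet> p < 1"
  shows "(gl has_derivative dgl p) (at p)"
proof -
  have "((\<lambda>p. - ((1 / lapse p * (1 / lapse p)) *\<^sub>R p)) has_derivative
      (\<lambda>q. - ((1 / lapse p * (1 / lapse p)) *\<^sub>R q + (1 / lapse p * ((p \<bullet> q) / lapse p ^ 3) + (p \<bullet> q) / lapse p ^ 3 * (1 / lapse p)) *\<^sub>R p))) (at p)"
    by (intro has_derivative_minus has_derivative_scaleR has_derivative_mult inv_lapse_deriv[OF assms] has_derivative_ident)
  moreover have "- ((1 / lapse p * (1 / lapse p)) *\<^sub>R p) = gl p" for p
    by (simp add: gl_def power2_eq_square)
  moreover have "- ((1 / lapse p * (1 / lapse p)) *\<^sub>R q + (1 / lapse p * ((p \<bullet> q) / lapse p ^ 3) + (p \<bullet> q) / lapse p ^ 3 * (1 / lapse p)) *\<^sub>R p)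
     = dgl p q" for q
    by (simp add: dgl_def power2_eq_square power3_eq_cube power4_eq_xxxx algebra_simps)
  ultimately show ?thesis by (rule has_derivative_cong_fun)
qed

lemma m_deriv:
  assumes "p \<bullet> p < 1"
  shows "(m_of \<epsilon> has_derivative dm \<epsilon> p) (at p)"
proof -
  have "((\<lambda>p. \<epsilon> *\<^sub>R ((1 / lapse p) *\<^sub>R p)) has_derivative
      (\<lambda>q. \<epsilon> *\<^sub>R ((1 / lapse p) *\<^sub>R q + ((p \<bullet> q) / lapse p ^ 3) *\<^sub>R p))) (at p)"
    by (intro has_derivative_scaleR_right has_derivative_scaleR inv_lapse_deriv[OF assms] has_derivative_ident)
  moreover have "\<epsilon> *\<^sub>R ((1 / lapse p) *\<^sub>R p) = m_of \<epsilon> p" for p by (simp add: m_of_def)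
  moreover have "\<epsilon> *\<^sub>R ((1 / lapse p) *\<^sub>R q + ((p \<bullet> q) / lapse p ^ 3) *\<^sub>R p) = dm \<epsilon> p q" for q
    by (simp add: dm_def algebra_simps)
  ultimately show ?thesis by (rule has_derivative_cong_fun)
qed

text \<open>\<open>m_of \<epsilon>\<close> is the gradient of \<open>- \<epsilon> * lapse p\<close>,
  so \<open>dm\<close> is a Hessian and \<open>ddm\<close> a symmetric third derivative;
  \<open>ddm_sym\<close> has the same origin.\<close>

lemma dm_sym: "dm \<epsilon> p q \<bullet> c = dm \<epsilon> p c \<bullet> q"
  unfolding dm_def inner_add_left inner_scaleR_left by (simp add: inner_commute[of q c])

lemma m_inner_deriv:
  assumes "p \<bullet> p < 1"
  shows "((\<lambda>p. m_of \<epsilon> p \<bullet> c) has_derivative (\<lambda>q. dm \<epsilon> p c \<bullet> q)) (at p)"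
proof -
  have "((\<lambda>p. m_of \<epsilon> p \<bullet> c) has_derivative (\<lambda>q. dm \<epsilon> p q \<bullet> c)) (at p)"
    by (intro has_derivative_inner_left m_deriv assms)
  then show ?thesis unfolding dm_sym[of _ _ _ c] .
qed

lemma dm_deriv:
  assumes "p \<bullet> p < 1"
  shows "((\<lambda>p. dm \<epsilon> p r) has_derivative ddm \<epsilon> p r) (at p)"
proof -
  have pr: "((\<lambda>p. p \<bullet> r) has_derivative (\<lambda>q. q \<bullet> r)) (at p)"
    by (auto intro!: derivative_eq_intros)
  have cube: "((\<lambda>p. 1 / lapse p * (1 / lapse p * (1 / lapse p))) has_derivative
    (\<lambda>q. 1 / lapse p * (1 / lapse p * ((p \<bullet> q) / lapse p ^ 3) + (p \<bullet> q) / lapse p ^ 3 * (1 / lapse p)) 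
        + (p \<bullet> q) / lapse p ^ 3 * (1 / lapse p * (1 / lapse p)))) (at p)"
    by (intro has_derivative_mult inv_lapse_deriv[OF assms])
  let ?c = "\<lambda>p. 1 / lapse p * (1 / lapse p * (1 / lapse p))"
  let ?c' = "\<lambda>q. 1 / lapse p * (1 / lapse p * ((p \<bullet> q) / lapse p ^ 3) + (p \<bullet> q) / lapse p ^ 3 * (1 / lapse p)) 
        + (p \<bullet> q) / lapse p ^ 3 * (1 / lapse p * (1 / lapse p))"
  have "((\<lambda>p. \<epsilon> *\<^sub>R ((1 / lapse p) *\<^sub>R r + (?c p * (p \<bullet> r)) *\<^sub>R p)) has_derivative
      (\<lambda>q. \<epsilon> *\<^sub>R (((p \<bullet> q) / lapse p ^ 3) *\<^sub>R r + ((?c p * (p \<bullet> r)) *\<^sub>R q + (?c p * (q \<bullet> r) + ?c' q * (p \<bullet> r)) *\<^sub>R p)))) (at p)"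
    by (intro has_derivative_scaleR_right has_derivative_add has_derivative_scaleR has_derivative_scaleR_left
        has_derivative_mult inv_lapse_deriv[OF assms] has_derivative_ident pr cube)
  moreover have "\<epsilon> *\<^sub>R ((1 / lapse p) *\<^sub>R r + (?c p * (p \<bullet> r)) *\<^sub>R p) = dm \<epsilon> p r" for p
    by (simp add: dm_def power3_eq_cube scaleR_add_right mult.assoc)
  moreover have "\<epsilon> *\<^sub>R (((p \<bullet> q) / lapse p ^ 3) *\<^sub>R r + ((?c p * (p \<bullet> r)) *\<^sub>R q + (?c p * (q \<bullet> r) + ?c' q * (p \<bullet> r)) *\<^sub>R p)) = ddm \<epsilon> p r q" for q
  proof -
    have "?c p * (q \<bullet> r) + ?c' q * (p \<bullet> r) = (1 / lapse p ^ 3) * (q \<bullet> r + 3 * (p \<bullet> q) * (p \<bullet> r) / (lapse p)\<^sup>2)"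
      using lapse_pos[OF assms] by (simp add: field_simps power2_eq_square power3_eq_cube)
    moreover have "?c p * (p \<bullet> r) = (1 / lapse p ^ 3) * (p \<bullet> r)" by (simp add: power3_eq_cube mult.assoc)
    ultimately show ?thesis
      by (simp add: ddm_def scaleR_add_right)
  qed
  ultimately show ?thesis by (rule has_derivative_cong_fun)
qed

text \<open>A zero of a semidefinite form lies in the kernel of the matrix. Thus the sign of the
  determinant in the equation upgrades the weak inequality from concavity to ellipticity.\<close>

lemma pos_def_of_psd:
  fixes M :: "real^'n^'n"
  assumes "sym_mat M" "\<And>x. x \<bullet> (M *v x) \<ge> 0" "det M \<noteq> 0"
  shows "pos_def M"
proof -
  have "x \<bullet> (M *v x) > 0" if x: "x \<noteq> 0" for x
  proof (rule ccontr)
    assume "\<not> ?thesis"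
    then have x0: "x \<bullet> (M *v x) = 0" using assms(2)[of x] by linarith
    have "(M *v x) \<bullet> (M *v x) = 0"
      by (rule pos_semidef_kernel[OF assms(1) subspace_UNIV assms(2) UNIV_I x0 UNIV_I])
    then have "M *v x = 0" by (simp only: inner_eq_zero_iff)
    then have "\<not> invertible M" using x
      by (metis invertible_def matrix_vector_mul_assoc matrix_vector_mul_lid matrix_vector_mult_0_right)
    then show False using assms(3) by (simp add: invertible_det_nz)
  qed
  then show ?thesis using assms(1) by (simp add: pos_def_def)
qed

text \<open>A complex eigenvector is split into real and imaginary parts; in a real eigenframe some
  coordinate pair of these is nonzero, and on it multiplication by \<open>z\<close> must agree with
  multiplication by the real number \<open>l i\<close>.\<close>

lemma eigenvals_diagonalizable:
  fixes J G w :: "real^'n^'n"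
  assumes db: "diag_basis G w e \<mu>" and J: "\<And>i. J *v e i = l i *\<^sub>R e i"
  shows "eigenvals J = (\<lambda>i. complex_of_real (l i)) ` UNIV"
proof -
  interpret diag_basis G w e \<mu> by fact
  \<comment> \<open>The functionals \<open>x \<mapsto> e i \<bullet> (G *v x)\<close> form the dual
    basis of the frame, hence are left eigenvectors of \<open>J\<close>.\<close>
  have coord: "e i \<bullet> (G *v (J *v x)) = l i * (e i \<bullet> (G *v x))" for i x
  proof -
    have "J *v x = J *v (\<Sum>j\<in>UNIV. (e j \<bullet> (G *v x)) *\<^sub>R e j)"
      using expand[of x] by (rule arg_cong)
    also have "\<dots> = (\<Sum>j\<in>UNIV. ((e j \<bullet> (G *v x)) * l j) *\<^sub>R e j)"
      by (simp add: linear_sum[OF matrix_vector_mul_linear] matrix_vector_mult_scaleR J)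
    finally have "e i \<bullet> (G *v (J *v x)) = (\<Sum>j\<in>UNIV. ((e j \<bullet> (G *v x)) * l j) * (if i = j then 1 else 0))"
      by (simp only: linear_sum[OF matrix_vector_mul_linear] matrix_vector_mult_scaleR inner_sum_right
          inner_scaleR_right orthonormal)
    then show ?thesis by (simp add: if_distrib cong: if_cong)
  qed
  have re: "Re ((map_matrix complex_of_real J *v v) $ k) = (J *v (\<chi> j. Re (v $ j))) $ k"
    and im: "Im ((map_matrix complex_of_real J *v v) $ k) = (J *v (\<chi> j. Im (v $ j))) $ k" for v k
    by (simp_all add: map_matrix_def matrix_vector_mult_def)
  show ?thesis
  proof (intro equalityI subsetI)
    fix z assume "z \<in> eigenvals J"
    then obtain v where v: "v \<noteq> 0" "map_matrix complex_of_real J *v v = z *s v"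
      unfolding eigenvals_def by blast
    define a where "a = (\<chi> j. Re (v $ j))"
    define b where "b = (\<chi> j. Im (v $ j))"
    have Ja: "J *v a = Re z *\<^sub>R a - Im z *\<^sub>R b"
      using v(2) re[of v] by (simp add: vec_eq_iff a_def b_def)
    have Jb: "J *v b = Im z *\<^sub>R a + Re z *\<^sub>R b"
      using v(2) im[of v] by (simp add: vec_eq_iff a_def b_def add.commute)
    have "a \<noteq> 0 \<or> b \<noteq> 0"
      using v(1) by (auto simp: a_def b_def vec_eq_iff complex_eq_iff)
    then obtain i where i: "e i \<bullet> (G *v a) \<noteq> 0 \<or> e i \<bullet> (G *v b) \<noteq> 0"
      using expand[of a] expand[of b] by fastforce
    define x where "x = e i \<bullet> (G *v a)"
    define y where "y = e i \<bullet> (G *v b)"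
    have 1: "l i * x = Re z * x - Im z * y"
      using coord[of i a] by (simp add: Ja x_def y_def matrix_vector_mult_diff_distrib matrix_vector_mult_scaleR inner_diff_right)
    have 2: "l i * y = Im z * x + Re z * y"
      using coord[of i b] by (simp add: Jb x_def y_def matrix_vector_right_distrib matrix_vector_mult_scaleR inner_add_right)
    have pos: "x * x + y * y > 0" using i unfolding x_def[symmetric] y_def[symmetric]
      by (metis less_eq_real_def not_sum_squares_lt_zero sum_squares_gt_zero_iff)
    have "(l i - Re z) * (x * x + y * y) = (l i * x - Re z * x) * x + (l i * y - Re z * y) * y"
      by (simp add: algebra_simps)
    also have "\<dots> = 0" unfolding 1 2 by (simp add: algebra_simps)
    finally have "Re z = l i" using pos by auto
    moreover have "Im z * (x * x + y * y) = (l i * y - Re z * y) * x - (l i * x - Re z * x) * y"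
      unfolding 1 2 by (simp add: algebra_simps)
    then have "Im z * (x * x + y * y) = 0" by (simp add: \<open>Re z = l i\<close>)
    then have "Im z = 0" using pos by auto
    ultimately have "z = complex_of_real (l i)" by (simp add: complex_eq_iff)
    then show "z \<in> (\<lambda>i. complex_of_real (l i)) ` UNIV" by blast
  next
    fix z assume "z \<in> (\<lambda>i. complex_of_real (l i)) ` UNIV"
    then obtain i where z: "z = complex_of_real (l i)" by blast
    define v where "v = (\<chi> j. complex_of_real (e i $ j))"
    have "e i \<noteq> 0" using orthonormal[of i i] by auto
    then have "v \<noteq> 0" by (simp add: v_def vec_eq_iff)
    moreover have "map_matrix complex_of_real J *v v = z *s v"
    proof (unfold vec_eq_iff, rule allI)
      fix k
      have "(map_matrix complex_of_real J *v v) $ k = complex_of_real ((J *v e i) $ k)"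
        by (simp add: map_matrix_def matrix_vector_mult_def v_def)
      then show "(map_matrix complex_of_real J *v v) $ k = (z *s v) $ k"
        by (simp add: J z v_def)
    qed
    ultimately show "z \<in> eigenvals J" unfolding eigenvals_def by blast
  qed
qed

section \<open>Cost-concave functions and regularity of the data\<close>

text \<open>The infimum need not be attained and \<open>\<psi>\<close> is arbitrary, so a minimising
  sequence is taken. The bound on the increment of \<open>u\<close> contains the cost only, because
  \<open>\<psi>\<close> cancels in it, and therefore passes to a limit \<open>y0\<close> in the
  closure.\<close>

lemma c_concave_support:
  fixes u :: "real^'n \<Rightarrow> real"
  assumes cc: "c_concave_on \<epsilon> \<Omega> \<Omega>s u" and bd: "bounded \<Omega>s" and ne: "\<Omega>s \<noteq> {}" and x0: "x0 \<in> \<Omega>"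
  obtains y0 where "\<And>x. x \<in> \<Omega> \<Longrightarrow> u x - u x0 \<le> cost \<epsilon> x y0 - cost \<epsilon> x0 y0"
proof -
  from cc obtain \<psi> where \<psi>: "\<forall>x\<in>\<Omega>. bdd_below ((\<lambda>y. cost \<epsilon> x y - \<psi> y) ` \<Omega>s) \<and>
      u x = (INF y\<in>\<Omega>s. cost \<epsilon> x y - \<psi> y)"
    unfolding c_concave_on_def by (elim exE)
  have bb: "bdd_below ((\<lambda>y. cost \<epsilon> x y - \<psi> y) ` \<Omega>s)"
    and u: "u x = (INF y\<in>\<Omega>s. cost \<epsilon> x y - \<psi> y)" if "x \<in> \<Omega>" for x
    using \<psi> that by auto
  have "\<exists>y\<in>\<Omega>s. cost \<epsilon> x0 y - \<psi> y < u x0 + inverse (real (Suc n))" for n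
    using cINF_less_iff[OF ne bb[OF x0], of "u x0 + inverse (real (Suc n))"] u[OF x0] by simp
  then obtain Y where Y: "\<And>n. Y n \<in> \<Omega>s" "\<And>n. cost \<epsilon> x0 (Y n) - \<psi> (Y n) < u x0 + inverse (real (Suc n))"
    by metis
  have "compact (closure \<Omega>s)" using bd by (simp add: compact_closure)
  then obtain y0 r where y0: "strict_mono (r :: nat \<Rightarrow> nat)" "(Y \<circ> r) \<longlonglongrightarrow> y0"
    unfolding compact_def using Y(1) closure_subset by (metis subsetD)
  have "u x - u x0 \<le> cost \<epsilon> x y0 - cost \<epsilon> x0 y0" if x: "x \<in> \<Omega>" for x
  proof -
    have le: "u x - u x0 \<le> cost \<epsilon> x ((Y \<circ> r) n) - cost \<epsilon> x0 ((Y \<circ> r) n) + inverse (real (Suc (r n)))" for n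
      using cINF_lower[OF bb[OF x] Y(1)[of "r n"]] Y(2)[of "r n"] u[OF x] by simp
    have inv: "(\<lambda>n. inverse (real (Suc (r n)))) \<longlonglongrightarrow> 0"
      using LIMSEQ_subseq_LIMSEQ[OF LIMSEQ_inverse_real_of_nat y0(1)] by (simp add: o_def)
    have "(\<lambda>n. cost \<epsilon> x ((Y \<circ> r) n) - cost \<epsilon> x0 ((Y \<circ> r) n) + inverse (real (Suc (r n)))) \<longlonglongrightarrow> cost \<epsilon> x y0 - cost \<epsilon> x0 y0 + 0"
      unfolding cost_def by (intro tendsto_intros y0(2) inv)
    then show ?thesis using le LIMSEQ_le_const by fastforce
  qed
  then show ?thesis using that by blast
qed

context C3_function begin

text \<open>The cost with pole \<open>y0\<close> minus \<open>u\<close> is minimal at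
  \<open>x0\<close>. The first order condition makes \<open>p x0\<close> equal to the gradient of
  the cost, of norm less than 1 because \<open>\<epsilon> > 0\<close>; the second order condition
  compares \<open>H x0\<close> with the Hessian of the cost, which is A at this gradient.\<close>

lemma support_point:
  assumes x0: "x0 \<in> S" and \<epsilon>: "\<epsilon> > 0"
    and supp: "\<And>x. x \<in> S \<Longrightarrow> u x - u x0 \<le> cost \<epsilon> x y0 - cost \<epsilon> x0 y0"
  shows "p x0 \<bullet> p x0 < 1" and "v \<bullet> (H x0 *v v) \<le> v \<bullet> (A_of \<epsilon> (p x0) *v v)"
proof -
  define z where "z = x0 - y0"
  define c where "c = sqrt (\<epsilon>\<^sup>2 + z \<bullet> z)"
  have pos: "\<epsilon>\<^sup>2 + y \<bullet> y > 0" for y :: "real^'n" using \<epsilon> by (simp add: add_pos_nonneg)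
  have c: "c > 0" "c\<^sup>2 = \<epsilon>\<^sup>2 + z \<bullet> z" using pos[of z] by (auto simp: c_def)
  have cost: "cost \<epsilon> x y0 = sqrt (\<epsilon>\<^sup>2 + (x - y0) \<bullet> (x - y0))" for x
    by (simp add: cost_def power2_norm_eq_inner)
  have key: "(z \<bullet> v) / c - p x0 \<bullet> v = 0 \<and> 0 \<le> (v \<bullet> v) / c - (z \<bullet> v)\<^sup>2 / c ^ 3 - v \<bullet> (H x0 *v v)" for v
  proof -
    obtain r where r: "r > 0" "cball x0 r \<subseteq> S" using open_S x0 open_contains_cball by blast
    define d where "d = r / (norm v + 1)"
    have d: "d > 0" using r unfolding d_def by (intro divide_pos_pos) (auto simp: add_nonneg_pos)
    have seg: "x0 + t *\<^sub>R v \<in> S" if "\<bar>t\<bar> < d" for t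
    proof -
      have "\<bar>t\<bar> * norm v \<le> d * (norm v + 1)" using that by (intro mult_mono) auto
      also have "\<dots> = r" by (simp add: d_def add_nonneg_eq_0_iff)
      finally show ?thesis using r by (auto simp: dist_norm intro!: subsetD[OF r(2)])
    qed
    define q where "q = (\<lambda>t. \<epsilon>\<^sup>2 + (z + t *\<^sub>R v) \<bullet> (z + t *\<^sub>R v))"
    have qpos: "q t > 0" for t by (simp add: q_def pos)
    have q': "(q has_real_derivative 2 * (z \<bullet> v + t * (v \<bullet> v))) (at t)" for t
    proof -
      have "q = (\<lambda>t. \<epsilon>\<^sup>2 + z \<bullet> z + 2 * t * (z \<bullet> v) + t\<^sup>2 * (v \<bullet> v))"
        by (auto simp: q_def inner_add_left inner_add_right power2_eq_square inner_commute algebra_simps)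
      then show ?thesis by (auto intro!: derivative_eq_intros simp: algebra_simps)
    qed
    define g where "g = (\<lambda>t. sqrt (q t) - u (x0 + t *\<^sub>R v))"
    define G where "G = (\<lambda>t. (z \<bullet> v + t * (v \<bullet> v)) / sqrt (q t) - p (x0 + t *\<^sub>R v) \<bullet> v)"
    have gm: "g 0 \<le> g t" if "\<bar>t\<bar> < d" for t
    proof -
      have e: "x0 + t *\<^sub>R v - y0 = z + t *\<^sub>R v" "x0 - y0 = z" by (simp_all add: z_def)
      show ?thesis
        using supp[OF seg[OF that]] unfolding cost e by (simp add: g_def q_def)
    qed
    have g: "DERIV g t :> G t" if "\<bar>t\<bar> < d" for t
      unfolding g_def G_def using qpos[of t]
      by (intro DERIV_diff line_derivative u_deriv seg that)
        (auto intro!: derivative_eq_intros q' simp: field_simps)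
    have "((\<lambda>t. p (x0 + t *\<^sub>R v) \<bullet> v) has_real_derivative (H x0 *v v) \<bullet> v) (at 0)"
      using line_derivative[OF Hvv_deriv, of x0 0 v v] x0 by simp
    moreover have "((\<lambda>t. (z \<bullet> v + t * (v \<bullet> v)) / sqrt (q t)) has_real_derivative
        (v \<bullet> v) / c - (z \<bullet> v)\<^sup>2 / c ^ 3) (at 0)"
    proof -
      have q0: "sqrt (q 0) = c" by (simp add: q_def c_def)
      have "((\<lambda>t. sqrt (q t)) has_real_derivative (z \<bullet> v) / c) (at 0)"
        using qpos[of 0] by (auto intro!: derivative_eq_intros q' simp: q0[symmetric] field_simps)
      moreover have "((\<lambda>t. z \<bullet> v + t * (v \<bullet> v)) has_real_derivative v \<bullet> v) (at 0)"
        by (auto intro!: derivative_eq_intros)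
      ultimately have "((\<lambda>t. (z \<bullet> v + t * (v \<bullet> v)) / sqrt (q t)) has_real_derivative
        ((v \<bullet> v) * sqrt (q 0) - (z \<bullet> v + 0 * (v \<bullet> v)) * ((z \<bullet> v) / c)) / (sqrt (q 0) * sqrt (q 0))) (at 0)"
        using c(1) q0 by (intro DERIV_divide) auto
      moreover have "((v \<bullet> v) * sqrt (q 0) - (z \<bullet> v + 0 * (v \<bullet> v)) * ((z \<bullet> v) / c)) / (sqrt (q 0) * sqrt (q 0))
          = (v \<bullet> v) / c - (z \<bullet> v)\<^sup>2 / c ^ 3"
        unfolding q0 using c(1) by (simp add: field_simps power2_eq_square power3_eq_cube)
      ultimately show ?thesis by simp
    qed
    ultimately have G': "DERIV G 0 :> (v \<bullet> v) / c - (z \<bullet> v)\<^sup>2 / c ^ 3 - (H x0 *v v) \<bullet> v"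
      unfolding G_def by (intro DERIV_diff)
    have "G 0 = 0" by (rule DERIV_local_min[OF g d]) (use d gm in auto)
    moreover have "0 \<le> (v \<bullet> v) / c - (z \<bullet> v)\<^sup>2 / c ^ 3 - (H x0 *v v) \<bullet> v"
      by (rule second_derivative_test[OF d gm g G'])
    ultimately show ?thesis by (simp add: G_def q_def c_def inner_commute)
  qed
  have "(z /\<^sub>R c - p x0) \<bullet> (z /\<^sub>R c - p x0) = 0"
    using key[of "z /\<^sub>R c - p x0"] by (simp add: inner_diff_left divide_inverse mult.commute)
  then have p: "p x0 = z /\<^sub>R c" by simp
  have "p x0 \<bullet> p x0 = (z \<bullet> z) / c\<^sup>2" by (simp add: p power2_eq_square field_simps)
  then have "1 - p x0 \<bullet> p x0 = (c\<^sup>2 - z \<bullet> z) / c\<^sup>2" using c(1) by (simp add: diff_divide_distrib)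
  also have "c\<^sup>2 - z \<bullet> z = \<epsilon>\<^sup>2" using c(2) by simp
  finally have pp: "1 - p x0 \<bullet> p x0 = (\<epsilon> / c)\<^sup>2" by (simp add: power_divide)
  have "(\<epsilon> / c)\<^sup>2 > 0" using \<epsilon> c(1) by simp
  then show "p x0 \<bullet> p x0 < 1" using pp by linarith
  have s: "lapse (p x0) = \<epsilon> / c" unfolding lapse_def pp using \<epsilon> c by simp
  have "v \<bullet> (A_of \<epsilon> (p x0) *v v) = (v \<bullet> v) / c - (z \<bullet> v)\<^sup>2 / c ^ 3"
    unfolding quad_A Q_def s using \<epsilon> c(1) by (simp add: p field_simps power2_eq_square power3_eq_cube)
  then show "v \<bullet> (H x0 *v v) \<le> v \<bullet> (A_of \<epsilon> (p x0) *v v)" using key[of v] by simp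
qed

section \<open>Chain rules for functions of the gradient\<close>

lemma comp_deriv:
  assumes "x \<in> S" and "(F has_derivative (\<lambda>r. g (p x) \<bullet> r)) (at (p x))"
  shows "((\<lambda>x. F (p x)) has_derivative (\<lambda>h. g (p x) \<bullet> (H x *v h))) (at x)"
  using has_derivative_compose[OF p_deriv[OF assms(1)] assms(2)] .

text \<open>Second order chain rule: the third derivatives of \<open>u\<close> enter linearly
  through \<open>D x0 \<xi> \<xi>\<close>, the rest is quadratic in the Hessian. It is applied to
  the form of A, to the logarithm of the lapse and to the components of the displacement.\<close>

lemma comp_sdiff_tendsto:
  assumes P: "\<And>x. x \<in> S \<Longrightarrow> p x \<bullet> p x < 1"
    and F: "\<And>q. q \<bullet> q < 1 \<Longrightarrow> (F has_derivative (\<lambda>r. g q \<bullet> r)) (at q)"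
    and g: "\<And>q. q \<bullet> q < 1 \<Longrightarrow> (g has_derivative dg q) (at q)"
    and cont: "isCont (\<lambda>x. dg (p x) (H x *v \<xi>)) x0" and x0: "x0 \<in> S"
    and xs: "xs \<longlonglongrightarrow> x0" and hs: "hs \<longlonglongrightarrow> 0" and pos: "\<And>k::nat. hs k > 0"
  shows "(\<lambda>k. sdiff (\<lambda>x. F (p x)) (xs k) (hs k *\<^sub>R \<xi>) / (hs k)\<^sup>2) \<longlonglongrightarrow>
     g (p x0) \<bullet> D x0 \<xi> \<xi> + dg (p x0) (H x0 *v \<xi>) \<bullet> (H x0 *v \<xi>)"
proof (rule sdiff_tendsto[OF open_S x0 _ _ _ xs hs pos, where v=\<xi>
      and F'="\<lambda>y h. g (p y) \<bullet> (H y *v h)"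
      and F''="\<lambda>y h. g (p y) \<bullet> D y h \<xi> + dg (p y) (H y *v h) \<bullet> (H y *v \<xi>)"])
  fix y assume y: "y \<in> S"
  show "((\<lambda>x. F (p x)) has_derivative (\<lambda>h. g (p y) \<bullet> (H y *v h))) (at y)"
    by (rule comp_deriv[where F=F and g=g, OF y F[OF P[OF y]]])
  have "((\<lambda>x. g (p x)) has_derivative (\<lambda>h. dg (p y) (H y *v h))) (at y)"
    by (rule has_derivative_compose[OF p_deriv[OF y] g[OF P[OF y]]])
  from has_derivative_inner[OF this H_deriv[OF y, of \<xi>]]
  show "((\<lambda>y. g (p y) \<bullet> (H y *v \<xi>)) has_derivative (\<lambda>h. g (p y) \<bullet> D y h \<xi> + dg (p y) (H y *v h) \<bullet> (H y *v \<xi>))) (at y)"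
    by simp
next
  have gp: "isCont (\<lambda>x. g (p x)) x0"
    using has_derivative_continuous[OF has_derivative_compose[OF p_deriv[OF x0] g[OF P[OF x0]]]] .
  have D: "isCont (\<lambda>x. D x \<xi> \<xi>) x0" and Hc: "isCont (\<lambda>x. H x *v \<xi>) x0"
    using D_cont continuous_Hv open_S x0 continuous_on_eq_continuous_at by blast+
  show "isCont (\<lambda>y. g (p y) \<bullet> D y \<xi> \<xi> + dg (p y) (H y *v \<xi>) \<bullet> (H y *v \<xi>)) x0"
    by (intro isCont_add continuous_inner gp D Hc cont)
qed

text \<open>By symmetry each component is \<open>g x\<close> paired with \<open>H x\<close> applied
  to a fixed axis vector, and for fixed vectors the derivative of \<open>H\<close> is known.\<close>

lemma Hg_deriv:
  assumes x0: "x0 \<in> S" and g: "(g has_derivative g') (at x0)"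
  shows "((\<lambda>x. H x *v g x) has_derivative (\<lambda>h. H x0 *v g' h + D x0 h (g x0))) (at x0)"
proof (rule has_derivative_vec_lambda)
  fix i
  let ?a = "axis i 1 :: real^'n"
  have "((\<lambda>x. g x \<bullet> (H x *v ?a)) has_derivative (\<lambda>h. g x0 \<bullet> D x0 h ?a + g' h \<bullet> (H x0 *v ?a))) (at x0)"
    by (rule has_derivative_inner[OF g H_deriv[OF x0]])
  then have "((\<lambda>x. (H x *v g x) $ i) has_derivative (\<lambda>h. g x0 \<bullet> D x0 h ?a + g' h \<bullet> (H x0 *v ?a))) (at x0)"
  proof (rule has_derivative_transform_within_open[OF _ open_S x0])
    fix x assume "x \<in> S"
    then have "g x \<bullet> (H x *v ?a) = ?a \<bullet> (H x *v g x)" by (intro sym_mat_inner H_sym)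
    then show "g x \<bullet> (H x *v ?a) = (H x *v g x) $ i" by (simp add: inner_axis')
  qed
  moreover have "g x0 \<bullet> D x0 h ?a + g' h \<bullet> (H x0 *v ?a) = (H x0 *v g' h + D x0 h (g x0)) $ i" for h
  proof -
    have "g' h \<bullet> (H x0 *v ?a) = ?a \<bullet> (H x0 *v g' h)" by (intro sym_mat_inner H_sym x0)
    moreover have "g x0 \<bullet> D x0 h ?a = D x0 h (g x0) \<bullet> ?a" using D_sym[OF x0] by (metis inner_commute)
    ultimately show ?thesis by (simp add: inner_axis inner_axis')
  qed
  ultimately show "((\<lambda>x. (H x *v g x) $ i) has_derivative (\<lambda>h. (H x0 *v g' h + D x0 h (g x0)) $ i)) (at x0)"
    by simp
qed

end

text \<open>The gradient is differentiable at the one point \<open>x0\<close>, so the remainder is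
  of smaller order than the squared distance: the mean value theorem reduces it to the first order
  remainder of \<open>G\<close>.\<close>

lemma peano_second_order:
  fixes f :: "'a::real_inner \<Rightarrow> real"
  assumes U: "open U" "x0 \<in> U" and f: "\<And>x. x \<in> U \<Longrightarrow> (f has_derivative (\<lambda>h. G x \<bullet> h)) (at x)"
    and G: "(G has_derivative G') (at x0)" and \<delta>: "\<delta> > 0"
  shows "\<forall>\<^sub>F x in nhds x0. \<bar>f x - f x0 - G x0 \<bullet> (x - x0) - (x - x0) \<bullet> G' (x - x0) / 2\<bar> \<le> \<delta> * (norm (x - x0))\<^sup>2"
proof -
  obtain r where r: "r > 0" "ball x0 r \<subseteq> U" using U open_contains_ball by blast
  obtain d where d: "d > 0" "\<And>y. norm (y - x0) < d \<Longrightarrow> norm (G y - G x0 - G' (y - x0)) \<le> \<delta> * norm (y - x0)"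
    using G \<delta> unfolding has_derivative_at_alt by blast
  have "\<bar>f x - f x0 - G x0 \<bullet> (x - x0) - (x - x0) \<bullet> G' (x - x0) / 2\<bar> \<le> \<delta> * (norm (x - x0))\<^sup>2"
    if x: "dist x x0 < min r d" for x
  proof -
    define z where "z = x - x0"
    have nz: "norm z < r" "norm z < d" using x by (auto simp: z_def dist_norm)
    have seg: "norm (t *\<^sub>R z) < d" "x0 + t *\<^sub>R z \<in> U" if "0 \<le> t" "t \<le> 1" for t
    proof -
      have "norm (t *\<^sub>R z) \<le> 1 * norm z" unfolding norm_scaleR using that by (intro mult_right_mono) auto
      then have *: "norm (t *\<^sub>R z) < d" "norm (t *\<^sub>R z) < r" using nz by linarith+
      then show "norm (t *\<^sub>R z) < d" by simp
      have "x0 + t *\<^sub>R z \<in> ball x0 r" using *(2) by (simp add: dist_norm)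
      then show "x0 + t *\<^sub>R z \<in> U" using r by blast
    qed
    define \<phi> where "\<phi> = (\<lambda>t. f (x0 + t *\<^sub>R z) - t * (G x0 \<bullet> z) - t\<^sup>2 * (z \<bullet> G' z) / 2)"
    define \<phi>' where "\<phi>' = (\<lambda>t. G (x0 + t *\<^sub>R z) \<bullet> z - G x0 \<bullet> z - t * (z \<bullet> G' z))"
    have D: "DERIV \<phi> t :> \<phi>' t" if "0 \<le> t" "t \<le> 1" for t
      unfolding \<phi>_def \<phi>'_def
    proof (intro DERIV_diff)
      show "((\<lambda>t. f (x0 + t *\<^sub>R z)) has_real_derivative G (x0 + t *\<^sub>R z) \<bullet> z) (at t)"
        by (rule line_derivative[OF f[OF seg(2)[OF that]]])
    qed (auto intro!: derivative_eq_intros)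
    obtain t where t: "0 < t" "t < 1" "\<phi> 1 - \<phi> 0 = (1 - 0) * \<phi>' t"
      using MVT2[of 0 1 \<phi> \<phi>'] D by auto
    have lin: "G' (t *\<^sub>R z) = t *\<^sub>R G' z" using linear_scale[OF has_derivative_linear[OF G]] .
    have "\<phi>' t = (G (x0 + t *\<^sub>R z) - G x0 - G' (t *\<^sub>R z)) \<bullet> z"
      by (simp add: \<phi>'_def inner_diff_left inner_diff_right lin inner_commute)
    then have "\<bar>\<phi>' t\<bar> \<le> norm (G (x0 + t *\<^sub>R z) - G x0 - G' (t *\<^sub>R z)) * norm z"
      using Cauchy_Schwarz_ineq2 by metis
    also have "\<dots> \<le> (\<delta> * norm (t *\<^sub>R z)) * norm z"
      using d(2)[of "x0 + t *\<^sub>R z"] seg(1)[of t] t by (intro mult_right_mono) auto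
    also have "\<dots> \<le> (\<delta> * (1 * norm z)) * norm z"
      unfolding norm_scaleR using t \<delta> by (intro mult_right_mono mult_left_mono) auto
    finally have "\<bar>\<phi>' t\<bar> \<le> \<delta> * (norm z)\<^sup>2" by (simp add: power2_eq_square)
    moreover have "\<phi> 1 - \<phi> 0 = f x - f x0 - G x0 \<bullet> z - z \<bullet> G' z / 2"
      by (simp add: \<phi>_def z_def)
    ultimately show ?thesis using t(3) by (simp add: z_def)
  qed
  then show ?thesis unfolding eventually_nhds_metric using r d by (intro exI[of _ "min r d"]) auto
qed

text \<open>Replaces second derivatives of the logarithm of the data by a quadratic error with one
  constant \<open>K\<close>. The expansion follows segments, hence is stated on balls inside the
  domain, which may fail to be convex.\<close>

lemma C11_ln_bounds:
  fixes f :: "real^'n \<Rightarrow> real"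
  assumes \<Omega>: "open \<Omega>" and C: "C11_on \<Omega> f" and m: "m > 0" "\<And>x. x \<in> \<Omega> \<Longrightarrow> m \<le> f x"
  obtains K where "K \<ge> 0" "\<And>x. x \<in> \<Omega> \<Longrightarrow> norm (grad f x /\<^sub>R f x) \<le> K"
    "\<And>x. x \<in> \<Omega> \<Longrightarrow> ((\<lambda>x. ln (f x)) has_derivative (\<lambda>h. (grad f x /\<^sub>R f x) \<bullet> h)) (at x)"
    "\<And>x. x \<in> \<Omega> \<Longrightarrow> isCont (\<lambda>x. grad f x /\<^sub>R f x) x"
    "\<And>x y r. ball x r \<subseteq> \<Omega> \<Longrightarrow> y \<in> ball x r \<Longrightarrow> \<bar>ln (f y) - ln (f x) - (grad f x /\<^sub>R f x) \<bullet> (y - x)\<bar> \<le> K * (norm (y - x))\<^sup>2"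
proof -
  have fd: "f differentiable (at x)" if "x \<in> \<Omega>" for x
    using C that by (auto simp: C11_on_def)
  have cp: "continuous_on \<Omega> (partial_deriv i f)" for i
    using C by (auto simp: C11_on_def)
  have "\<exists>B. \<forall>x\<in>\<Omega>. \<bar>partial_deriv i f x\<bar> \<le> B" for i
    using C by (auto simp: C11_on_def bounded_iff)
  then obtain B where B: "\<And>i x. x \<in> \<Omega> \<Longrightarrow> \<bar>partial_deriv i f x\<bar> \<le> B i" by metis
  have "\<exists>K. K-lipschitz_on \<Omega> (partial_deriv i f)" for i using C by (auto simp: C11_on_def)
  then obtain M where M: "\<And>i. (M i)-lipschitz_on \<Omega> (partial_deriv i f)" by metis
  define b where "b = (\<Sum>i\<in>UNIV. \<bar>B i\<bar>)"
  define k where "k = (\<Sum>i\<in>UNIV. M i)"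
  have Mn: "M i \<ge> 0" for i using M lipschitz_on_nonneg by blast
  have b0: "b \<ge> 0" and k0: "k \<ge> 0" by (auto simp: b_def k_def Mn intro!: sum_nonneg)
  have gb: "norm (grad f x) \<le> b" if "x \<in> \<Omega>" for x
    unfolding b_def using B[OF that]
    by (intro order_trans[OF norm_le_l1_cart] sum_mono) (auto simp: grad_def intro: order_trans[OF _ abs_ge_self])
  have gL: "norm (grad f y - grad f x) \<le> k * norm (y - x)" if "x \<in> \<Omega>" "y \<in> \<Omega>" for x y
    unfolding k_def sum_distrib_right
    by (intro order_trans[OF norm_le_l1_cart] sum_mono)
      (use lipschitz_onD[OF M that(2,1)] in \<open>simp add: grad_def dist_norm\<close>)
  let ?\<gamma> = "\<lambda>x. grad f x /\<^sub>R f x"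
  have fpos: "f x > 0" if "x \<in> \<Omega>" for x using m(1) m(2)[OF that] by linarith
  have lnd: "((\<lambda>x. ln (f x)) has_derivative (\<lambda>h. ?\<gamma> x \<bullet> h)) (at x)" if "x \<in> \<Omega>" for x
    using has_derivative_ln[OF fpos[OF that] has_derivative_grad[OF fd[OF that]]]
    by (rule has_derivative_cong_fun) (simp_all add: mult.commute)
  \<comment> \<open>With \<open>b\<close> a bound and \<open>k\<close> a Lipschitz constant for the
    gradient of \<open>f\<close>, and \<open>m\<close> a lower bound of \<open>f\<close>, the first
    summand bounds the gradient of \<open>ln f\<close> and the other two its Lipschitz constant
    along segments.\<close>
  define K where "K = b / m + k / m + b * b / (m * m)"
  have K0: "K \<ge> 0" "b / m \<le> K" "k / m + b * b / (m * m) \<le> K" using b0 k0 m(1) by (simp_all add: K_def)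
  have gn: "norm (?\<gamma> x) \<le> K" if "x \<in> \<Omega>" for x
  proof -
    have "norm (?\<gamma> x) \<le> b / m"
      using gb[OF that] m(2)[OF that] m(1) fpos[OF that] by (simp add: divide_inverse_commute[symmetric]) (intro frac_le b0, auto)
    then show ?thesis using K0 by linarith
  qed
  have gc: "isCont ?\<gamma> x" if "x \<in> \<Omega>" for x
  proof -
    have "isCont (partial_deriv i f) x" for i using cp \<Omega> that by (simp add: continuous_on_eq_continuous_at)
    then have "isCont (grad f) x"
      unfolding grad_def[abs_def] isCont_def by (intro tendsto_vec_lambda)
    moreover have "isCont f x" using fd[OF that] differentiable_imp_continuous_within by blast
    ultimately show ?thesis using fpos[OF that] by (intro continuous_intros) auto
  qed
  have line: "\<exists>c\<in>ball x r. norm (c - x) \<le> norm (y - x) \<and> h y - h x = gh c \<bullet> (y - x)"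
    if xy: "y \<in> ball x r" and h: "\<And>z. z \<in> ball x r \<Longrightarrow> (h has_derivative (\<lambda>v. gh z \<bullet> v)) (at z)"
    for x y r and h :: "real^'n \<Rightarrow> real" and gh
  proof -
    have seg: "x + t *\<^sub>R (y - x) \<in> ball x r \<and> norm (t *\<^sub>R (y - x)) \<le> norm (y - x)" if "0 \<le> t" "t \<le> 1" for t
    proof -
      have "norm (t *\<^sub>R (y - x)) \<le> 1 * norm (y - x)" unfolding norm_scaleR using that by (intro mult_right_mono) auto
      moreover have "norm (y - x) < r" using xy by (simp add: dist_norm norm_minus_commute)
      ultimately show ?thesis by (simp add: dist_norm)
    qed
    obtain t where t: "0 < t" "t < 1" "h (x + 1 *\<^sub>R (y - x)) - h (x + 0 *\<^sub>R (y - x)) = (1 - 0) * (gh (x + t *\<^sub>R (y - x)) \<bullet> (y - x))"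
      using MVT2[of 0 1 "\<lambda>t. h (x + t *\<^sub>R (y - x))" "\<lambda>t. gh (x + t *\<^sub>R (y - x)) \<bullet> (y - x)"]
        line_derivative[OF h] seg by auto
    then show ?thesis using seg[of t] by (intro bexI[of _ "x + t *\<^sub>R (y - x)"]) auto
  qed
  have exp: "\<bar>ln (f y) - ln (f x) - ?\<gamma> x \<bullet> (y - x)\<bar> \<le> K * (norm (y - x))\<^sup>2"
    if br: "ball x r \<subseteq> \<Omega>" "y \<in> ball x r" for x y r
  proof -
    have "0 < r" using le_less_trans[OF zero_le_dist, of x y r] br(2) by simp
    then have x: "x \<in> \<Omega>" using br(1) by (simp add: subset_iff)
    have mem: "z \<in> \<Omega>" if "z \<in> ball x r" for z using br(1) that by blast
    obtain c where c: "c \<in> ball x r" "norm (c - x) \<le> norm (y - x)" "ln (f y) - ln (f x) = ?\<gamma> c \<bullet> (y - x)"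
      using line[OF br(2), where h="\<lambda>x. ln (f x)" and gh="?\<gamma>", OF lnd[OF mem]] by blast
    have c\<Omega>: "c \<in> \<Omega>" using c br by blast
    obtain c' where c': "c' \<in> ball x r" "f c - f x = grad f c' \<bullet> (c - x)"
      using line[OF c(1), where h=f and gh="grad f", OF has_derivative_grad[OF fd[OF mem]]] by blast
    have fcx: "\<bar>f c - f x\<bar> \<le> b * norm (c - x)"
      unfolding c'(2) using gb[of c'] c'(1) br(1)
      by (intro order_trans[OF Cauchy_Schwarz_ineq2] mult_right_mono) auto
    have eq: "?\<gamma> c - ?\<gamma> x = (1 / f c) *\<^sub>R (grad f c - grad f x) - ((f c - f x) / (f c * f x)) *\<^sub>R grad f x"
    proof -
      have "(f c - f x) / (f c * f x) = inverse (f x) - inverse (f c)"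
        using fpos[OF x] fpos[OF c\<Omega>] by (simp add: field_simps)
      then show ?thesis by (simp add: scaleR_diff_left scaleR_diff_right divide_inverse)
    qed
    have "norm (?\<gamma> c - ?\<gamma> x) \<le> (1 / f c) * norm (grad f c - grad f x) + (\<bar>f c - f x\<bar> / (f c * f x)) * norm (grad f x)"
      unfolding eq using fpos[OF x] fpos[OF c\<Omega>]
      by (intro order_trans[OF norm_triangle_ineq4]) (simp add: abs_mult)
    also have "\<dots> \<le> (1 / m) * (k * norm (c - x)) + (b * norm (c - x) / (m * m)) * b"
    proof (intro add_mono mult_mono)
      show "1 / f c \<le> 1 / m" using m(1) m(2)[OF c\<Omega>] by (intro frac_le) auto
      have "m * m \<le> f c * f x" using m(1) m(2)[OF c\<Omega>] m(2)[OF x] by (intro mult_mono) auto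
      then show "\<bar>f c - f x\<bar> / (f c * f x) \<le> b * norm (c - x) / (m * m)"
        using fcx m(1) b0 by (intro frac_le) auto
    qed (use gL[OF x c\<Omega>] gb[OF x] b0 m(1) in auto)
    also have "\<dots> = (k / m + b * b / (m * m)) * norm (c - x)" by (simp add: algebra_simps)
    also have "\<dots> \<le> K * norm (y - x)" using K0 c(2) by (intro mult_mono) auto
    finally have n: "norm (?\<gamma> c - ?\<gamma> x) \<le> K * norm (y - x)" .
    have "\<bar>ln (f y) - ln (f x) - ?\<gamma> x \<bullet> (y - x)\<bar> = \<bar>(?\<gamma> c - ?\<gamma> x) \<bullet> (y - x)\<bar>"
      unfolding c(3) by (simp add: inner_diff_left)
    also have "\<dots> \<le> norm (?\<gamma> c - ?\<gamma> x) * norm (y - x)" by (rule Cauchy_Schwarz_ineq2)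
    also have "\<dots> \<le> (K * norm (y - x)) * norm (y - x)" by (rule mult_right_mono[OF n]) simp
    finally show ?thesis by (simp add: power2_eq_square)
  qed
  show ?thesis
    by (rule that[OF K0(1)], erule gn, erule lnd, erule gc, erule exp, assumption)
qed

section \<open>The transport map and the once differentiated equation\<close>

text \<open>The first order companion of \<open>sdiff_tendsto\<close>, again with moving base
  points.\<close>

lemma diff_quotient_tendsto:
  fixes F :: "'a::real_normed_vector \<Rightarrow> real"
  assumes U: "open U" "x0 \<in> U"
    and d1: "\<And>y. y \<in> U \<Longrightarrow> (F has_derivative F' y) (at y)"
    and cont: "isCont (\<lambda>y. F' y v) x0"
    and xs: "xs \<longlonglongrightarrow> x0" and hs: "hs \<longlonglongrightarrow> 0" and pos: "\<And>k::nat. hs k > 0"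
  shows "(\<lambda>k. (F (xs k + hs k *\<^sub>R v) - F (xs k)) / hs k) \<longlonglongrightarrow> F' x0 v"
proof (rule tendstoI)
  fix e :: real assume "e > 0"
  then obtain d where d: "d > 0" "\<And>y. dist y x0 < d \<Longrightarrow> dist (F' y v) (F' x0 v) < e"
    using cont unfolding continuous_at_eps_delta by blast
  obtain r where r: "r > 0" "ball x0 r \<subseteq> U" using U open_contains_ball by blast
  have "(\<lambda>k. dist (xs k) x0 + hs k * norm v) \<longlonglongrightarrow> 0 + 0 * norm v"
    by (intro tendsto_add tendsto_mult tendsto_const hs iffD1[OF tendsto_dist_iff xs])
  then have "\<forall>\<^sub>F k in sequentially. dist (xs k) x0 + hs k * norm v < min d r"
    by (rule order_tendstoD) (use d r in auto)
  then show "\<forall>\<^sub>F k in sequentially. dist ((F (xs k + hs k *\<^sub>R v) - F (xs k)) / hs k) (F' x0 v) < e"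
  proof eventually_elim
    fix k assume k: "dist (xs k) x0 + hs k * norm v < min d r"
    have near: "dist (xs k + t *\<^sub>R v) x0 < min d r" if "0 \<le> t" "t \<le> hs k" for t
    proof -
      have "dist (xs k + t *\<^sub>R v) x0 \<le> dist (xs k) x0 + norm (t *\<^sub>R v)"
        using norm_triangle_ineq[of "xs k - x0" "t *\<^sub>R v"] by (simp add: dist_norm algebra_simps)
      also have "\<dots> \<le> dist (xs k) x0 + hs k * norm v" using that by (simp add: mult_right_mono)
      finally show ?thesis using k by linarith
    qed
    have "DERIV (\<lambda>t. F (xs k + t *\<^sub>R v)) t :> F' (xs k + t *\<^sub>R v) v" if "0 \<le> t" "t \<le> hs k" for t
      by (rule line_derivative[OF d1]) (use near[OF that] r in \<open>auto simp: dist_commute\<close>)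
    then obtain t where t: "0 < t" "t < hs k"
      "F (xs k + hs k *\<^sub>R v) - F (xs k + 0 *\<^sub>R v) = (hs k - 0) * F' (xs k + t *\<^sub>R v) v"
      using MVT2[OF pos, of k "\<lambda>t. F (xs k + t *\<^sub>R v)" "\<lambda>t. F' (xs k + t *\<^sub>R v) v"] by blast
    then have "(F (xs k + hs k *\<^sub>R v) - F (xs k)) / hs k = F' (xs k + t *\<^sub>R v) v"
      using pos[of k] by simp
    then show "dist ((F (xs k + hs k *\<^sub>R v) - F (xs k)) / hs k) (F' x0 v) < e"
      using d(2) near[of t] t by simp
  qed
qed

lemma ddm_sym: "ddm \<epsilon> p c q \<bullet> q = ddm \<epsilon> p q q \<bullet> c"
  unfolding ddm_def inner_add_left inner_scaleR_left by (simp add: inner_commute[of q c] algebra_simps)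

lemma dm_linear: "dm \<epsilon> p (q + r) = dm \<epsilon> p q + dm \<epsilon> p r" "dm \<epsilon> p (c *\<^sub>R q) = c *\<^sub>R dm \<epsilon> p q"
  by (simp_all add: dm_def inner_add_right algebra_simps add_divide_distrib)

context C3_function begin

definition T_of :: "real \<Rightarrow> real^'n \<Rightarrow> real^'n" where
  "T_of \<epsilon> x = x - m_of \<epsilon> (p x)"

lemma T_deriv:
  assumes "x \<in> S" "p x \<bullet> p x < 1"
  shows "(T_of \<epsilon> has_derivative (\<lambda>h. h - dm \<epsilon> (p x) (H x *v h))) (at x)"
  unfolding T_of_def[abs_def]
  by (intro has_derivative_diff has_derivative_ident has_derivative_compose[OF p_deriv m_deriv] assms)

lemma T_inner_deriv:
  assumes "x \<in> S" "p x \<bullet> p x < 1"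
  shows "((\<lambda>x. T_of \<epsilon> x \<bullet> c) has_derivative (\<lambda>h. h \<bullet> c - dm \<epsilon> (p x) c \<bullet> (H x *v h))) (at x)"
proof -
  have "((\<lambda>x. T_of \<epsilon> x \<bullet> c) has_derivative (\<lambda>h. (h - dm \<epsilon> (p x) (H x *v h)) \<bullet> c)) (at x)"
    by (intro has_derivative_inner_left T_deriv assms)
  then show ?thesis by (simp add: inner_diff_left dm_sym)
qed

lemma continuous_comp:
  assumes "x0 \<in> S" "\<And>x. x \<in> S \<Longrightarrow> p x \<bullet> p x < 1"
  shows "isCont p x0" "isCont (\<lambda>x. H x *v a) x0" "isCont (\<lambda>x. lapse (p x)) x0" "isCont (\<lambda>x. dm \<epsilon> (p x) c) x0" "isCont (T_of \<epsilon>) x0"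
proof -
  show "isCont p x0" using has_derivative_continuous[OF p_deriv[OF assms(1)]] .
  show "isCont (\<lambda>x. H x *v a) x0" using continuous_Hv open_S assms continuous_on_eq_continuous_at by blast
  show "isCont (\<lambda>x. lapse (p x)) x0"
    using has_derivative_continuous[OF has_derivative_compose[OF p_deriv[OF assms(1)] lapse_deriv]] assms by blast
  show "isCont (\<lambda>x. dm \<epsilon> (p x) c) x0"
    using has_derivative_continuous[OF has_derivative_compose[OF p_deriv[OF assms(1)] dm_deriv]] assms by blast
  show "isCont (T_of \<epsilon>) x0"
    using has_derivative_continuous[OF T_deriv] assms by blast
qed

lemma continuous_on_A_of:
  assumes "\<And>x. x \<in> S \<Longrightarrow> p x \<bullet> p x < 1"
  shows "continuous_on S (\<lambda>x. A_of \<epsilon> (p x))"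
proof (intro continuous_at_imp_continuous_on ballI)
  fix x assume "x \<in> S"
  note c = continuous_comp(1,3)[OF this assms]
  have "isCont (\<lambda>x. G_mat (p x)) x"
    unfolding G_mat_def isCont_def
    by (intro tendsto_vec_lambda tendsto_intros isContD[OF c(1)])
  then show "isCont (\<lambda>x. A_of \<epsilon> (p x)) x"
    unfolding A_of_def divide_inverse by (intro continuous_intros c)
qed

lemma T_quotient_tendsto:
  assumes P: "\<And>x. x \<in> S \<Longrightarrow> p x \<bullet> p x < 1" and x0: "x0 \<in> S"
    and xs: "xs \<longlonglongrightarrow> x0" and hs: "hs \<longlonglongrightarrow> 0" and pos: "\<And>k::nat. hs k > 0"
  shows "(\<lambda>k. (T_of \<epsilon> (xs k + hs k *\<^sub>R v) - T_of \<epsilon> (xs k)) /\<^sub>R hs k) \<longlonglongrightarrow> v - dm \<epsilon> (p x0) (H x0 *v v)"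
proof (rule vec_tendstoI)
  fix i
  let ?c = "axis i 1 :: real^'n"
  have "isCont (\<lambda>y. v \<bullet> ?c - dm \<epsilon> (p y) ?c \<bullet> (H y *v v)) x0"
    by (intro continuous_intros continuous_comp x0 P)
  from diff_quotient_tendsto[OF open_S x0 T_inner_deriv[OF _ P] this xs hs pos]
  have "(\<lambda>k. (T_of \<epsilon> (xs k + hs k *\<^sub>R v) \<bullet> ?c - T_of \<epsilon> (xs k) \<bullet> ?c) / hs k) \<longlonglongrightarrow> v \<bullet> ?c - dm \<epsilon> (p x0) ?c \<bullet> (H x0 *v v)"
    by simp
  then show "(\<lambda>k. ((T_of \<epsilon> (xs k + hs k *\<^sub>R v) - T_of \<epsilon> (xs k)) /\<^sub>R hs k) $ i) \<longlonglongrightarrow> (v - dm \<epsilon> (p x0) (H x0 *v v)) $ i"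
    unfolding dm_sym[of _ _ ?c] by (simp add: inner_axis divide_inverse mult.commute)
qed

lemma T_sdiff_tendsto:
  assumes P: "\<And>x. x \<in> S \<Longrightarrow> p x \<bullet> p x < 1" and x0: "x0 \<in> S"
    and xs: "xs \<longlonglongrightarrow> x0" and hs: "hs \<longlonglongrightarrow> 0" and pos: "\<And>k::nat. hs k > 0"
  shows "(\<lambda>k. sdiff (T_of \<epsilon>) (xs k) (hs k *\<^sub>R v) /\<^sub>R (hs k)\<^sup>2) \<longlonglongrightarrow>
     - (dm \<epsilon> (p x0) (D x0 v v) + ddm \<epsilon> (p x0) (H x0 *v v) (H x0 *v v))"
proof (rule vec_tendstoI)
  fix i
  let ?c = "axis i 1 :: real^'n"
  have ct: "isCont (\<lambda>x. ddm \<epsilon> (p x) ?c (H x *v v)) x0"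
    unfolding ddm_def using lapse_pos[OF P[OF x0]]
    by (intro continuous_intros continuous_comp x0 P) auto
  have "(\<lambda>k. sdiff (\<lambda>x. m_of \<epsilon> (p x) \<bullet> ?c) (xs k) (hs k *\<^sub>R v) / (hs k)\<^sup>2) \<longlonglongrightarrow>
    dm \<epsilon> (p x0) ?c \<bullet> D x0 v v + ddm \<epsilon> (p x0) ?c (H x0 *v v) \<bullet> (H x0 *v v)"
    by (rule comp_sdiff_tendsto[OF P m_inner_deriv dm_deriv ct x0 xs hs pos])
  from tendsto_minus[OF this]
  have "(\<lambda>k. - (sdiff (\<lambda>x. m_of \<epsilon> (p x) \<bullet> ?c) (xs k) (hs k *\<^sub>R v) / (hs k)\<^sup>2)) \<longlonglongrightarrow>
     (- (dm \<epsilon> (p x0) (D x0 v v) + ddm \<epsilon> (p x0) (H x0 *v v) (H x0 *v v))) $ i"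
    using dm_sym[of \<epsilon> "p x0" ?c] ddm_sym[of \<epsilon> "p x0" ?c] by (simp add: inner_axis)
  moreover have "- (sdiff (\<lambda>x. m_of \<epsilon> (p x) \<bullet> ?c) y w / h) = (sdiff (T_of \<epsilon>) y w /\<^sub>R h) $ i" for y w h
    by (simp add: sdiff_def T_of_def inner_axis divide_inverse algebra_simps)
  ultimately show "(\<lambda>k. (sdiff (T_of \<epsilon>) (xs k) (hs k *\<^sub>R v) /\<^sub>R (hs k)\<^sup>2) $ i) \<longlonglongrightarrow>
     (- (dm \<epsilon> (p x0) (D x0 v v) + ddm \<epsilon> (p x0) (H x0 *v v) (H x0 *v v))) $ i"
    by simp
qed

text \<open>The limit matrix is assembled by polarisation from the limits of the scalar functions
  \<open>Q\<close>. Its quadratic form is then identified by uniqueness of limits, with the base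
  point held at \<open>x0\<close>.\<close>

lemma A_sdiff_tendsto:
  assumes P: "\<And>x. x \<in> S \<Longrightarrow> p x \<bullet> p x < 1" and x0: "x0 \<in> S"
  obtains \<alpha> where "\<And>xs hs. xs \<longlonglongrightarrow> x0 \<Longrightarrow> hs \<longlonglongrightarrow> 0 \<Longrightarrow> (\<And>k::nat. hs k > 0) \<Longrightarrow>
      (\<lambda>k. sdiff (\<lambda>x. A_of \<epsilon> (p x)) (xs k) (hs k *\<^sub>R \<xi>) /\<^sub>R (hs k)\<^sup>2) \<longlonglongrightarrow> \<alpha>"
    and "\<And>v. v \<bullet> (\<alpha> *v v) = gQ \<epsilon> v (p x0) \<bullet> D x0 \<xi> \<xi> + dgQ \<epsilon> v (p x0) (H x0 *v \<xi>) \<bullet> (H x0 *v \<xi>)"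
proof -
  define q2 where "q2 = (\<lambda>v. gQ \<epsilon> v (p x0) \<bullet> D x0 \<xi> \<xi> + dgQ \<epsilon> v (p x0) (H x0 *v \<xi>) \<bullet> (H x0 *v \<xi>))"
  let ?a = "\<lambda>x. A_of \<epsilon> (p x)"
  define \<alpha> where "\<alpha> = (\<chi> i j. (q2 (axis i 1 + axis j 1) - q2 (axis i 1) - q2 (axis j 1)) / 2)"
  have Qlim: "(\<lambda>k. sdiff (\<lambda>x. Q \<epsilon> v (p x)) (xs k) (hs k *\<^sub>R \<xi>) / (hs k)\<^sup>2) \<longlonglongrightarrow> q2 v"
    if xs: "xs \<longlonglongrightarrow> x0" and hs: "hs \<longlonglongrightarrow> 0" and pos: "\<And>k::nat. hs k > 0" for xs hs v
  proof -
    have ct: "isCont (\<lambda>x. dgQ \<epsilon> v (p x) (H x *v \<xi>)) x0"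
      unfolding dgQ_def using lapse_pos[OF P[OF x0]]
      by (intro continuous_intros continuous_comp x0 P) auto
    show ?thesis unfolding q2_def
      by (rule comp_sdiff_tendsto[OF P Q_deriv gQ_deriv ct x0 xs hs pos])
  qed
  have Asym: "sym_mat (A_of \<epsilon> q)" for q
    by (simp add: sym_mat_def A_of_def G_mat_def transpose_def vec_eq_iff mult.commute)
  have pol: "(A_of \<epsilon> q) $ i $ j = (Q \<epsilon> (axis i 1 + axis j 1) q - Q \<epsilon> (axis i 1) q - Q \<epsilon> (axis j 1) q) / 2" for q i j
  proof -
    have "axis i 1 \<bullet> (A_of \<epsilon> q *v axis j 1) = A_of \<epsilon> q $ i $ j"
      by (simp add: inner_axis' matrix_vector_mult_basis column_def)
    moreover have "axis j 1 \<bullet> (A_of \<epsilon> q *v axis i 1) = axis i 1 \<bullet> (A_of \<epsilon> q *v axis j 1)"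
      by (rule sym_mat_inner[OF Asym])
    ultimately show ?thesis
      unfolding quad_A[symmetric] matrix_vector_right_distrib inner_add_left inner_add_right by simp
  qed
  have lim: "(\<lambda>k. sdiff ?a (xs k) (hs k *\<^sub>R \<xi>) /\<^sub>R (hs k)\<^sup>2) \<longlonglongrightarrow> \<alpha>"
    if xs: "xs \<longlonglongrightarrow> x0" and hs: "hs \<longlonglongrightarrow> 0" and pos: "\<And>k::nat. hs k > 0" for xs hs
  proof (intro vec_tendstoI)
    fix i j
    have "(\<lambda>k. (sdiff (\<lambda>x. Q \<epsilon> (axis i 1 + axis j 1) (p x)) (xs k) (hs k *\<^sub>R \<xi>) / (hs k)\<^sup>2
       - sdiff (\<lambda>x. Q \<epsilon> (axis i 1) (p x)) (xs k) (hs k *\<^sub>R \<xi>) / (hs k)\<^sup>2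
       - sdiff (\<lambda>x. Q \<epsilon> (axis j 1) (p x)) (xs k) (hs k *\<^sub>R \<xi>) / (hs k)\<^sup>2) / 2) \<longlonglongrightarrow> \<alpha> $ i $ j"
      unfolding \<alpha>_def vec_lambda_beta
      by (rule tendsto_divide[OF tendsto_diff[OF tendsto_diff[OF Qlim[OF xs hs pos] Qlim[OF xs hs pos]]
          Qlim[OF xs hs pos]] tendsto_const]) simp
    moreover have "(sdiff (\<lambda>x. Q \<epsilon> (axis i 1 + axis j 1) (p x)) y w / h
       - sdiff (\<lambda>x. Q \<epsilon> (axis i 1) (p x)) y w / h
       - sdiff (\<lambda>x. Q \<epsilon> (axis j 1) (p x)) y w / h) / 2 = (sdiff ?a y w /\<^sub>R h) $ i $ j" for y w h
    proof -
      have alg: "((a1 + a2 - 2 * a3) / h - (b1 + b2 - 2 * b3) / h - (c1 + c2 - 2 * c3) / h) / 2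
        = inverse h * ((a1 - b1 - c1) / 2 + (a2 - b2 - c2) / 2 - 2 * ((a3 - b3 - c3) / 2))" for a1 a2 a3 b1 b2 b3 c1 c2 c3 :: real
        unfolding divide_inverse[of _ h] by algebra
      show ?thesis unfolding sdiff_def real_scaleR_def alg by (simp add: pol)
    qed
    ultimately show "(\<lambda>k. (sdiff ?a (xs k) (hs k *\<^sub>R \<xi>) /\<^sub>R (hs k)\<^sup>2) $ i $ j) \<longlonglongrightarrow> \<alpha> $ i $ j"
      by simp
  qed
  have "v \<bullet> (\<alpha> *v v) = q2 v" for v
  proof -
    define hs where "hs = (\<lambda>k::nat. inverse (real (Suc k)))"
    have hs: "hs \<longlonglongrightarrow> 0" "\<And>k. hs k > 0" unfolding hs_def by (rule LIMSEQ_inverse_real_of_nat) simp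
    have "(\<lambda>k. v \<bullet> ((sdiff ?a x0 (hs k *\<^sub>R \<xi>) /\<^sub>R (hs k)\<^sup>2) *v v)) \<longlonglongrightarrow> v \<bullet> (\<alpha> *v v)"
      unfolding matrix_vector_mult_def
      by (intro tendsto_inner tendsto_const tendsto_vec_lambda tendsto_sum tendsto_mult tendsto_vec_nth lim hs)
    moreover have "v \<bullet> ((sdiff ?a x0 w /\<^sub>R h) *v v) = sdiff (\<lambda>x. Q \<epsilon> v (p x)) x0 w / h" for w h
      by (simp add: sdiff_def quad_A[symmetric] matrix_vector_mult_add_rdistrib matrix_vector_mult_diff_rdistrib
         scaleR_matrix_vector_assoc[symmetric] inner_add_right inner_diff_right divide_inverse mult.commute)
    ultimately have "(\<lambda>k. sdiff (\<lambda>x. Q \<epsilon> v (p x)) x0 (hs k *\<^sub>R \<xi>) / (hs k)\<^sup>2) \<longlonglongrightarrow> v \<bullet> (\<alpha> *v v)"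
      by (simp only:)
    then show ?thesis by (rule LIMSEQ_unique[OF _ Qlim[OF tendsto_const hs]])
  qed
  then show ?thesis using that[OF lim] unfolding q2_def by blast
qed

text \<open>Differentiating the determinant is avoided: by concavity its logarithm is touched from above at
  \<^term>\<open>x0\<close> by a function whose derivative is read off.\<close>

lemma first_order_equation:
  assumes x0: "x0 \<in> S" and P: "\<And>x. x \<in> S \<Longrightarrow> p x \<bullet> p x < 1"
    and pd: "\<And>x. x \<in> S \<Longrightarrow> pos_def (A_of \<epsilon> (p x) - H x)"
    and db: "diag_basis G (A_of \<epsilon> (p x0) - H x0) e \<mu>"
    and psi: "((\<lambda>x. ln (det (A_of \<epsilon> (p x) - H x))) has_derivative \<psi>') (at x0)"
  shows "(\<Sum>i\<in>UNIV. (gQ \<epsilon> (e i) (p x0) \<bullet> (H x0 *v k) - D x0 (e i) (e i) \<bullet> k) / \<mu> i) = \<psi>' k"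
proof -
  interpret diag_basis G "A_of \<epsilon> (p x0) - H x0" e \<mu> by fact
  let ?w = "\<lambda>x. A_of \<epsilon> (p x) - H x"
  have mu: "\<mu> i > 0" for i by (rule pos_def_eigen[OF pd[OF x0]])
  then have mu0: "\<mu> i \<noteq> 0" for i by (metis less_irrefl)
  obtain W where W: "W ** ?w x0 = mat 1" using pos_def_invertible[OF pd[OF x0]] by blast
  \<comment> \<open>The sum is the trace of \<open>?w x\<close> against the fixed inverse
    \<open>W\<close>, so the tangent inequality says that \<open>\<Phi>\<close> is minimal at
    \<open>x0\<close>.\<close>
  define \<Phi> where "\<Phi> = (\<lambda>x. (\<Sum>i\<in>UNIV. (Q \<epsilon> (e i) (p x) - (H x *v e i) \<bullet> e i) / \<mu> i) - ln (det (?w x)))"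
  have quad: "e i \<bullet> (?w x *v e i) = Q \<epsilon> (e i) (p x) - (H x *v e i) \<bullet> e i" for i x
    by (simp add: matrix_vector_mult_diff_rdistrib inner_diff_right quad_A inner_commute)
  have tr: "trace (W ** ?w x) = (\<Sum>i\<in>UNIV. (Q \<epsilon> (e i) (p x) - (H x *v e i) \<bullet> e i) / \<mu> i)" for x
    using trace_inverse_mult[OF mu0 W, of "?w x"] unfolding quad .
  have min: "\<Phi> x0 \<le> \<Phi> x" if "x \<in> S" for x
    using ln_det_tangent[OF pd[OF x0] pd[OF that] W] unfolding trace_mult_linear(2)[of W "?w x" "?w x0"] tr \<Phi>_def by linarith
  have qd: "((\<lambda>x. Q \<epsilon> v (p x)) has_derivative (\<lambda>h. gQ \<epsilon> v (p x0) \<bullet> (H x0 *v h))) (at x0)" for v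
    by (rule comp_deriv[where g="gQ \<epsilon> v", OF x0 Q_deriv[OF P[OF x0]]])
  have d: "(\<Phi> has_derivative (\<lambda>h. (\<Sum>i\<in>UNIV. (gQ \<epsilon> (e i) (p x0) \<bullet> (H x0 *v h) - D x0 h (e i) \<bullet> e i) / \<mu> i) - \<psi>' h)) (at x0)"
    unfolding \<Phi>_def divide_inverse
    by (intro has_derivative_diff has_derivative_sum has_derivative_mult_left psi
       qd has_derivative_inner_left H_deriv x0)
  have "(\<lambda>h. (\<Sum>i\<in>UNIV. (gQ \<epsilon> (e i) (p x0) \<bullet> (H x0 *v h) - D x0 h (e i) \<bullet> e i) / \<mu> i) - \<psi>' h) = (\<lambda>h. 0)"
    by (rule differential_zero_maxmin[OF x0 open_S d]) (use min in \<open>intro disjI2 ballI\<close>)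
  from fun_cong[OF this, of k] show ?thesis
    using D_commute[OF x0, of k] D_sym[OF x0, of _ k] by (simp add: D_commute[OF x0, of k] D_sym[OF x0, of _ k])
qed

end

section \<open>The inequality at the maximum point\<close>

context C3_function begin

text \<open>All third derivatives of \<^term>\<open>u\<close> cancel: those on the two sides of the viscosity inequality are related by
  the first order condition at the touching point and by the once differentiated equation.\<close>

lemma key_inequality:
  fixes \<xi> :: "real^'n" and c0 N Kf Kg \<epsilon> :: real and lf lg \<rho> :: "real^'n \<Rightarrow> real" and \<gamma>f :: "real^'n" and \<gamma>g g\<rho> dg\<rho> :: "real^'n \<Rightarrow> real^'n"
  assumes x0: "x0 \<in> S" and P: "\<And>x. x \<in> S \<Longrightarrow> p x \<bullet> p x < 1"
    and pd: "\<And>x. x \<in> S \<Longrightarrow> pos_def (A_of \<epsilon> (p x) - H x)"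
    and db: "diag_basis G (A_of \<epsilon> (p x0) - H x0) e \<mu>"
    and lndet: "\<And>x. x \<in> S \<Longrightarrow> ln (det (A_of \<epsilon> (p x) - H x)) = c0 + N * ln (lapse (p x)) + lf x - lg (T_of \<epsilon> x)"
    and lf: "(lf has_derivative (\<lambda>h. \<gamma>f \<bullet> h)) (at x0)"
    and lf2: "\<And>x v. x \<in> S \<Longrightarrow> x + v \<in> S \<Longrightarrow> x - v \<in> S \<Longrightarrow> sdiff lf x v \<ge> - (2 * Kf * (norm v)\<^sup>2)"
    and V: "open V" "T_of \<epsilon> x0 \<in> V"
    and lg: "(lg has_derivative (\<lambda>h. \<gamma>g (T_of \<epsilon> x0) \<bullet> h)) (at (T_of \<epsilon> x0))"
    and \<gamma>g: "isCont \<gamma>g (T_of \<epsilon> x0)"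
    and lg2: "\<And>y z. y \<in> V \<Longrightarrow> z \<in> V \<Longrightarrow> lg z - lg y \<le> \<gamma>g y \<bullet> (z - y) + Kg * (norm (z - y))\<^sup>2"
    and \<rho>: "\<And>x. x \<in> S \<Longrightarrow> (\<rho> has_derivative (\<lambda>h. g\<rho> x \<bullet> h)) (at x)"
    and g\<rho>: "(g\<rho> has_derivative dg\<rho>) (at x0)"
    and touch: "\<And>x. x \<in> S \<Longrightarrow> \<xi> \<bullet> (H x *v \<xi>) \<ge> \<rho> x * Q \<epsilon> \<xi> (p x)" "\<xi> \<bullet> (H x0 *v \<xi>) = \<rho> x0 * Q \<epsilon> \<xi> (p x0)"
  shows "(\<Sum>i\<in>UNIV. (\<rho> x0 * (dgQ \<epsilon> \<xi> (p x0) (H x0 *v e i) \<bullet> (H x0 *v e i))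
        + 2 * (gQ \<epsilon> \<xi> (p x0) \<bullet> (H x0 *v e i)) * (g\<rho> x0 \<bullet> e i) + Q \<epsilon> \<xi> (p x0) * (dg\<rho> (e i) \<bullet> e i)) / \<mu> i)
      + \<rho> x0 * ((\<gamma>g (T_of \<epsilon> x0) - \<gamma>f) \<bullet> gQ \<epsilon> \<xi> (p x0))
    \<le> (\<Sum>i\<in>UNIV. dgQ \<epsilon> (e i) (p x0) (H x0 *v \<xi>) \<bullet> (H x0 *v \<xi>) / \<mu> i)
      - N * (dgl (p x0) (H x0 *v \<xi>) \<bullet> (H x0 *v \<xi>)) + 2 * Kf * (norm \<xi>)\<^sup>2
      + 2 * Kg * (norm (\<xi> - dm \<epsilon> (p x0) (H x0 *v \<xi>)))\<^sup>2
      - \<gamma>g (T_of \<epsilon> x0) \<bullet> ddm \<epsilon> (p x0) (H x0 *v \<xi>) (H x0 *v \<xi>)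
      + Q \<epsilon> \<xi> (p x0) * ((\<Sum>i\<in>UNIV. gQ \<epsilon> (e i) (p x0) \<bullet> g\<rho> x0 / \<mu> i)
          - N * (gl (p x0) \<bullet> g\<rho> x0) - dm \<epsilon> (p x0) (\<gamma>g (T_of \<epsilon> x0)) \<bullet> g\<rho> x0)"
proof -
  interpret B: diag_basis G "A_of \<epsilon> (p x0) - H x0" e \<mu> by fact
  have mu0: "\<mu> i \<noteq> 0" for i using B.pos_def_eigen[OF pd[OF x0], of i] by simp
  define p0 where "p0 = p x0"
  define \<gamma> where "\<gamma> = \<gamma>g (T_of \<epsilon> x0)"
  define t where "t = D x0 \<xi> \<xi>"
  define \<eta> where "\<eta> = H x0 *v \<xi>"
  define gq where "gq = gQ \<epsilon> \<xi> p0"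
  define q where "q = Q \<epsilon> \<xi> p0"
  \<comment> \<open>The gradient of the touching function \<open>\<phi>\<close>; its derivative
    \<open>G'\<close> at \<open>x0\<close> plays the part of the matrix \<open>N\<close> in the
    viscosity inequality.\<close>
  define G\<phi> where "G\<phi> = (\<lambda>x. \<rho> x *\<^sub>R (H x *v gQ \<epsilon> \<xi> (p x)) + Q \<epsilon> \<xi> (p x) *\<^sub>R g\<rho> x)"
  define \<phi> where "\<phi> = (\<lambda>x. \<rho> x * Q \<epsilon> \<xi> (p x))"
  define G' where "G' = (\<lambda>h. \<rho> x0 *\<^sub>R (H x0 *v dgQ \<epsilon> \<xi> p0 (H x0 *v h) + D x0 h gq) + (g\<rho> x0 \<bullet> h) *\<^sub>R (H x0 *v gq)
     + (q *\<^sub>R dg\<rho> h + (gq \<bullet> (H x0 *v h)) *\<^sub>R g\<rho> x0))"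
  have Qd: "((\<lambda>x. Q \<epsilon> \<xi> (p x)) has_derivative (\<lambda>h. gQ \<epsilon> \<xi> (p x) \<bullet> (H x *v h))) (at x)" if "x \<in> S" for x
    by (rule comp_deriv[where g="gQ \<epsilon> \<xi>", OF that Q_deriv[OF P[OF that]]])
  have Hs: "a \<bullet> (H x *v b) = (H x *v a) \<bullet> b" if "x \<in> S" for a b x
    using sym_mat_inner[OF H_sym[OF that], of a b] by (simp add: inner_commute)
  have \<phi>d: "(\<phi> has_derivative (\<lambda>h. G\<phi> x \<bullet> h)) (at x)" if x: "x \<in> S" for x
    using has_derivative_mult[OF \<rho>[OF x] Qd[OF x]] unfolding \<phi>_def
    by (rule has_derivative_cong_fun) (simp_all add: G\<phi>_def inner_add_left Hs[OF x] mult.commute)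
  have gQd: "((\<lambda>x. gQ \<epsilon> \<xi> (p x)) has_derivative (\<lambda>h. dgQ \<epsilon> \<xi> p0 (H x0 *v h))) (at x0)"
    unfolding p0_def by (rule has_derivative_compose[OF p_deriv[OF x0] gQ_deriv[OF P[OF x0]]])
  have G\<phi>d: "(G\<phi> has_derivative G') (at x0)"
    unfolding G\<phi>_def G'_def gq_def q_def p0_def
    by (intro has_derivative_add has_derivative_scaleR \<rho> x0 g\<rho> Qd Hg_deriv gQd[unfolded p0_def])
  have linG': "linear G'" using has_derivative_linear[OF G\<phi>d] .
  have N: "matrix G' *v h = G' h" for h using matrix_works[OF linear_matrix_vector_mul_eq[THEN iffD2, OF linG']] .
  have Htouch: "\<forall>\<^sub>F x in nhds x0. \<xi> \<bullet> (H x *v \<xi>) \<ge> \<xi> \<bullet> (H x0 *v \<xi>) + G\<phi> x0 \<bullet> (x - x0)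
         + (x - x0) \<bullet> (matrix G' *v (x - x0)) / 2 - \<delta> * (norm (x - x0))\<^sup>2" if "\<delta> > 0" for \<delta>
  proof -
    have "\<forall>\<^sub>F x in nhds x0. \<bar>\<phi> x - \<phi> x0 - G\<phi> x0 \<bullet> (x - x0) - (x - x0) \<bullet> G' (x - x0) / 2\<bar> \<le> \<delta> * (norm (x - x0))\<^sup>2"
      by (rule peano_second_order[OF open_S x0 \<phi>d G\<phi>d that])
    then show ?thesis using eventually_nhds_in_open[OF open_S x0]
    proof eventually_elim
      fix x assume x: "\<bar>\<phi> x - \<phi> x0 - G\<phi> x0 \<bullet> (x - x0) - (x - x0) \<bullet> G' (x - x0) / 2\<bar> \<le> \<delta> * (norm (x - x0))\<^sup>2"
        and "x \<in> S"
      then have "\<xi> \<bullet> (H x *v \<xi>) \<ge> \<phi> x" using touch(1) by (simp add: \<phi>_def)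
      then show "\<xi> \<bullet> (H x *v \<xi>) \<ge> \<xi> \<bullet> (H x0 *v \<xi>) + G\<phi> x0 \<bullet> (x - x0)
           + (x - x0) \<bullet> (matrix G' *v (x - x0)) / 2 - \<delta> * (norm (x - x0))\<^sup>2"
        using x touch(2) unfolding N \<phi>_def by linarith
    qed
  qed
  \<comment> \<open>First order condition at the touching point: \<open>t\<close> is the gradient at
    \<open>x0\<close> of the second derivative of \<open>u\<close> along
    \<open>\<xi>\<close>.\<close>
  have tG: "t = G\<phi> x0"
  proof -
    have d: "((\<lambda>x. (H x *v \<xi>) \<bullet> \<xi> - \<phi> x) has_derivative (\<lambda>h. D x0 h \<xi> \<bullet> \<xi> - G\<phi> x0 \<bullet> h)) (at x0)"
      by (intro has_derivative_diff has_derivative_inner_left H_deriv \<phi>d x0)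
    have "(\<lambda>h. D x0 h \<xi> \<bullet> \<xi> - G\<phi> x0 \<bullet> h) = (\<lambda>h. 0)"
      by (rule differential_zero_maxmin[OF x0 open_S d])
        (use touch in \<open>auto simp: \<phi>_def inner_commute[of "_ *v _" \<xi>]\<close>)
    then have "D x0 (t - G\<phi> x0) \<xi> \<bullet> \<xi> - G\<phi> x0 \<bullet> (t - G\<phi> x0) = 0" by (rule fun_cong)
    moreover have "D x0 h \<xi> \<bullet> \<xi> = t \<bullet> h" for h
      unfolding t_def D_commute[OF x0, of h \<xi>] by (rule D_sym[OF x0])
    ultimately have "(t - G\<phi> x0) \<bullet> (t - G\<phi> x0) = 0" by (simp add: inner_diff_left)
    then show ?thesis by (simp only: inner_eq_zero_iff right_minus_eq)
  qed
  define \<psi> where "\<psi> = (\<lambda>x. ln (det (A_of \<epsilon> (p x) - H x)))"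
  have psid: "(\<psi> has_derivative (\<lambda>h. N * (gl p0 \<bullet> (H x0 *v h)) + \<gamma>f \<bullet> h - \<gamma> \<bullet> (h - dm \<epsilon> p0 (H x0 *v h)))) (at x0)"
  proof -
    have "((\<lambda>x. c0 + N * ln (lapse (p x)) + lf x - lg (T_of \<epsilon> x)) has_derivative
      (\<lambda>h. 0 + N * (gl p0 \<bullet> (H x0 *v h)) + \<gamma>f \<bullet> h - \<gamma> \<bullet> (h - dm \<epsilon> p0 (H x0 *v h)))) (at x0)"
      unfolding p0_def \<gamma>_def
      by (intro has_derivative_diff has_derivative_add has_derivative_const has_derivative_mult_right lf
         comp_deriv[where F="\<lambda>p. ln (lapse p)" and g=gl, OF x0 ln_lapse_deriv[OF P[OF x0]]]
         has_derivative_compose[OF T_deriv[OF x0 P[OF x0]] lg])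
    then show ?thesis
      by (simp, elim has_derivative_transform_within_open[OF _ open_S x0]) (simp add: lndet \<psi>_def)
  qed
  \<comment> \<open>The limit of a lower bound for the second difference quotients of the right
    side. The quadratic errors of the data are paid once for each shifted point, whence the factor 2
    and the two norms, for \<open>\<xi>\<close> and \<open>- \<xi>\<close>.\<close>
  define \<beta> where "\<beta> = N * (gl p0 \<bullet> t + dgl p0 \<eta> \<bullet> \<eta>) - 2 * Kf * (norm \<xi>)\<^sup>2
     - \<gamma> \<bullet> (- (dm \<epsilon> p0 t + ddm \<epsilon> p0 \<eta> \<eta>)) - Kg * ((norm (\<xi> - dm \<epsilon> p0 (H x0 *v \<xi>)))\<^sup>2 + (norm (- \<xi> - dm \<epsilon> p0 (H x0 *v (- \<xi>))))\<^sup>2)"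
  have psi2: "\<forall>\<^sub>F k in sequentially. sdiff \<psi> (xs k) (hs k *\<^sub>R \<xi>) / (hs k)\<^sup>2 \<ge> \<beta> - c"
    if xs: "xs \<longlonglongrightarrow> x0" and hs: "hs \<longlonglongrightarrow> 0" and pos: "\<And>k::nat. hs k > 0" and c: "c > 0" for xs hs c
  proof -
    let ?T = "T_of \<epsilon>"
    define R where "R = (\<lambda>k. N * (sdiff (\<lambda>x. ln (lapse (p x))) (xs k) (hs k *\<^sub>R \<xi>) / (hs k)\<^sup>2) - 2 * Kf * (norm \<xi>)\<^sup>2
      - \<gamma>g (?T (xs k)) \<bullet> (sdiff ?T (xs k) (hs k *\<^sub>R \<xi>) /\<^sub>R (hs k)\<^sup>2)
      - Kg * ((norm ((?T (xs k + hs k *\<^sub>R \<xi>) - ?T (xs k)) /\<^sub>R hs k))\<^sup>2 + (norm ((?T (xs k + hs k *\<^sub>R (- \<xi>)) - ?T (xs k)) /\<^sub>R hs k))\<^sup>2))"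
    have Tc: "isCont ?T x0" by (rule continuous_comp(5)[OF x0 P])
    have glc: "isCont (\<lambda>x. dgl (p x) (H x *v \<xi>)) x0"
      unfolding dgl_def using lapse_pos[OF P[OF x0]]
      by (intro continuous_intros continuous_comp x0 P) auto
    have "(\<lambda>k. \<gamma>g (?T (xs k))) \<longlonglongrightarrow> \<gamma>"
      unfolding \<gamma>_def by (rule isCont_tendsto_compose[OF \<gamma>g isCont_tendsto_compose[OF Tc xs]])
    then have "R \<longlonglongrightarrow> \<beta>"
      unfolding R_def \<beta>_def p0_def t_def \<eta>_def
      by (intro tendsto_diff tendsto_add tendsto_const tendsto_mult[OF tendsto_const] tendsto_power tendsto_norm tendsto_inner
        comp_sdiff_tendsto[OF P ln_lapse_deriv gl_deriv glc x0 xs hs pos]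
        T_sdiff_tendsto[OF P x0 xs hs pos] T_quotient_tendsto[OF P x0 xs hs pos])
    then have ev1: "\<forall>\<^sub>F k in sequentially. R k > \<beta> - c" using c by (intro order_tendstoD) auto
    have l1: "(\<lambda>k. xs k + hs k *\<^sub>R \<xi>) \<longlonglongrightarrow> x0" "(\<lambda>k. xs k - hs k *\<^sub>R \<xi>) \<longlonglongrightarrow> x0"
      using tendsto_add[OF xs tendsto_scaleR[OF hs tendsto_const]] tendsto_diff[OF xs tendsto_scaleR[OF hs tendsto_const]] by simp_all
    have evS: "\<forall>\<^sub>F k in sequentially. y k \<in> S" and evV: "\<forall>\<^sub>F k in sequentially. ?T (y k) \<in> V" if "y \<longlonglongrightarrow> x0" for y
      using topological_tendstoD[OF that open_S x0] topological_tendstoD[OF isCont_tendsto_compose[OF Tc that] V] by auto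
    show ?thesis
      using ev1 evS[OF xs] evS[OF l1(1)] evS[OF l1(2)] evV[OF xs] evV[OF l1(1)] evV[OF l1(2)]
    proof eventually_elim
      fix k assume 1: "R k > \<beta> - c" and s: "xs k \<in> S" "xs k + hs k *\<^sub>R \<xi> \<in> S" "xs k - hs k *\<^sub>R \<xi> \<in> S"
        and v: "?T (xs k) \<in> V" "?T (xs k + hs k *\<^sub>R \<xi>) \<in> V" "?T (xs k - hs k *\<^sub>R \<xi>) \<in> V"
      define h where "h = hs k"
      have h: "h > 0" using pos by (simp add: h_def)
      define x where "x = xs k"
      define Tp where "Tp = ?T (x + h *\<^sub>R \<xi>) - ?T x"
      define Tm where "Tm = ?T (x - h *\<^sub>R \<xi>) - ?T x"
      define l where "l = sdiff (\<lambda>x. ln (lapse (p x))) x (h *\<^sub>R \<xi>)"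
      have "sdiff \<psi> x (h *\<^sub>R \<xi>) = N * l + sdiff lf x (h *\<^sub>R \<xi>) - (lg (?T (x + h *\<^sub>R \<xi>)) - lg (?T x)) - (lg (?T (x - h *\<^sub>R \<xi>)) - lg (?T x))"
        using s by (simp add: sdiff_def \<psi>_def lndet x_def h_def l_def algebra_simps)
      moreover have "sdiff lf x (h *\<^sub>R \<xi>) \<ge> - (2 * Kf * (norm (h *\<^sub>R \<xi>))\<^sup>2)"
        by (rule lf2) (use s in \<open>auto simp: x_def h_def\<close>)
      moreover have "lg (?T (x + h *\<^sub>R \<xi>)) - lg (?T x) \<le> \<gamma>g (?T x) \<bullet> Tp + Kg * (norm Tp)\<^sup>2"
        unfolding Tp_def by (rule lg2) (use v in \<open>auto simp: x_def h_def\<close>)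
      moreover have "lg (?T (x - h *\<^sub>R \<xi>)) - lg (?T x) \<le> \<gamma>g (?T x) \<bullet> Tm + Kg * (norm Tm)\<^sup>2"
        unfolding Tm_def by (rule lg2) (use v in \<open>auto simp: x_def h_def\<close>)
      moreover have "sdiff ?T x (h *\<^sub>R \<xi>) = Tp + Tm"
        by (simp add: sdiff_def Tp_def Tm_def scaleR_2)
      ultimately have "sdiff \<psi> x (h *\<^sub>R \<xi>) \<ge> N * l - 2 * Kf * (h\<^sup>2 * (norm \<xi>)\<^sup>2) - \<gamma>g (?T x) \<bullet> sdiff ?T x (h *\<^sub>R \<xi>)
          - Kg * ((norm Tp)\<^sup>2 + (norm Tm)\<^sup>2)" 
        by (simp add: inner_add_right power_mult_distrib algebra_simps)
      then have "sdiff \<psi> x (h *\<^sub>R \<xi>) / h\<^sup>2 \<ge> (N * l - 2 * Kf * (h\<^sup>2 * (norm \<xi>)\<^sup>2) - \<gamma>g (?T x) \<bullet> sdiff ?T x (h *\<^sub>R \<xi>)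
          - Kg * ((norm Tp)\<^sup>2 + (norm Tm)\<^sup>2)) / h\<^sup>2"
        by (rule divide_right_mono) simp
      also have "(N * l - 2 * Kf * (h\<^sup>2 * (norm \<xi>)\<^sup>2) - \<gamma>g (?T x) \<bullet> sdiff ?T x (h *\<^sub>R \<xi>)
          - Kg * ((norm Tp)\<^sup>2 + (norm Tm)\<^sup>2)) / h\<^sup>2 = R k"
      proof -
        have "?T (xs k + hs k *\<^sub>R (- \<xi>)) - ?T (xs k) = Tm" by (simp add: Tm_def x_def h_def)
        moreover have "(norm (w /\<^sub>R h))\<^sup>2 = (norm w)\<^sup>2 / h\<^sup>2" for w :: "real^'n"
          using h by (simp add: power_mult_distrib power_inverse divide_inverse)
        moreover have "h\<^sup>2 * (inverse (h\<^sup>2) * y) = y" for y using h by simp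
        ultimately show ?thesis
          unfolding R_def using h
          by (simp add: power_inverse Tp_def[symmetric] l_def[symmetric] x_def[symmetric] h_def[symmetric] diff_divide_distrib add_divide_distrib divide_inverse algebra_simps)
      qed
      finally show "sdiff \<psi> (xs k) (hs k *\<^sub>R \<xi>) / (hs k)\<^sup>2 \<ge> \<beta> - c" using 1 by (simp add: x_def h_def)
    qed
  qed
  obtain \<alpha> where \<alpha>: "\<And>xs hs. xs \<longlonglongrightarrow> x0 \<Longrightarrow> hs \<longlonglongrightarrow> 0 \<Longrightarrow> (\<And>k::nat. hs k > 0) \<Longrightarrow>
      (\<lambda>k. sdiff (\<lambda>x. A_of \<epsilon> (p x)) (xs k) (hs k *\<^sub>R \<xi>) /\<^sub>R (hs k)\<^sup>2) \<longlonglongrightarrow> \<alpha>"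
    and \<alpha>q: "\<And>v. v \<bullet> (\<alpha> *v v) = gQ \<epsilon> v p0 \<bullet> t + dgQ \<epsilon> v p0 \<eta> \<bullet> \<eta>"
    unfolding p0_def t_def \<eta>_def using A_sdiff_tendsto[OF P x0, of \<epsilon> \<xi>] by blast
  have acont: "continuous_on S (\<lambda>x. A_of \<epsilon> (p x))"
    by (rule continuous_on_A_of[OF P])
  obtain W where W: "W ** (A_of \<epsilon> (p x0) - H x0) = mat 1" using pos_def_invertible[OF pd[OF x0]] by blast
  have visc: "\<beta> \<le> trace (W ** (\<alpha> - matrix G'))"
    by (rule viscosity_inequality[OF x0 pd acont \<alpha> _ psi2 Htouch W]) (simp_all add: \<psi>_def)
  have trs: "trace (W ** (\<alpha> - matrix G')) = (\<Sum>i\<in>UNIV. (gQ \<epsilon> (e i) p0 \<bullet> t + dgQ \<epsilon> (e i) p0 \<eta> \<bullet> \<eta> - e i \<bullet> G' (e i)) / \<mu> i)"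
    unfolding B.trace_inverse_mult[OF mu0 W] matrix_vector_mult_diff_rdistrib inner_diff_right \<alpha>q N ..
  define tq where "tq = (\<lambda>i. dgQ \<epsilon> \<xi> p0 (H x0 *v e i) \<bullet> (H x0 *v e i))"
  define r where "r = \<rho> x0"
  have G'e: "e i \<bullet> G' (e i) = r * tq i + r * (D x0 (e i) (e i) \<bullet> gq) + 2 * (gq \<bullet> (H x0 *v e i)) * (g\<rho> x0 \<bullet> e i) + q * (dg\<rho> (e i) \<bullet> e i)" for i
  proof -
    have "e i \<bullet> (H x0 *v gq) = gq \<bullet> (H x0 *v e i)" by (rule sym_mat_inner[OF H_sym[OF x0]])
    moreover have "e i \<bullet> (H x0 *v dgQ \<epsilon> \<xi> p0 (H x0 *v e i)) = tq i"
      unfolding tq_def by (rule sym_mat_inner[OF H_sym[OF x0]])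
    moreover have "e i \<bullet> D x0 (e i) gq = D x0 (e i) (e i) \<bullet> gq"
      using D_sym[OF x0, of "e i" gq "e i"] by (simp add: inner_commute)
    ultimately show ?thesis
      by (simp add: G'_def r_def inner_add_right inner_commute[of "e i"] algebra_simps)
  qed
  \<comment> \<open>The linear functional through which \<open>t\<close> enters. By
    \<open>fo\<close> the third derivatives in the trace of \<open>G'\<close> contribute
    \<open>r * Z (H x0 *v gq)\<close>; by \<open>tG\<close> this is \<open>Z t\<close> up to
    \<open>q * Z (g\<rho> x0)\<close>, so only the cutoff term survives.\<close>
  define Z where "Z = (\<lambda>k. (\<Sum>i\<in>UNIV. gQ \<epsilon> (e i) p0 \<bullet> k / \<mu> i) - N * (gl p0 \<bullet> k) - dm \<epsilon> p0 \<gamma> \<bullet> k)"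
  have Zlin: "Z (c *\<^sub>R k + d *\<^sub>R l) = c * Z k + d * Z l" for c d k l
    unfolding Z_def by (simp add: inner_add_right add_divide_distrib sum.distrib sum_distrib_left algebra_simps)
  have fo: "(\<Sum>i\<in>UNIV. D x0 (e i) (e i) \<bullet> gq / \<mu> i) = Z (H x0 *v gq) + (\<gamma> - \<gamma>f) \<bullet> gq"
  proof -
    have "(\<Sum>i\<in>UNIV. (gQ \<epsilon> (e i) p0 \<bullet> (H x0 *v gq) - D x0 (e i) (e i) \<bullet> gq) / \<mu> i)
      = N * (gl p0 \<bullet> (H x0 *v gq)) + \<gamma>f \<bullet> gq - \<gamma> \<bullet> (gq - dm \<epsilon> p0 (H x0 *v gq))"
      unfolding p0_def by (rule first_order_equation[OF x0 P pd db psid[unfolded \<psi>_def p0_def]])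
    moreover have "\<gamma> \<bullet> dm \<epsilon> p0 (H x0 *v gq) = dm \<epsilon> p0 \<gamma> \<bullet> (H x0 *v gq)"
      using dm_sym by (metis inner_commute)
    ultimately show ?thesis
      by (simp add: Z_def diff_divide_distrib sum_subtractf inner_diff_left inner_diff_right)
  qed
  have "t = r *\<^sub>R (H x0 *v gq) + q *\<^sub>R g\<rho> x0" by (simp add: tG G\<phi>_def r_def gq_def q_def p0_def)
  then have Zt: "Z t = r * Z (H x0 *v gq) + q * Z (g\<rho> x0)" using Zlin by simp
  have sum1: "trace (W ** (\<alpha> - matrix G')) = (\<Sum>i\<in>UNIV. gQ \<epsilon> (e i) p0 \<bullet> t / \<mu> i) + (\<Sum>i\<in>UNIV. dgQ \<epsilon> (e i) p0 \<eta> \<bullet> \<eta> / \<mu> i)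
     - (\<Sum>i\<in>UNIV. (r * tq i + 2 * (gq \<bullet> (H x0 *v e i)) * (g\<rho> x0 \<bullet> e i) + q * (dg\<rho> (e i) \<bullet> e i)) / \<mu> i)
     - r * (\<Sum>i\<in>UNIV. D x0 (e i) (e i) \<bullet> gq / \<mu> i)"
    unfolding trs G'e by (simp add: diff_divide_distrib add_divide_distrib sum_subtractf sum.distrib sum_distrib_left)
  have nn: "norm (- \<xi> - dm \<epsilon> p0 (H x0 *v (- \<xi>))) = norm (\<xi> - dm \<epsilon> p0 (H x0 *v \<xi>))"
  proof -
    have "- \<xi> - dm \<epsilon> p0 (H x0 *v (- \<xi>)) = - (\<xi> - dm \<epsilon> p0 (H x0 *v \<xi>))"
      using dm_linear(2)[where \<epsilon>=\<epsilon> and p=p0 and c="-1" and q="H x0 *v \<xi>"]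
        linear_neg[OF matrix_vector_mul_linear, of "H x0" \<xi>] by simp
    then show ?thesis by (metis norm_minus_cancel)
  qed
  have gdm: "\<gamma> \<bullet> dm \<epsilon> p0 t = dm \<epsilon> p0 \<gamma> \<bullet> t" using dm_sym by (metis inner_commute)
  have Zt': "Z t = (\<Sum>i\<in>UNIV. gQ \<epsilon> (e i) p0 \<bullet> t / \<mu> i) - N * (gl p0 \<bullet> t) - dm \<epsilon> p0 \<gamma> \<bullet> t"
    by (simp add: Z_def)
  have "r * (Z (H x0 *v gq) + (\<gamma> - \<gamma>f) \<bullet> gq) = r * Z (H x0 *v gq) + r * ((\<gamma> - \<gamma>f) \<bullet> gq)" by (simp add: algebra_simps)
  then have "(\<Sum>i\<in>UNIV. (r * tq i + 2 * (gq \<bullet> (H x0 *v e i)) * (g\<rho> x0 \<bullet> e i) + q * (dg\<rho> (e i) \<bullet> e i)) / \<mu> i)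
      + r * ((\<gamma> - \<gamma>f) \<bullet> gq)
    \<le> (\<Sum>i\<in>UNIV. dgQ \<epsilon> (e i) p0 \<eta> \<bullet> \<eta> / \<mu> i)
      - N * (dgl p0 \<eta> \<bullet> \<eta>) + 2 * Kf * (norm \<xi>)\<^sup>2
      + 2 * Kg * (norm (\<xi> - dm \<epsilon> p0 (H x0 *v \<xi>)))\<^sup>2
      - \<gamma> \<bullet> ddm \<epsilon> p0 \<eta> \<eta> + q * Z (g\<rho> x0)"
    using visc Zt Zt' gdm unfolding sum1 fo \<beta>_def nn
    by (simp add: inner_add_right inner_diff_right ring_distribs)
  then show ?thesis unfolding tq_def r_def q_def gq_def \<eta>_def \<gamma>_def Z_def p0_def .
qed

end

section \<open>Coefficients evaluated on unit vectors of the induced metric\<close>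

context
  fixes p :: "real^'n" and s :: real
  assumes p: "p \<bullet> p < 1" defines "s \<equiv> lapse p"
begin

lemma lapse_gt_0: "s > 0" and lapse_square: "s\<^sup>2 = 1 - p \<bullet> p" and lapse_le_1: "s \<le> 1"
proof -
  show "s > 0" "s\<^sup>2 = 1 - p \<bullet> p" using lapse_pos[OF p] lapse_sq[OF p] by (simp_all add: s_def)
  then have "s\<^sup>2 \<le> 1" by simp
  then show "s \<le> 1" using power2_le_imp_le[of s 1] by simp
qed

lemma G_form: "v \<bullet> (G_mat p *v u) = v \<bullet> u - (p \<bullet> v) * (p \<bullet> u)"
  by (simp add: G_mult inner_diff_right inner_commute[of v p])

lemma norm_p: "norm p \<le> 1"
  using p by (simp add: norm_eq_sqrt_inner)

text \<open>By Cauchy-Schwarz the induced metric is at least \<open>s\<^sup>2\<close> times the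
  Euclidean one.\<close>

lemma G_unit_norm:
  assumes "v \<bullet> (G_mat p *v v) = 1"
  shows "norm v \<le> 1 / s" and "\<bar>p \<bullet> v\<bar> \<le> 1 / s"
proof -
  have "(p \<bullet> v)\<^sup>2 \<le> (p \<bullet> p) * (v \<bullet> v)" by (rule Cauchy_Schwarz_ineq)
  then have "(v \<bullet> v) * s\<^sup>2 \<le> 1" using assms unfolding lapse_square G_form by (simp add: power2_eq_square algebra_simps)
  then have "(norm v * s)\<^sup>2 \<le> 1\<^sup>2" by (simp add: power_mult_distrib power2_norm_eq_inner)
  then have "norm v * s \<le> 1" by (rule power2_le_imp_le) simp
  then show n: "norm v \<le> 1 / s" using lapse_gt_0 by (simp add: field_simps)
  have "\<bar>p \<bullet> v\<bar> \<le> norm p * norm v" by (rule Cauchy_Schwarz_ineq2)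
  also have "\<dots> \<le> 1 * norm v" using norm_p by (rule mult_right_mono) simp
  finally show "\<bar>p \<bullet> v\<bar> \<le> 1 / s" using n by simp
qed

lemma G_image:
  shows "p \<bullet> (G_mat p *v u) = s\<^sup>2 * (p \<bullet> u)"
    and "(G_mat p *v u) \<bullet> (G_mat p *v u) = u \<bullet> (G_mat p *v u) - s\<^sup>2 * (p \<bullet> u)\<^sup>2"
  unfolding lapse_square by (simp_all add: G_mult inner_diff_right inner_diff_left inner_commute[of u p] power2_eq_square algebra_simps)

lemma lapse_inner_bounds: assumes "u \<bullet> (G_mat p *v u) = 1" shows "s\<^sup>2 * (p \<bullet> u)\<^sup>2 \<le> 1" "s * \<bar>p \<bullet> u\<bar> \<le> 1"
proof -
  have "\<bar>p \<bullet> u\<bar> \<le> 1 / s" by (rule G_unit_norm[OF assms])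
  then show 1: "s * \<bar>p \<bullet> u\<bar> \<le> 1" using lapse_gt_0 by (simp add: field_simps)
  then have "(s * \<bar>p \<bullet> u\<bar>)\<^sup>2 \<le> 1" using lapse_gt_0 by (intro power_le_one) auto
  then show "s\<^sup>2 * (p \<bullet> u)\<^sup>2 \<le> 1" by (simp add: power_mult_distrib)
qed

text \<open>In a diagonalising frame the Hessian sends \<open>e i\<close> to a multiple of
  \<open>G_mat p *v e i\<close>, so only such arguments occur. By \<open>G_image\<close> everything
  then reduces to \<open>p \<bullet> u\<close>, \<open>p \<bullet> v\<close> and the product of
  \<open>u\<close> and \<open>v\<close> in the induced metric.\<close>

lemma dgQ_G:
  assumes v: "v \<bullet> (G_mat p *v v) = 1" and u: "u \<bullet> (G_mat p *v u) = 1"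
  shows "dgQ \<epsilon> v p (G_mat p *v u) \<bullet> (G_mat p *v u) =
    (- 1 / s + 4 * s * (p \<bullet> u) * (p \<bullet> v) * (v \<bullet> (G_mat p *v u)) - 2 * s * (v \<bullet> (G_mat p *v u))\<^sup>2) / \<epsilon>"
proof -
  define q where "q = G_mat p *v u"
  have v1: "v \<bullet> v - (p \<bullet> v)\<^sup>2 = 1" using v unfolding G_form by (simp add: power2_eq_square)
  have qq: "q \<bullet> q = 1 - s\<^sup>2 * (p \<bullet> u)\<^sup>2" and pq: "p \<bullet> q = s\<^sup>2 * (p \<bullet> u)"
    unfolding q_def G_image u by simp_all
  have qv: "q \<bullet> v = v \<bullet> q" by (rule inner_commute)
  have "dgQ \<epsilon> v p q \<bullet> q = (1 / \<epsilon>) * (- (1 / s) * (q \<bullet> q)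
     + (2 * (p \<bullet> v) * (v \<bullet> q) / s - (p \<bullet> q) / s ^ 3) * (p \<bullet> q)
     + (2 * (p \<bullet> q) * (p \<bullet> v) / s - 2 * s * (v \<bullet> q)) * (v \<bullet> q))"
    unfolding dgQ_def v1 s_def[symmetric] qv inner_scaleR_left inner_add_left by simp
  also have "- (1 / s) * (q \<bullet> q)
     + (2 * (p \<bullet> v) * (v \<bullet> q) / s - (p \<bullet> q) / s ^ 3) * (p \<bullet> q)
     + (2 * (p \<bullet> q) * (p \<bullet> v) / s - 2 * s * (v \<bullet> q)) * (v \<bullet> q)
     = - 1 / s + 4 * s * (p \<bullet> u) * (p \<bullet> v) * (v \<bullet> q) - 2 * s * (v \<bullet> q)\<^sup>2"
    unfolding qq pq using lapse_gt_0 by (simp add: field_simps power2_eq_square power3_eq_cube)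
  finally show ?thesis by (simp add: q_def)
qed

lemma dgQ_same: 
  assumes u: "u \<bullet> (G_mat p *v u) = 1" and \<epsilon>: "\<epsilon> > 0"
  shows "dgQ \<epsilon> u p (G_mat p *v u) \<bullet> (G_mat p *v u) \<le> 3 / (\<epsilon> * s)"
proof -
  have "- 1 / s + 4 * s * (p \<bullet> u) * (p \<bullet> u) - 2 * s \<le> 3 / s"
  proof -
    have "s * (s * ((p \<bullet> u) * (p \<bullet> u))) \<le> 1" using lapse_inner_bounds(1)[OF u] by (simp add: power2_eq_square mult.assoc)
    then have "s * ((p \<bullet> u) * (p \<bullet> u)) \<le> 1 / s" using lapse_gt_0 by (simp add: field_simps)
    then show ?thesis using lapse_gt_0 by (simp add: mult.assoc)
  qed
  then have "(- 1 / s + 4 * s * (p \<bullet> u) * (p \<bullet> u) - 2 * s) / \<epsilon> \<le> (3 / s) / \<epsilon>"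
    by (rule divide_right_mono) (use \<epsilon> in simp)
  then show ?thesis unfolding dgQ_G[OF u u] u by (simp add: mult.commute)
qed

text \<open>For orthogonal vectors all terms of indefinite sign carry the vanishing product; what
  remains is exact and strictly negative.\<close>

lemma dgQ_other:
  assumes "v \<bullet> (G_mat p *v v) = 1" "u \<bullet> (G_mat p *v u) = 1" "v \<bullet> (G_mat p *v u) = 0"
  shows "dgQ \<epsilon> v p (G_mat p *v u) \<bullet> (G_mat p *v u) = - (1 / (\<epsilon> * s))"
  unfolding dgQ_G[OF assms(1,2)] assms(3) by (simp add: mult.commute)

lemma gQ_G:
  assumes v: "v \<bullet> (G_mat p *v v) = 1" and u: "u \<bullet> (G_mat p *v u) = 1" and uv: "\<bar>v \<bullet> (G_mat p *v u)\<bar> \<le> 1" and \<epsilon>: "\<epsilon> > 0"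
  shows "\<bar>gQ \<epsilon> v p \<bullet> (G_mat p *v u)\<bar> \<le> 3 / \<epsilon>"
proof -
  define q where "q = G_mat p *v u"
  have v1: "v \<bullet> v - (p \<bullet> v)\<^sup>2 = 1" using v unfolding G_form by (simp add: power2_eq_square)
  have pq: "p \<bullet> q = s\<^sup>2 * (p \<bullet> u)" unfolding q_def G_image by simp
  have "gQ \<epsilon> v p \<bullet> q = (- (s * (p \<bullet> u)) - 2 * ((s * (p \<bullet> v)) * (v \<bullet> q))) / \<epsilon>"
    unfolding gQ_def v1 s_def[symmetric] inner_scaleR_left inner_diff_left pq using lapse_gt_0 by (simp add: power2_eq_square)
  moreover have "\<bar>- (s * (p \<bullet> u)) - 2 * ((s * (p \<bullet> v)) * (v \<bullet> q))\<bar> \<le> 1 + 2 * (1 * 1)"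
  proof -
    have "\<bar>(s * (p \<bullet> v)) * (v \<bullet> q)\<bar> \<le> 1 * 1"
      unfolding abs_mult using lapse_inner_bounds(2)[OF v] uv lapse_gt_0 by (intro mult_mono) (auto simp: abs_mult q_def)
    moreover have "\<bar>s * (p \<bullet> u)\<bar> \<le> 1" using lapse_inner_bounds(2)[OF u] lapse_gt_0 by (simp add: abs_mult)
    ultimately show ?thesis by linarith
  qed
  ultimately show ?thesis using \<epsilon> by (simp add: q_def divide_right_mono)
qed

lemma norm_gQ:
  assumes v: "v \<bullet> (G_mat p *v v) = 1" and \<epsilon>: "\<epsilon> > 0"
  shows "norm (gQ \<epsilon> v p) \<le> 3 / (\<epsilon> * s)"
proof -
  have v1: "v \<bullet> v - (p \<bullet> v)\<^sup>2 = 1" using v unfolding G_form by (simp add: power2_eq_square)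
  have "norm (- (1 / s) *\<^sub>R p - (2 * s * (p \<bullet> v)) *\<^sub>R v) \<le> norm (- (1 / s) *\<^sub>R p) + norm ((2 * s * (p \<bullet> v)) *\<^sub>R v)"
    by (rule norm_triangle_ineq4)
  also have "\<dots> = (1 / s) * norm p + 2 * (s * \<bar>p \<bullet> v\<bar>) * norm v" using lapse_gt_0 by (simp add: abs_mult)
  also have "\<dots> \<le> (1 / s) * 1 + 2 * 1 * (1 / s)"
    using lapse_gt_0 norm_p G_unit_norm[OF v] lapse_inner_bounds(2)[OF v] by (intro add_mono mult_mono) auto
  finally have "norm (- (1 / s) *\<^sub>R p - (2 * s * (p \<bullet> v)) *\<^sub>R v) \<le> 3 / s" by simp
  then have "(1 / \<epsilon>) * norm (- (1 / s) *\<^sub>R p - (2 * s * (p \<bullet> v)) *\<^sub>R v) \<le> (1 / \<epsilon>) * (3 / s)"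
    using \<epsilon> by (intro mult_left_mono) auto
  then show ?thesis unfolding gQ_def v1 s_def[symmetric] using \<epsilon> by simp
qed

lemma dgl_G:
  assumes u: "u \<bullet> (G_mat p *v u) = 1"
  shows "dgl p (G_mat p *v u) \<bullet> (G_mat p *v u) \<ge> - (2 / s\<^sup>2)"
proof -
  define q where "q = G_mat p *v u"
  have qq: "q \<bullet> q = 1 - s\<^sup>2 * (p \<bullet> u)\<^sup>2" and pq: "p \<bullet> q = s\<^sup>2 * (p \<bullet> u)"
    unfolding q_def G_image u by simp_all
  have "dgl p q \<bullet> q = - (1 / s\<^sup>2) * (q \<bullet> q) - 2 * (p \<bullet> q) / s ^ 4 * (p \<bullet> q)"
    unfolding dgl_def s_def[symmetric] inner_diff_left inner_scaleR_left by simp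
  also have "\<dots> = - (1 / s\<^sup>2) * (1 + s\<^sup>2 * (p \<bullet> u)\<^sup>2)"
    unfolding qq pq using lapse_gt_0 by (simp add: field_simps power2_eq_square power4_eq_xxxx)
  also have "\<dots> \<ge> - (1 / s\<^sup>2) * 2"
    using lapse_inner_bounds(1)[OF u] by (intro mult_left_mono_neg) auto
  finally show ?thesis by (simp add: q_def)
qed

lemma norm_gl: "norm (gl p) \<le> 1 / s\<^sup>2"
  unfolding gl_def s_def[symmetric] using norm_p by (simp add: divide_right_mono)

lemma norm_dm:
  assumes \<epsilon>: "\<epsilon> > 0"
  shows "norm (dm \<epsilon> p \<gamma>) \<le> 2 * \<epsilon> * norm \<gamma> / s ^ 3"
proof -
  have "norm (dm \<epsilon> p \<gamma>) \<le> norm ((\<epsilon> / s) *\<^sub>R \<gamma>) + norm ((\<epsilon> * (p \<bullet> \<gamma>) / s ^ 3) *\<^sub>R p)"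
    unfolding dm_def s_def[symmetric] by (rule norm_triangle_ineq)
  also have "\<dots> = (\<epsilon> / s) * norm \<gamma> + \<epsilon> / s ^ 3 * (\<bar>p \<bullet> \<gamma>\<bar> * norm p)"
    using \<epsilon> lapse_gt_0 by (simp add: abs_mult)
  also have "\<dots> \<le> (\<epsilon> / s ^ 3) * norm \<gamma> + \<epsilon> / s ^ 3 * ((norm p * norm \<gamma>) * 1)"
  proof (intro add_mono mult_right_mono mult_left_mono mult_mono)
    have "s ^ 3 \<le> s" using lapse_gt_0 lapse_le_1 power_decreasing[of 1 3 s] by simp
    then show "\<epsilon> / s \<le> \<epsilon> / s ^ 3" using \<epsilon> lapse_gt_0 by (intro divide_left_mono) auto
  qed (use \<epsilon> lapse_gt_0 norm_p Cauchy_Schwarz_ineq2 in auto)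
  also have "\<dots> \<le> (\<epsilon> / s ^ 3) * norm \<gamma> + \<epsilon> / s ^ 3 * ((1 * norm \<gamma>) * 1)"
    using \<epsilon> lapse_gt_0 norm_p by (intro add_left_mono mult_left_mono mult_right_mono) auto
  finally show ?thesis by simp
qed

lemma norm_ddm:
  assumes u: "u \<bullet> (G_mat p *v u) = 1" and \<epsilon>: "\<epsilon> > 0"
  shows "norm (ddm \<epsilon> p (G_mat p *v u) (G_mat p *v u)) \<le> 5 * \<epsilon> / s ^ 3"
proof -
  define q where "q = G_mat p *v u"
  have qq: "q \<bullet> q = 1 - s\<^sup>2 * (p \<bullet> u)\<^sup>2" and pq: "p \<bullet> q = s\<^sup>2 * (p \<bullet> u)"
    unfolding q_def G_image u by simp_all
  have nq: "norm q \<le> 1" using qq by (simp add: norm_eq_sqrt_inner)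
  have pq1: "\<bar>p \<bullet> q\<bar> \<le> 1"
  proof -
    have "\<bar>p \<bullet> q\<bar> = s * (s * \<bar>p \<bullet> u\<bar>)" unfolding pq using lapse_gt_0 by (simp add: abs_mult power2_eq_square)
    also have "\<dots> \<le> 1 * 1" using lapse_le_1 lapse_gt_0 lapse_inner_bounds(2)[OF u] by (intro mult_mono) auto
    finally show ?thesis by simp
  qed
  define c where "c = q \<bullet> q + 3 * (p \<bullet> q) * (p \<bullet> q) / s\<^sup>2"
  have "c = 1 + 2 * (s\<^sup>2 * (p \<bullet> u)\<^sup>2)"
    unfolding c_def qq pq using lapse_gt_0 by (simp add: field_simps power2_eq_square)
  then have c: "\<bar>c\<bar> \<le> 3" using lapse_inner_bounds(1)[OF u] zero_le_mult_iff[of "s\<^sup>2" "(p \<bullet> u)\<^sup>2"] by simp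
  have "norm ((p \<bullet> q) *\<^sub>R q + (p \<bullet> q) *\<^sub>R q + c *\<^sub>R p) \<le> norm ((p \<bullet> q) *\<^sub>R q) + norm ((p \<bullet> q) *\<^sub>R q) + norm (c *\<^sub>R p)"
    by (meson norm_triangle_ineq norm_triangle_le add_right_mono order_trans)
  also have "\<dots> \<le> 1 * 1 + 1 * 1 + 3 * 1"
    unfolding norm_scaleR using nq pq1 c norm_p by (intro add_mono mult_mono) auto
  finally have "norm ((p \<bullet> q) *\<^sub>R q + (p \<bullet> q) *\<^sub>R q + c *\<^sub>R p) \<le> 5" by simp
  then have "(\<epsilon> / s ^ 3) * norm ((p \<bullet> q) *\<^sub>R q + (p \<bullet> q) *\<^sub>R q + c *\<^sub>R p) \<le> (\<epsilon> / s ^ 3) * 5"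
    using \<epsilon> lapse_gt_0 by (intro mult_left_mono) auto
  then show ?thesis
    unfolding ddm_def q_def[symmetric] s_def[symmetric] c_def[symmetric] using \<epsilon> lapse_gt_0 by (simp add: mult.commute)
qed

text \<open>\<open>dm\<close> inverts A, which is \<open>s / \<epsilon>\<close> times the
  metric.\<close>

lemma dm_G: "dm \<epsilon> p (G_mat p *v u) = (\<epsilon> / s) *\<^sub>R u"
proof -
  have "dm \<epsilon> p (G_mat p *v u) = (\<epsilon> / s) *\<^sub>R (u - (p \<bullet> u) *\<^sub>R p) + (\<epsilon> * (s\<^sup>2 * (p \<bullet> u)) / s ^ 3) *\<^sub>R p"
    unfolding dm_def G_image(1) unfolding s_def[symmetric] G_mult by (rule refl)
  also have "\<epsilon> * (s\<^sup>2 * (p \<bullet> u)) / s ^ 3 = (\<epsilon> / s) * (p \<bullet> u)"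
    using lapse_gt_0 by (simp add: field_simps power2_eq_square power3_eq_cube)
  finally show ?thesis by (simp add: scaleR_diff_right)
qed

end

text \<open>The good term is \<^term>\<open>(l k - 1)\<^sup>2 * (\<Sum>i\<in>UNIV - {k}. 1 / l i)\<close>, produced by the sign in
  \<open>dgQ_other\<close> (the strict form of the Ma--Trudinger--Wang condition). Every other term carries the
  same factor \<^term>\<open>1 / \<epsilon>\<^sup>2\<close>, so that \<^term>\<open>\<epsilon>\<close> drops out.\<close>

lemma point_estimate:
  fixes p gr \<gamma> \<gamma>f :: "real^'n" and H :: "real^'n^'n" and e :: "'n \<Rightarrow> real^'n" and l :: "'n \<Rightarrow> real"
    and dgr :: "real^'n \<Rightarrow> real^'n" and \<epsilon> E K Kf Kg N R :: real
  assumes p: "p \<bullet> p < 1" and \<epsilon>: "\<epsilon> > 0"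
    and on: "\<And>i j. e i \<bullet> (G_mat p *v e j) = (if i = j then 1 else 0)"
    and He: "\<And>i. H *v e i = ((1 - l i) * (lapse p / \<epsilon>)) *\<^sub>R (G_mat p *v e i)"
    and lpos: "\<And>i. l i > 0" and lk: "l k \<ge> 1"
    and gr: "norm gr \<le> l k * E" and dgr: "\<And>v. dgr v \<bullet> v \<ge> - (l k * E * (norm v)\<^sup>2)" and E: "E \<ge> 0"
    and K: "norm \<gamma> \<le> K" "norm \<gamma>f \<le> K" "Kf \<le> K" "Kg \<le> K" and N: "N \<ge> 0"
    and R: "\<epsilon> / lapse p \<le> R" "R \<ge> 1"
    and key: "(\<Sum>i\<in>UNIV. ((1 - l k) * (dgQ \<epsilon> (e k) p (H *v e i) \<bullet> (H *v e i))
        + 2 * (gQ \<epsilon> (e k) p \<bullet> (H *v e i)) * (gr \<bullet> e i) + Q \<epsilon> (e k) p * (dgr (e i) \<bullet> e i)) / (l i * (lapse p / \<epsilon>)))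
      + (1 - l k) * ((\<gamma> - \<gamma>f) \<bullet> gQ \<epsilon> (e k) p)
    \<le> (\<Sum>i\<in>UNIV. dgQ \<epsilon> (e i) p (H *v e k) \<bullet> (H *v e k) / (l i * (lapse p / \<epsilon>)))
      - N * (dgl p (H *v e k) \<bullet> (H *v e k)) + 2 * Kf * (norm (e k))\<^sup>2
      + 2 * Kg * (norm (e k - dm \<epsilon> p (H *v e k)))\<^sup>2
      - \<gamma> \<bullet> ddm \<epsilon> p (H *v e k) (H *v e k)
      + Q \<epsilon> (e k) p * ((\<Sum>i\<in>UNIV. gQ \<epsilon> (e i) p \<bullet> gr / (l i * (lapse p / \<epsilon>)))
          - N * (gl p \<bullet> gr) - dm \<epsilon> p \<gamma> \<bullet> gr)"
  shows "(l k - 1)\<^sup>2 * (\<Sum>i\<in>UNIV - {k}. 1 / l i)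
     \<le> R\<^sup>2 * (20 + 6 * real CARD('n) + 3 * N + 20 * K) * ((l k)\<^sup>2 + l k * E * ((\<Sum>i\<in>UNIV - {k}. 1 / l i) + 1))"
proof -
  define s where "s = lapse p"
  define \<Lambda> where "\<Lambda> = l k"
  define S where "S = (\<Sum>i\<in>UNIV - {k}. 1 / l i)"
  define S1 where "S1 = (\<Sum>i\<in>UNIV. 1 / l i)"
  define L where "L = \<epsilon> / s"
  \<comment> \<open>Every term is written as a power of the bounded quantity \<open>L\<close> times
    \<open>X\<close>; see \<open>es\<close>. The common factor \<open>X\<close> is divided out at
    the end.\<close>
  define X where "X = 1 / \<epsilon>\<^sup>2"
  define n where "n = real CARD('n)"
  define c where "c = (\<lambda>i. (1 - l i) * (s / \<epsilon>))"
  define q where "q = (\<lambda>i. G_mat p *v e i)"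
  have s: "s > 0" "s \<le> 1" using lapse_gt_0[OF p] lapse_le_1[OF p] by (auto simp: s_def)
  have X: "X > 0" using \<epsilon> by (simp add: X_def)
  have L: "L > 0" "L \<le> R" using s \<epsilon> R by (auto simp: L_def s_def)
  have K0: "K \<ge> 0" using K(1) norm_ge_zero[of \<gamma>] by linarith
  have \<Lambda>: "\<Lambda> \<ge> 1" using lk by (simp add: \<Lambda>_def)
  have S0: "S \<ge> 0" unfolding S_def using lpos by (intro sum_nonneg) (simp add: less_imp_le)
  have S1: "S1 = 1 / \<Lambda> + S"
    unfolding S1_def S_def \<Lambda>_def by (rule sum.remove) auto
  have es: "1 / (\<epsilon> * s) = L * X" "1 / s\<^sup>2 = L\<^sup>2 * X" 
    using \<epsilon> s by (auto simp: L_def X_def field_simps power2_eq_square)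
  have es3: "3 / (\<epsilon> * lapse p) = 3 * (L * X)" unfolding es(1)[symmetric] s_def by simp
  have on1: "e i \<bullet> (G_mat p *v e i) = 1" for i using on[of i i] by simp
  have on': "\<bar>e i \<bullet> (G_mat p *v e j)\<bar> \<le> 1" for i j using on[of i j] by simp
  have Hq: "H *v e i = c i *\<^sub>R q i" for i using He[of i] by (simp add: c_def q_def s_def)
  have ne: "norm (e i) \<le> 1 / s" for i using G_unit_norm(1)[OF p on1] by (simp add: s_def)
  have ne2: "(norm (e i))\<^sup>2 \<le> L\<^sup>2 * X" for i
  proof -
    have "(norm (e i))\<^sup>2 \<le> (1 / s)\<^sup>2" using ne by (intro power_mono) auto
    then show ?thesis using es(2) by (simp add: power_divide)
  qed
  have dgQs: "dgQ \<epsilon> v p (d *\<^sub>R r) \<bullet> (d *\<^sub>R r) = d\<^sup>2 * (dgQ \<epsilon> v p r \<bullet> r)" for v d r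
  proof -
    have "dgQ \<epsilon> v p (d *\<^sub>R r) = d *\<^sub>R dgQ \<epsilon> v p r"
      by (simp add: dgQ_def scaleR_add_right algebra_simps)
    then show ?thesis by (simp add: power2_eq_square)
  qed
  have dgls: "dgl p (d *\<^sub>R r) \<bullet> (d *\<^sub>R r) = d\<^sup>2 * (dgl p r \<bullet> r)" for d r
  proof -
    have "dgl p (d *\<^sub>R r) = d *\<^sub>R dgl p r"
      by (simp add: dgl_def scaleR_diff_right algebra_simps)
    then show ?thesis by (simp add: power2_eq_square)
  qed
  have ddms: "ddm \<epsilon> p (d *\<^sub>R r) (d *\<^sub>R r) = d\<^sup>2 *\<^sub>R ddm \<epsilon> p r r" for d r
  proof -
    have "(p \<bullet> (d *\<^sub>R r)) *\<^sub>R (d *\<^sub>R r) + (p \<bullet> (d *\<^sub>R r)) *\<^sub>R (d *\<^sub>R r) + ((d *\<^sub>R r) \<bullet> (d *\<^sub>R r) + 3 * (p \<bullet> (d *\<^sub>R r)) * (p \<bullet> (d *\<^sub>R r)) / (lapse p)\<^sup>2) *\<^sub>R p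
      = d\<^sup>2 *\<^sub>R ((p \<bullet> r) *\<^sub>R r + (p \<bullet> r) *\<^sub>R r + (r \<bullet> r + 3 * (p \<bullet> r) * (p \<bullet> r) / (lapse p)\<^sup>2) *\<^sub>R p)"
      by (simp add: scaleR_add_right power2_eq_square distrib_left mult.assoc mult.left_commute)
    then show ?thesis unfolding ddm_def by (simp only: scaleR_scaleR mult.commute)
  qed
  have dgQH: "dgQ \<epsilon> v p (H *v e i) \<bullet> (H *v e i) = (c i)\<^sup>2 * (dgQ \<epsilon> v p (q i) \<bullet> q i)" for v i
    unfolding Hq by (rule dgQs)
  have dglH: "dgl p (H *v e i) \<bullet> (H *v e i) = (c i)\<^sup>2 * (dgl p (q i) \<bullet> q i)" for i
    unfolding Hq by (rule dgls)
  have Qk: "Q \<epsilon> (e k) p = s / \<epsilon>"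
    using on1[of k] unfolding G_form[OF p] Q_def s_def by (simp add: power2_eq_square)
  have mu: "l i * (lapse p / \<epsilon>) = l i * s / \<epsilon>" for i by (simp add: s_def)
  have ck: "(c k)\<^sup>2 = (\<Lambda> - 1)\<^sup>2 * (s\<^sup>2 / \<epsilon>\<^sup>2)"
    unfolding c_def \<Lambda>_def power_mult_distrib power_divide by (simp add: power2_commute)
  define A where "A = (\<lambda>i. (1 - \<Lambda>) * (dgQ \<epsilon> (e k) p (H *v e i) \<bullet> (H *v e i)) / (l i * s / \<epsilon>))"
  define B where "B = (\<lambda>i. 2 * (gQ \<epsilon> (e k) p \<bullet> (H *v e i)) * (gr \<bullet> e i) / (l i * s / \<epsilon>))"
  define C where "C = (\<lambda>i. Q \<epsilon> (e k) p * (dgr (e i) \<bullet> e i) / (l i * s / \<epsilon>))"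
  \<comment> \<open>For \<open>i \<noteq> k\<close> the product of
    \<open>1 - \<Lambda> \<le> 0\<close> with the negative value from \<open>dgQ_other\<close> has
    the favourable sign and is dropped.\<close>
  have Ai: "A i \<ge> (if i = k then - (3 * \<Lambda>\<^sup>2 * X) else 0)" for i
  proof (cases "i = k")
    case True
    have d: "dgQ \<epsilon> (e k) p (q k) \<bullet> q k \<le> 3 * (L * X)"
      using dgQ_same[OF p on1 \<epsilon>, of k] unfolding q_def es3 .
    have fac: "(1 - \<Lambda>) * (c k)\<^sup>2 / (l k * s / \<epsilon>) \<le> 0"
      using \<Lambda> lpos s \<epsilon> by (intro divide_nonpos_pos mult_nonpos_nonneg) (auto simp: mult_pos_pos)
    have "A k = (1 - \<Lambda>) * (c k)\<^sup>2 / (l k * s / \<epsilon>) * (dgQ \<epsilon> (e k) p (q k) \<bullet> q k)"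
      by (simp add: A_def dgQH)
    also have "\<dots> \<ge> (1 - \<Lambda>) * (c k)\<^sup>2 / (l k * s / \<epsilon>) * (3 * (L * X))"
      by (rule mult_left_mono_neg[OF d fac])
    also have "(1 - \<Lambda>) * (c k)\<^sup>2 / (l k * s / \<epsilon>) * (3 * (L * X)) = - (3 * ((\<Lambda> - 1) ^ 3 / \<Lambda>) * X)"
      unfolding ck using s \<epsilon> \<Lambda> by (simp add: \<Lambda>_def[symmetric] L_def X_def field_simps power2_eq_square power3_eq_cube)
    finally have "A k \<ge> - (3 * ((\<Lambda> - 1) ^ 3 / \<Lambda>) * X)" .
    moreover have "(\<Lambda> - 1) ^ 3 / \<Lambda> \<le> \<Lambda>\<^sup>2"
    proof -
      have "(\<Lambda> - 1) ^ 3 \<le> \<Lambda> ^ 3" using \<Lambda> by (intro power_mono) auto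
      then show ?thesis using \<Lambda> by (simp add: field_simps power2_eq_square power3_eq_cube)
    qed
    then have "3 * ((\<Lambda> - 1) ^ 3 / \<Lambda>) * X \<le> 3 * \<Lambda>\<^sup>2 * X" using X by (intro mult_right_mono) auto
    ultimately show ?thesis using True by simp
  next
    case False
    have d: "dgQ \<epsilon> (e k) p (q i) \<bullet> q i = - (L * X)"
      unfolding q_def es(1)[symmetric] s_def using dgQ_other[OF p on1 on1, of k i \<epsilon>] on[of k i] False by auto
    have "A i = (\<Lambda> - 1) * ((c i)\<^sup>2 * (L * X)) / (l i * s / \<epsilon>)"
      by (simp add: A_def dgQH d algebra_simps)
    also have "\<dots> \<ge> 0" using \<Lambda> L X s \<epsilon> lpos[of i] by (intro divide_nonneg_pos mult_nonneg_nonneg) auto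
    finally show ?thesis using False by simp
  qed
  have "(\<Sum>i\<in>UNIV. (if i = k then - (3 * \<Lambda>\<^sup>2 * X) else 0)) \<le> (\<Sum>i\<in>UNIV. A i)" by (rule sum_mono) (rule Ai)
  then have sA: "(\<Sum>i\<in>UNIV. A i) \<ge> - (3 * \<Lambda>\<^sup>2 * X)" by simp
  \<comment> \<open>The Hessian supplies a factor \<open>1 - l i\<close>, so after division by
    \<open>l i\<close> the weight is \<open>1 / l i - 1\<close> and grows at most like
    \<open>1 / l i\<close>.\<close>
  have Bi: "B i \<ge> - (6 * \<Lambda> * E * L * X) * (1 / l i + 1)" for i
  proof -
    have "\<bar>gQ \<epsilon> (e k) p \<bullet> q i\<bar> \<le> 3 / \<epsilon>" unfolding q_def by (rule gQ_G[OF p on1 on1 on' \<epsilon>])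
    moreover have "\<bar>gr \<bullet> e i\<bar> \<le> (\<Lambda> * E) * (1 / s)"
      using Cauchy_Schwarz_ineq2[of gr "e i"] mult_mono[OF gr ne[of i]] E \<Lambda> unfolding \<Lambda>_def by fastforce
    ultimately have "\<bar>gQ \<epsilon> (e k) p \<bullet> q i\<bar> * \<bar>gr \<bullet> e i\<bar> \<le> (3 / \<epsilon>) * ((\<Lambda> * E) * (1 / s))"
      by (rule mult_mono) (use \<epsilon> in auto)
    then have b: "\<bar>gQ \<epsilon> (e k) p \<bullet> q i\<bar> * \<bar>gr \<bullet> e i\<bar> \<le> 3 * \<Lambda> * E * (L * X)"
      unfolding es(1)[symmetric] by (simp add: field_simps)
    have f: "\<bar>c i / (l i * s / \<epsilon>)\<bar> \<le> 1 / l i + 1"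
    proof -
      have "c i / (l i * s / \<epsilon>) = 1 / l i - 1" using s \<epsilon> lpos[of i] by (simp add: c_def field_simps)
      then show ?thesis using lpos[of i] by (simp add: abs_le_iff)
    qed
    have "\<bar>B i\<bar> = 2 * (\<bar>c i / (l i * s / \<epsilon>)\<bar> * (\<bar>gQ \<epsilon> (e k) p \<bullet> q i\<bar> * \<bar>gr \<bullet> e i\<bar>))"
      unfolding B_def Hq by (simp add: abs_mult abs_divide)
    also have "\<dots> \<le> 2 * ((1 / l i + 1) * (3 * \<Lambda> * E * (L * X)))"
      by (rule mult_left_mono[OF mult_mono[OF f b]]) (use lpos[of i] in auto)
    finally show ?thesis by (simp add: algebra_simps abs_le_iff)
  qed
  have "(\<Sum>i\<in>UNIV. - (6 * \<Lambda> * E * L * X) * (1 / l i + 1)) \<le> (\<Sum>i\<in>UNIV. B i)" by (rule sum_mono) (rule Bi)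
  then have sB: "(\<Sum>i\<in>UNIV. B i) \<ge> - (6 * \<Lambda> * E * L * X) * (S1 + n)"
    unfolding sum_distrib_left[symmetric] sum.distrib S1_def n_def by simp
  have Ci: "C i \<ge> - (\<Lambda> * E * L\<^sup>2 * X) * (1 / l i)" for i
  proof -
    have "- (\<Lambda> * E * (L\<^sup>2 * X)) \<le> - (\<Lambda> * E * (norm (e i))\<^sup>2)" using ne2 E \<Lambda> by (simp add: mult_left_mono)
    also have "\<dots> \<le> dgr (e i) \<bullet> e i" using dgr by (simp add: \<Lambda>_def)
    finally have "- (\<Lambda> * E * (L\<^sup>2 * X)) / l i \<le> (dgr (e i) \<bullet> e i) / l i" using lpos[of i] by (intro divide_right_mono) auto
    moreover have "C i = (dgr (e i) \<bullet> e i) / l i" unfolding C_def Qk using s \<epsilon> by (simp add: field_simps)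
    ultimately show ?thesis by (simp add: mult.assoc)
  qed
  have "(\<Sum>i\<in>UNIV. - (\<Lambda> * E * L\<^sup>2 * X) * (1 / l i)) \<le> (\<Sum>i\<in>UNIV. C i)" by (rule sum_mono) (rule Ci)
  then have sC: "(\<Sum>i\<in>UNIV. C i) \<ge> - (\<Lambda> * E * L\<^sup>2 * X) * S1"
    unfolding sum_distrib_left[symmetric] S1_def .
  have ngk: "norm (gQ \<epsilon> (e i) p) \<le> 3 * (L * X)" for i
    using norm_gQ[OF p on1 \<epsilon>, of i] unfolding es3 .
  have sd: "(1 - \<Lambda>) * ((\<gamma> - \<gamma>f) \<bullet> gQ \<epsilon> (e k) p) \<ge> - (6 * K * \<Lambda> * L * X)"
  proof -
    have "\<bar>(\<gamma> - \<gamma>f) \<bullet> gQ \<epsilon> (e k) p\<bar> \<le> norm (\<gamma> - \<gamma>f) * norm (gQ \<epsilon> (e k) p)" by (rule Cauchy_Schwarz_ineq2)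
    also have "\<dots> \<le> (2 * K) * (3 * (L * X))"
      using norm_triangle_ineq4[of \<gamma> \<gamma>f] K K0 ngk by (intro mult_mono) auto
    finally have "\<bar>1 - \<Lambda>\<bar> * \<bar>(\<gamma> - \<gamma>f) \<bullet> gQ \<epsilon> (e k) p\<bar> \<le> \<Lambda> * ((2 * K) * (3 * (L * X)))"
      using \<Lambda> by (intro mult_mono) auto
    then show ?thesis unfolding abs_mult[symmetric] by (simp add: abs_le_iff algebra_simps)
  qed
  \<comment> \<open>The source of the good term: each direction other than \<open>k\<close>
    contributes exactly minus \<open>1 / l i\<close> times the common factor.\<close>
  have se: "(\<Sum>i\<in>UNIV. dgQ \<epsilon> (e i) p (H *v e k) \<bullet> (H *v e k) / (l i * s / \<epsilon>)) \<le> (\<Lambda> - 1)\<^sup>2 * X * (3 / \<Lambda> - S)"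
  proof -
    have fac: "(c k)\<^sup>2 / (l i * s / \<epsilon>) * (L * X) = (\<Lambda> - 1)\<^sup>2 * X * (1 / l i)" for i
      unfolding ck using s \<epsilon> lpos[of i] by (simp add: L_def X_def field_simps power2_eq_square)
    have pos: "(c k)\<^sup>2 / (l i * s / \<epsilon>) \<ge> 0" for i using s \<epsilon> lpos[of i] by (intro divide_nonneg_pos) auto
    have "dgQ \<epsilon> (e i) p (H *v e k) \<bullet> (H *v e k) / (l i * s / \<epsilon>)
       \<le> (if i = k then 3 * ((\<Lambda> - 1)\<^sup>2 * X * (1 / l i)) else - ((\<Lambda> - 1)\<^sup>2 * X * (1 / l i)))" for i
    proof (cases "i = k")
      case True
      have "dgQ \<epsilon> (e k) p (q k) \<bullet> q k \<le> 3 * (L * X)"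
        using dgQ_same[OF p on1 \<epsilon>, of k] unfolding q_def es3 .
      then have "(c k)\<^sup>2 / (l k * s / \<epsilon>) * (dgQ \<epsilon> (e k) p (q k) \<bullet> q k) \<le> (c k)\<^sup>2 / (l k * s / \<epsilon>) * (3 * (L * X))"
        using pos by (rule mult_left_mono)
      also have "\<dots> = 3 * ((c k)\<^sup>2 / (l k * s / \<epsilon>) * (L * X))" by simp
      finally have "(c k)\<^sup>2 / (l k * s / \<epsilon>) * (dgQ \<epsilon> (e k) p (q k) \<bullet> q k) \<le> 3 * ((\<Lambda> - 1)\<^sup>2 * X * (1 / l k))"
        unfolding fac .
      moreover have "dgQ \<epsilon> (e k) p (H *v e k) \<bullet> (H *v e k) / (l k * s / \<epsilon>)
          = (c k)\<^sup>2 / (l k * s / \<epsilon>) * (dgQ \<epsilon> (e k) p (q k) \<bullet> q k)"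
        by (simp add: dgQH)
      ultimately have "dgQ \<epsilon> (e k) p (H *v e k) \<bullet> (H *v e k) / (l k * s / \<epsilon>) \<le> 3 * ((\<Lambda> - 1)\<^sup>2 * X * (1 / l k))"
        by (simp only:)
      then show ?thesis unfolding True by (simp only: if_True simp_thms)
    next
      case False
      have "dgQ \<epsilon> (e i) p (q k) \<bullet> q k = - (L * X)"
        unfolding q_def es(1)[symmetric] s_def using dgQ_other[OF p on1 on1, of i k \<epsilon>] on[of i k] False by auto
      then have "dgQ \<epsilon> (e i) p (H *v e k) \<bullet> (H *v e k) / (l i * s / \<epsilon>)
          = - ((c k)\<^sup>2 / (l i * s / \<epsilon>) * (L * X))"
        by (simp add: dgQH)
      then show ?thesis unfolding fac using False by (simp only: if_False simp_thms)
    qed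
    then have "(\<Sum>i\<in>UNIV. dgQ \<epsilon> (e i) p (H *v e k) \<bullet> (H *v e k) / (l i * s / \<epsilon>))
      \<le> (\<Sum>i\<in>UNIV. if i = k then 3 * ((\<Lambda> - 1)\<^sup>2 * X * (1 / l i)) else - ((\<Lambda> - 1)\<^sup>2 * X * (1 / l i)))"
      by (rule sum_mono)
    also have "\<dots> = 3 * ((\<Lambda> - 1)\<^sup>2 * X * (1 / l k)) + (\<Sum>i\<in>UNIV - {k}. - ((\<Lambda> - 1)\<^sup>2 * X * (1 / l i)))"
      by (subst sum.remove[of UNIV k]) (auto intro!: sum.cong)
    also have "\<dots> = (\<Lambda> - 1)\<^sup>2 * X * (3 / \<Lambda> - S)"
      unfolding sum_negf sum_distrib_left[symmetric] S_def[symmetric] \<Lambda>_def[symmetric] by (simp add: algebra_simps)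
    finally show ?thesis .
  qed
  have ckL: "(c k)\<^sup>2 \<le> \<Lambda>\<^sup>2 * (s\<^sup>2 / \<epsilon>\<^sup>2)"
    unfolding ck using \<Lambda> by (intro mult_right_mono power_mono) auto
  have sf: "- N * (dgl p (H *v e k) \<bullet> (H *v e k)) \<le> 2 * N * \<Lambda>\<^sup>2 * X"
  proof -
    have "- (dgl p (q k) \<bullet> q k) \<le> 2 / s\<^sup>2" using dgl_G[OF p on1, of k] by (simp add: q_def s_def)
    then have "(c k)\<^sup>2 * - (dgl p (q k) \<bullet> q k) \<le> (c k)\<^sup>2 * (2 / s\<^sup>2)" by (rule mult_left_mono) simp
    also have "\<dots> \<le> \<Lambda>\<^sup>2 * (s\<^sup>2 / \<epsilon>\<^sup>2) * (2 / s\<^sup>2)" using ckL by (rule mult_right_mono) simp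
    also have "\<dots> = 2 * \<Lambda>\<^sup>2 * X" using s by (simp add: X_def)
    finally have "N * ((c k)\<^sup>2 * - (dgl p (q k) \<bullet> q k)) \<le> N * (2 * \<Lambda>\<^sup>2 * X)" using N by (rule mult_left_mono)
    then show ?thesis by (simp add: dglH)
  qed
  have sg1: "2 * Kf * (norm (e k))\<^sup>2 \<le> 2 * K * \<Lambda>\<^sup>2 * L\<^sup>2 * X"
  proof -
    have "Kf * (norm (e k))\<^sup>2 \<le> K * (L\<^sup>2 * X)" using K(3) ne2 K0 by (intro mult_mono) auto
    also have "\<dots> \<le> \<Lambda>\<^sup>2 * (K * (L\<^sup>2 * X))" 
      using mult_right_mono[of 1 "\<Lambda>\<^sup>2" "K * (L\<^sup>2 * X)"] \<Lambda> K0 X L by (simp add: one_le_power)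
    finally show ?thesis by (simp add: algebra_simps)
  qed
  \<comment> \<open>The vector in the norm is DT applied to the eigenvector \<open>e k\<close>, that
    is \<open>\<Lambda> *\<^sub>R e k\<close>.\<close>
  have sg2: "2 * Kg * (norm (e k - dm \<epsilon> p (H *v e k)))\<^sup>2 \<le> 2 * K * \<Lambda>\<^sup>2 * L\<^sup>2 * X"
  proof -
    have "dm \<epsilon> p (H *v e k) = (c k * (\<epsilon> / s)) *\<^sub>R e k"
      unfolding Hq dm_linear q_def dm_G[OF p] s_def by simp
    moreover have "c k * (\<epsilon> / s) = 1 - \<Lambda>" using s \<epsilon> by (simp add: c_def \<Lambda>_def)
    ultimately have "dm \<epsilon> p (H *v e k) = (1 - \<Lambda>) *\<^sub>R e k" by (simp only:)
    then have "e k - dm \<epsilon> p (H *v e k) = \<Lambda> *\<^sub>R e k" by (simp add: scaleR_diff_left)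
    then have "(norm (e k - dm \<epsilon> p (H *v e k)))\<^sup>2 = \<Lambda>\<^sup>2 * (norm (e k))\<^sup>2" by (simp add: power_mult_distrib)
    also have "\<dots> \<le> \<Lambda>\<^sup>2 * (L\<^sup>2 * X)" using ne2 by (intro mult_left_mono) auto
    finally have "Kg * (norm (e k - dm \<epsilon> p (H *v e k)))\<^sup>2 \<le> K * (\<Lambda>\<^sup>2 * (L\<^sup>2 * X))" using K(4) K0 by (intro mult_mono) auto
    then show ?thesis by (simp add: algebra_simps)
  qed
  have sh: "- (\<gamma> \<bullet> ddm \<epsilon> p (H *v e k) (H *v e k)) \<le> 5 * K * \<Lambda>\<^sup>2 * L * X"
  proof -
    have "\<bar>\<gamma> \<bullet> ddm \<epsilon> p (q k) (q k)\<bar> \<le> norm \<gamma> * norm (ddm \<epsilon> p (q k) (q k))" by (rule Cauchy_Schwarz_ineq2)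
    also have "\<dots> \<le> K * (5 * \<epsilon> / s ^ 3)"
      using K(1) K0 norm_ddm[OF p on1 \<epsilon>, of k] by (intro mult_mono) (auto simp: q_def s_def)
    finally have "(c k)\<^sup>2 * \<bar>\<gamma> \<bullet> ddm \<epsilon> p (q k) (q k)\<bar> \<le> (\<Lambda>\<^sup>2 * (s\<^sup>2 / \<epsilon>\<^sup>2)) * (K * (5 * \<epsilon> / s ^ 3))"
      using ckL by (intro mult_mono) auto
    also have "\<dots> = 5 * K * \<Lambda>\<^sup>2 * L * X" using s \<epsilon> by (simp add: L_def X_def field_simps power2_eq_square power3_eq_cube)
    finally have "\<bar>(c k)\<^sup>2 * (\<gamma> \<bullet> ddm \<epsilon> p (q k) (q k))\<bar> \<le> 5 * K * \<Lambda>\<^sup>2 * L * X" by (simp add: abs_mult)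
    then show ?thesis by (simp add: Hq ddms abs_le_iff)
  qed
  have ngr: "norm gr \<le> \<Lambda> * E" using gr by (simp add: \<Lambda>_def)
  have si: "(s / \<epsilon>) * (\<Sum>i\<in>UNIV. gQ \<epsilon> (e i) p \<bullet> gr / (l i * s / \<epsilon>)) \<le> 3 * \<Lambda> * E * L * X * S1"
  proof -
    have "(s / \<epsilon>) * (gQ \<epsilon> (e i) p \<bullet> gr / (l i * s / \<epsilon>)) \<le> 3 * \<Lambda> * E * L * X * (1 / l i)" for i
    proof -
      have "gQ \<epsilon> (e i) p \<bullet> gr \<le> norm (gQ \<epsilon> (e i) p) * norm gr" by (rule norm_cauchy_schwarz)
      also have "\<dots> \<le> (3 * (L * X)) * (\<Lambda> * E)" using ngk ngr L X by (intro mult_mono) auto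
      finally have "(gQ \<epsilon> (e i) p \<bullet> gr) / l i \<le> (3 * (L * X)) * (\<Lambda> * E) / l i" using lpos[of i] by (intro divide_right_mono) auto
      moreover have "(s / \<epsilon>) * (gQ \<epsilon> (e i) p \<bullet> gr / (l i * s / \<epsilon>)) = (gQ \<epsilon> (e i) p \<bullet> gr) / l i"
        using s \<epsilon> by (simp add: field_simps)
      ultimately show ?thesis by (simp add: mult_ac)
    qed
    then have "(\<Sum>i\<in>UNIV. (s / \<epsilon>) * (gQ \<epsilon> (e i) p \<bullet> gr / (l i * s / \<epsilon>))) \<le> (\<Sum>i\<in>UNIV. 3 * \<Lambda> * E * L * X * (1 / l i))"
      by (rule sum_mono)
    then show ?thesis unfolding sum_distrib_left[symmetric] S1_def .
  qed
  have sj: "- ((s / \<epsilon>) * (N * (gl p \<bullet> gr))) \<le> N * \<Lambda> * E * L * X"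
  proof -
    have "\<bar>gl p \<bullet> gr\<bar> \<le> norm (gl p) * norm gr" by (rule Cauchy_Schwarz_ineq2)
    also have "\<dots> \<le> (1 / s\<^sup>2) * (\<Lambda> * E)" using norm_gl[OF p] ngr by (intro mult_mono) (auto simp: s_def)
    finally have "((s / \<epsilon>) * N) * \<bar>gl p \<bullet> gr\<bar> \<le> ((s / \<epsilon>) * N) * ((1 / s\<^sup>2) * (\<Lambda> * E))" using s \<epsilon> N by (intro mult_left_mono) auto
    also have "\<dots> = N * \<Lambda> * E * L * X" using s \<epsilon> by (simp add: L_def X_def field_simps power2_eq_square)
    also have "((s / \<epsilon>) * N) * \<bar>gl p \<bullet> gr\<bar> = \<bar>(s / \<epsilon>) * (N * (gl p \<bullet> gr))\<bar>" using s \<epsilon> N by (simp add: abs_mult)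
    finally show ?thesis by linarith
  qed
  have sk: "- ((s / \<epsilon>) * (dm \<epsilon> p \<gamma> \<bullet> gr)) \<le> 2 * K * \<Lambda> * E * L\<^sup>2 * X"
  proof -
    have "norm (dm \<epsilon> p \<gamma>) \<le> 2 * \<epsilon> * K / s ^ 3"
      using norm_dm[OF p \<epsilon>, of \<gamma>] K(1) \<epsilon> s unfolding s_def[symmetric]
      by (elim order_trans) (intro divide_right_mono mult_left_mono, auto)
    then have "norm (dm \<epsilon> p \<gamma>) * norm gr \<le> (2 * \<epsilon> * K / s ^ 3) * (\<Lambda> * E)"
      using ngr \<epsilon> s K0 by (intro mult_mono) auto
    then have "\<bar>dm \<epsilon> p \<gamma> \<bullet> gr\<bar> \<le> (2 * \<epsilon> * K / s ^ 3) * (\<Lambda> * E)"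
      using Cauchy_Schwarz_ineq2[of "dm \<epsilon> p \<gamma>" gr] by linarith
    then have "(s / \<epsilon>) * \<bar>dm \<epsilon> p \<gamma> \<bullet> gr\<bar> \<le> (s / \<epsilon>) * ((2 * \<epsilon> * K / s ^ 3) * (\<Lambda> * E))"
      using s \<epsilon> by (intro mult_left_mono) auto
    also have "\<dots> = 2 * K * \<Lambda> * E * L\<^sup>2 * X" using s \<epsilon> by (simp add: L_def X_def field_simps power2_eq_square power3_eq_cube)
    also have "(s / \<epsilon>) * \<bar>dm \<epsilon> p \<gamma> \<bullet> gr\<bar> = \<bar>(s / \<epsilon>) * (dm \<epsilon> p \<gamma> \<bullet> gr)\<bar>" using s \<epsilon> by (simp add: abs_mult)
    finally show ?thesis by linarith
  qed
  have keyABC: "(\<Sum>i\<in>UNIV. A i) + (\<Sum>i\<in>UNIV. B i) + (\<Sum>i\<in>UNIV. C i) + (1 - \<Lambda>) * ((\<gamma> - \<gamma>f) \<bullet> gQ \<epsilon> (e k) p)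
    \<le> (\<Sum>i\<in>UNIV. dgQ \<epsilon> (e i) p (H *v e k) \<bullet> (H *v e k) / (l i * s / \<epsilon>))
      + - N * (dgl p (H *v e k) \<bullet> (H *v e k)) + 2 * Kf * (norm (e k))\<^sup>2
      + 2 * Kg * (norm (e k - dm \<epsilon> p (H *v e k)))\<^sup>2
      + - (\<gamma> \<bullet> ddm \<epsilon> p (H *v e k) (H *v e k))
      + ((s / \<epsilon>) * (\<Sum>i\<in>UNIV. gQ \<epsilon> (e i) p \<bullet> gr / (l i * s / \<epsilon>))
          + - ((s / \<epsilon>) * (N * (gl p \<bullet> gr))) + - ((s / \<epsilon>) * (dm \<epsilon> p \<gamma> \<bullet> gr)))"
    using key unfolding mu A_def B_def C_def sum.distrib[symmetric] add_divide_distrib[symmetric] \<Lambda>_def[symmetric] Qk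
    by (simp add: right_diff_distrib)
  \<comment> \<open>The sum of all error bounds, already divided by \<open>X\<close>.\<close>
  define M where "M = 3 * \<Lambda>\<^sup>2 + 6 * \<Lambda> * E * L * (S1 + n) + \<Lambda> * E * L\<^sup>2 * S1 + 6 * K * \<Lambda> * L + (\<Lambda> - 1)\<^sup>2 * (3 / \<Lambda>)
      + 2 * N * \<Lambda>\<^sup>2 + 4 * K * \<Lambda>\<^sup>2 * L\<^sup>2 + 5 * K * \<Lambda>\<^sup>2 * L + 3 * \<Lambda> * E * L * S1 + N * \<Lambda> * E * L + 2 * K * \<Lambda> * E * L\<^sup>2"
  have "(\<Lambda> - 1)\<^sup>2 * X * (3 / \<Lambda> - S) = (\<Lambda> - 1)\<^sup>2 * (3 / \<Lambda>) * X - (\<Lambda> - 1)\<^sup>2 * S * X"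
    by (simp add: algebra_simps)
  then have "(\<Lambda> - 1)\<^sup>2 * S * X \<le> M * X"
    using keyABC sA sB sC sd se sf sg1 sg2 sh si sj sk unfolding M_def by (simp add: algebra_simps)
  then have SM: "(\<Lambda> - 1)\<^sup>2 * S \<le> M" using X by simp
  \<comment> \<open>Each error is of one of two types: quadratic in \<open>\<Lambda>\<close>, or
    linear in \<open>\<Lambda> * E\<close> with at most one factor \<open>S + 1\<close>. The factor
    \<open>R\<^sup>2\<close> dominates 1, \<open>L\<close> and \<open>L\<^sup>2\<close>.\<close>
  define P1 where "P1 = R\<^sup>2 * \<Lambda>\<^sup>2"
  define P2 where "P2 = R\<^sup>2 * (\<Lambda> * E * (S + 1))"
  have R2: "1 \<le> R\<^sup>2" "R \<le> R\<^sup>2"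
    using one_le_power[OF R(2), of 2] mult_left_mono[OF R(2), of R] R(2) by (auto simp: power2_eq_square)
  have L1: "L \<le> R\<^sup>2" "L\<^sup>2 \<le> R\<^sup>2" using L R2 by (auto intro: power_mono)
  have ll: "\<Lambda> \<le> \<Lambda>\<^sup>2" using \<Lambda> by (simp add: power2_eq_square)
  have S1S: "S1 \<le> S + 1" "S1 \<ge> 0" using \<Lambda> S0 by (auto simp: S1)
  have lE: "\<Lambda> * E \<ge> 0" using \<Lambda> E by simp
  have m1: "\<Lambda>\<^sup>2 \<le> P1" unfolding P1_def using R2 by (simp add: mult_le_cancel_right1)
  have m2: "\<Lambda> * E * L * (S1 + n) \<le> (1 + n) * P2"
  proof -
    have "0 \<le> S * n" using S0 by (simp add: n_def)
    moreover have "(1 + n) * (S + 1) = 1 + n + S + S * n" by (simp add: algebra_simps)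
    ultimately have "S1 + n \<le> (1 + n) * (S + 1)" using S1S by linarith
    then have "L * (S1 + n) \<le> R\<^sup>2 * ((1 + n) * (S + 1))" using L1 L S1S by (intro mult_mono) (auto simp: n_def)
    then have "(\<Lambda> * E) * (L * (S1 + n)) \<le> (\<Lambda> * E) * (R\<^sup>2 * ((1 + n) * (S + 1)))" using lE by (rule mult_left_mono)
    then show ?thesis by (simp add: P2_def mult_ac)
  qed
  have m3: "\<Lambda> * E * L\<^sup>2 * S1 \<le> P2"
  proof -
    have "L\<^sup>2 * S1 \<le> R\<^sup>2 * (S + 1)" using L1 S1S by (intro mult_mono) auto
    then have "(\<Lambda> * E) * (L\<^sup>2 * S1) \<le> (\<Lambda> * E) * (R\<^sup>2 * (S + 1))" using lE by (rule mult_left_mono)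
    then show ?thesis by (simp add: P2_def mult_ac)
  qed
  have m4: "K * \<Lambda> * L \<le> K * P1"
  proof -
    have "\<Lambda> * L \<le> \<Lambda>\<^sup>2 * R\<^sup>2" using ll L1 L \<Lambda> by (intro mult_mono) auto
    then have "K * (\<Lambda> * L) \<le> K * (\<Lambda>\<^sup>2 * R\<^sup>2)" using K0 by (rule mult_left_mono)
    then show ?thesis by (simp add: P1_def mult_ac)
  qed
  have m5: "(\<Lambda> - 1)\<^sup>2 * (3 / \<Lambda>) \<le> 3 * P1"
  proof -
    have "(\<Lambda> - 1)\<^sup>2 * (3 / \<Lambda>) \<le> \<Lambda>\<^sup>2 * 3" using \<Lambda> by (intro mult_mono power_mono) (auto simp: field_simps)
    then show ?thesis using m1 by linarith
  qed
  have m6: "N * \<Lambda>\<^sup>2 \<le> N * P1" using m1 N by (rule mult_left_mono)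
  have KP: "K * \<Lambda>\<^sup>2 * a \<le> K * P1" if "a \<le> R\<^sup>2" for a
  proof -
    have "(K * \<Lambda>\<^sup>2) * a \<le> (K * \<Lambda>\<^sup>2) * R\<^sup>2" using that K0 by (intro mult_left_mono) auto
    then show ?thesis by (simp add: P1_def mult_ac)
  qed
  have m7: "K * \<Lambda>\<^sup>2 * L\<^sup>2 \<le> K * P1" "K * \<Lambda>\<^sup>2 * L \<le> K * P1"
    using KP L1 by auto
  have m8: "\<Lambda> * E * L * S1 \<le> P2"
  proof -
    have "L * S1 \<le> R\<^sup>2 * (S + 1)" using L1 L S1S by (intro mult_mono) auto
    then have "(\<Lambda> * E) * (L * S1) \<le> (\<Lambda> * E) * (R\<^sup>2 * (S + 1))" using lE by (rule mult_left_mono)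
    then show ?thesis by (simp add: P2_def mult_ac)
  qed
  have lEP: "\<Lambda> * E * c \<le> P2" if "c \<le> R\<^sup>2" for c
  proof -
    have "R\<^sup>2 * 1 \<le> R\<^sup>2 * (S + 1)" using S0 by (intro mult_left_mono) auto
    then have "c * 1 \<le> R\<^sup>2 * (S + 1)" using that by simp
    then have "(\<Lambda> * E) * (c * 1) \<le> (\<Lambda> * E) * (R\<^sup>2 * (S + 1))" using lE by (rule mult_left_mono)
    then show ?thesis by (simp add: P2_def mult_ac)
  qed
  have m9: "N * (\<Lambda> * E * L) \<le> N * P2" "K * (\<Lambda> * E * L\<^sup>2) \<le> K * P2"
    using lEP[OF L1(1)] lEP[OF L1(2)] N K0 by (auto intro: mult_left_mono)
  have P: "P1 \<ge> 0" "P2 \<ge> 0" using lE S0 by (auto simp: P1_def P2_def)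
  have nn: "n \<ge> 0" by (simp add: n_def)
  have "M \<le> 6 * P1 + 2 * (N * P1) + 15 * (K * P1) + 6 * ((1 + n) * P2) + 4 * P2 + N * P2 + 2 * (K * P2)"
    using m1 m2 m3 m4 m5 m6 m7 m8 m9 unfolding M_def by (simp add: mult.assoc)
  \<comment> \<open>The coefficients are \<open>6 + 2 N + 15 K\<close> for \<open>P1\<close> and
    \<open>10 + 6 n + N + 2 K\<close> for \<open>P2\<close>; the constant is a generous common
    bound.\<close>
  also have "\<dots> \<le> (20 + 6 * n + 3 * N + 20 * K) * (P1 + P2)"
    using P nn N K0 mult_nonneg_nonneg[OF nn P(1)] mult_nonneg_nonneg[OF N P(1)] mult_nonneg_nonneg[OF N P(2)]
      mult_nonneg_nonneg[OF K0 P(1)] mult_nonneg_nonneg[OF K0 P(2)] by (simp add: algebra_simps)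
  also have "\<dots> = R\<^sup>2 * (20 + 6 * n + 3 * N + 20 * K) * (\<Lambda>\<^sup>2 + \<Lambda> * E * (S + 1))"
    by (simp add: P1_def P2_def algebra_simps)
  finally show ?thesis using SM unfolding \<Lambda>_def S_def n_def by linarith
qed

section \<open>The interior estimate\<close>

text \<open>Both derivatives of \<open>\<rho>\<close> are measured against
  \<open>M / (\<zeta> x)\<^sup>2\<close>, which at the maximum point is the largest eigenvalue. The
  remaining factor becomes at most \<open>r ^ 4 + 36 * r\<^sup>2\<close> when multiplied by the
  cutoff \<open>(\<zeta> x)\<^sup>2\<close>.\<close>

lemma cutoff_gradient_estimate:
  fixes y :: "real^'n" and r M :: real
  defines "\<zeta> \<equiv> \<lambda>x. r\<^sup>2 - (x - y) \<bullet> (x - y)"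
  defines "g\<rho> \<equiv> \<lambda>x. (- 4 * M / \<zeta> x ^ 3) *\<^sub>R (x - y)"
    and "dg\<rho> \<equiv> \<lambda>x h. (- 4 * M / \<zeta> x ^ 3) *\<^sub>R h - (24 * M * ((x - y) \<bullet> h) / \<zeta> x ^ 4) *\<^sub>R (x - y)"
  assumes x: "norm (x - y) < r" and M: "M \<ge> 0"
  shows "((\<lambda>x. 1 - M / (\<zeta> x)\<^sup>2) has_derivative (\<lambda>h. g\<rho> x \<bullet> h)) (at x)"
    and "(g\<rho> has_derivative dg\<rho> x) (at x)"
    and "norm (g\<rho> x) \<le> M / (\<zeta> x)\<^sup>2 * (1 + 36 * r\<^sup>2 / (\<zeta> x)\<^sup>2)"
    and "dg\<rho> x v \<bullet> v \<ge> - (M / (\<zeta> x)\<^sup>2 * (1 + 36 * r\<^sup>2 / (\<zeta> x)\<^sup>2) * (norm v)\<^sup>2)"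
    and "0 < \<zeta> x" "\<zeta> x \<le> r\<^sup>2"
proof -
  have r: "r > 0" using x norm_ge_zero[of "x - y"] by linarith
  have "(norm (x - y))\<^sup>2 < r\<^sup>2" using x by (intro power_strict_mono) auto
  then show z: "0 < \<zeta> x" by (simp add: \<zeta>_def power2_norm_eq_inner)
  show zr: "\<zeta> x \<le> r\<^sup>2" by (simp add: \<zeta>_def)
  have zd: "(\<zeta> has_derivative (\<lambda>h. - 2 * ((x - y) \<bullet> h))) (at x)"
    unfolding \<zeta>_def by (auto intro!: derivative_eq_intros simp: inner_commute)
  have inv: "((\<lambda>x. 1 / \<zeta> x) has_derivative (\<lambda>h. 2 * ((x - y) \<bullet> h) / (\<zeta> x)\<^sup>2)) (at x)"
    using has_derivative_divide[OF has_derivative_const[of 1] zd] z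
    by (simp add: power2_eq_square divide_inverse mult_ac)
  have "((\<lambda>x. 1 - M * (1 / \<zeta> x * (1 / \<zeta> x))) has_derivative
     (\<lambda>h. 0 - M * (1 / \<zeta> x * (2 * ((x - y) \<bullet> h) / (\<zeta> x)\<^sup>2) + 2 * ((x - y) \<bullet> h) / (\<zeta> x)\<^sup>2 * (1 / \<zeta> x)))) (at x)"
    by (intro has_derivative_diff has_derivative_const has_derivative_mult_right has_derivative_mult inv)
  then show "((\<lambda>x. 1 - M / (\<zeta> x)\<^sup>2) has_derivative (\<lambda>h. g\<rho> x \<bullet> h)) (at x)"
    by (rule has_derivative_cong_fun) (use z in \<open>simp_all add: g\<rho>_def power2_eq_square power3_eq_cube mult_ac\<close>)
  have "((\<lambda>x. (- 4 * M * (1 / \<zeta> x * (1 / \<zeta> x * (1 / \<zeta> x)))) *\<^sub>R (x - y)) has_derivative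
     (\<lambda>h. (- 4 * M * (1 / \<zeta> x * (1 / \<zeta> x * (1 / \<zeta> x)))) *\<^sub>R (h - 0) +
       (- 4 * M * (1 / \<zeta> x * (1 / \<zeta> x * (2 * ((x - y) \<bullet> h) / (\<zeta> x)\<^sup>2) + 2 * ((x - y) \<bullet> h) / (\<zeta> x)\<^sup>2 * (1 / \<zeta> x))
         + 2 * ((x - y) \<bullet> h) / (\<zeta> x)\<^sup>2 * (1 / \<zeta> x * (1 / \<zeta> x)))) *\<^sub>R (x - y))) (at x)"
    by (intro has_derivative_scaleR has_derivative_mult_right has_derivative_mult inv has_derivative_diff
      has_derivative_const has_derivative_ident)
  then show "(g\<rho> has_derivative dg\<rho> x) (at x)"
  proof (rule has_derivative_cong_fun)
    show "(- 4 * M * (1 / \<zeta> x * (1 / \<zeta> x * (1 / \<zeta> x)))) *\<^sub>R (x - y) = g\<rho> x" for x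
      by (simp add: g\<rho>_def power3_eq_cube)
    fix h
    have "- 4 * M * (1 / \<zeta> x * (1 / \<zeta> x * (2 * ((x - y) \<bullet> h) / (\<zeta> x)\<^sup>2) + 2 * ((x - y) \<bullet> h) / (\<zeta> x)\<^sup>2 * (1 / \<zeta> x))
         + 2 * ((x - y) \<bullet> h) / (\<zeta> x)\<^sup>2 * (1 / \<zeta> x * (1 / \<zeta> x))) = - (24 * M * ((x - y) \<bullet> h) / \<zeta> x ^ 4)"
      using z by (simp add: field_simps power2_eq_square power4_eq_xxxx)
    then show "(- 4 * M * (1 / \<zeta> x * (1 / \<zeta> x * (1 / \<zeta> x)))) *\<^sub>R (h - 0) +
       (- 4 * M * (1 / \<zeta> x * (1 / \<zeta> x * (2 * ((x - y) \<bullet> h) / (\<zeta> x)\<^sup>2) + 2 * ((x - y) \<bullet> h) / (\<zeta> x)\<^sup>2 * (1 / \<zeta> x))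
         + 2 * ((x - y) \<bullet> h) / (\<zeta> x)\<^sup>2 * (1 / \<zeta> x * (1 / \<zeta> x)))) *\<^sub>R (x - y) = dg\<rho> x h"
      by (simp add: dg\<rho>_def power3_eq_cube)
  qed
  define a where "a = r / \<zeta> x"
  have a: "a > 0" using r z by (simp add: a_def)
  \<comment> \<open>The gradient costs only one power of \<open>r / \<zeta> x\<close>; this makes it
    share a factor with the second derivative, whose
    \<open>4 / \<zeta> x + 24 * r\<^sup>2 / (\<zeta> x)\<^sup>2\<close> is at most
    \<open>28 * r\<^sup>2 / (\<zeta> x)\<^sup>2\<close> because
    \<open>\<zeta> x \<le> r\<^sup>2\<close>.\<close>
  have "4 * a \<le> 1 + 36 * a\<^sup>2"
  proof -
    have "0 \<le> (1 - 2 * a)\<^sup>2 + 32 * a\<^sup>2" by simp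
    then show ?thesis by (simp add: power2_eq_square algebra_simps)
  qed
  then have E1: "4 * r / \<zeta> x \<le> 1 + 36 * r\<^sup>2 / (\<zeta> x)\<^sup>2" by (simp add: a_def power_divide)
  have "norm (g\<rho> x) = 4 * M / \<zeta> x ^ 3 * norm (x - y)" using z M by (simp add: g\<rho>_def)
  also have "\<dots> \<le> 4 * M / \<zeta> x ^ 3 * r" using x z M by (intro mult_left_mono) auto
  also have "\<dots> = M / (\<zeta> x)\<^sup>2 * (4 * r / \<zeta> x)" using z by (simp add: field_simps power2_eq_square power3_eq_cube)
  also have "\<dots> \<le> M / (\<zeta> x)\<^sup>2 * (1 + 36 * r\<^sup>2 / (\<zeta> x)\<^sup>2)" using E1 M by (intro mult_left_mono) auto
  finally show "norm (g\<rho> x) \<le> M / (\<zeta> x)\<^sup>2 * (1 + 36 * r\<^sup>2 / (\<zeta> x)\<^sup>2)" .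
  have "((x - y) \<bullet> v)\<^sup>2 \<le> ((x - y) \<bullet> (x - y)) * (v \<bullet> v)" by (rule Cauchy_Schwarz_ineq)
  also have "\<dots> \<le> r\<^sup>2 * (v \<bullet> v)"
    using z by (intro mult_right_mono) (auto simp: \<zeta>_def)
  finally have cs: "((x - y) \<bullet> v)\<^sup>2 \<le> r\<^sup>2 * (v \<bullet> v)" .
  have "4 * (1 / \<zeta> x) + 24 * (r\<^sup>2 / (\<zeta> x)\<^sup>2) \<le> 36 * (r\<^sup>2 / (\<zeta> x)\<^sup>2)"
  proof -
    have "1 / \<zeta> x = \<zeta> x / (\<zeta> x)\<^sup>2" using z by (simp add: power2_eq_square)
    also have "\<dots> \<le> r\<^sup>2 / (\<zeta> x)\<^sup>2" using zr by (rule divide_right_mono) simp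
    finally have "1 / \<zeta> x \<le> r\<^sup>2 / (\<zeta> x)\<^sup>2" .
    moreover have "0 \<le> r\<^sup>2 / (\<zeta> x)\<^sup>2" by simp
    ultimately show ?thesis by linarith
  qed
  then have "M / (\<zeta> x)\<^sup>2 * (4 * (1 / \<zeta> x) + 24 * (r\<^sup>2 / (\<zeta> x)\<^sup>2)) * (v \<bullet> v)
     \<le> M / (\<zeta> x)\<^sup>2 * (1 + 36 * (r\<^sup>2 / (\<zeta> x)\<^sup>2)) * (v \<bullet> v)"
    using M by (intro mult_right_mono mult_left_mono) auto
  moreover have "dg\<rho> x v \<bullet> v = - (4 * M / \<zeta> x ^ 3 * (v \<bullet> v) + 24 * M / \<zeta> x ^ 4 * ((x - y) \<bullet> v)\<^sup>2)"
    by (simp add: dg\<rho>_def inner_diff_left power2_eq_square)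
  moreover have "24 * M / \<zeta> x ^ 4 * ((x - y) \<bullet> v)\<^sup>2 \<le> 24 * M / \<zeta> x ^ 4 * (r\<^sup>2 * (v \<bullet> v))"
    using cs M by (intro mult_left_mono) auto
  moreover have "4 * M / \<zeta> x ^ 3 * (v \<bullet> v) + 24 * M / \<zeta> x ^ 4 * (r\<^sup>2 * (v \<bullet> v))
     = M / (\<zeta> x)\<^sup>2 * (4 * (1 / \<zeta> x) + 24 * (r\<^sup>2 / (\<zeta> x)\<^sup>2)) * (v \<bullet> v)"
    using z by (simp add: field_simps power2_eq_square power3_eq_cube power4_eq_xxxx)
  ultimately show "dg\<rho> x v \<bullet> v \<ge> - (M / (\<zeta> x)\<^sup>2 * (1 + 36 * r\<^sup>2 / (\<zeta> x)\<^sup>2) * (norm v)\<^sup>2)"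
    by (simp add: power2_norm_eq_inner)
qed

context C3_function begin

text \<open>Lets the inequality at the maximum point be applied on a small ball, where all
  expansions of the data are available.\<close>

lemma C3_function_subset:
  assumes "open U" "U \<subseteq> S"
  shows "C3_function U u p H D"
  using assms open_S u_deriv p_deriv H_sym H_deriv D_commute D_sym continuous_on_subset[OF D_cont]
  by unfold_locales blast+

text \<open>The three summands on the right match three cases for the largest eigenvalue at the
  maximum point: below the cutoff error \<open>8 * C1 * E\<close>, below 2, or above both. In the
  last case the reciprocals of the other eigenvalues are bounded, and the product bound
  \<open>F1\<close> gives the claim. The factor \<open>r ^ 4\<close> is the cutoff at the
  centre.\<close>

lemma interior_bound:
  fixes y :: "real^'n" and r \<epsilon> c0 K R F1 :: real and lf lg :: "real^'n \<Rightarrow> real" and \<gamma>f \<gamma>g :: "real^'n \<Rightarrow> real^'n"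
  assumes \<epsilon>: "\<epsilon> > 0" and P: "\<And>x. x \<in> S \<Longrightarrow> p x \<bullet> p x < 1"
    and pd: "\<And>x. x \<in> S \<Longrightarrow> pos_def (A_of \<epsilon> (p x) - H x)"
    and lndet: "\<And>x. x \<in> S \<Longrightarrow> ln (det (A_of \<epsilon> (p x) - H x)) = c0 + (real CARD('n) + 2) * ln (lapse (p x)) + lf x - lg (T_of \<epsilon> x)"
    and prod: "\<And>x e \<mu>. x \<in> S \<Longrightarrow> diag_basis (G_mat (p x)) (A_of \<epsilon> (p x) - H x) e \<mu> \<Longrightarrow> (\<Prod>i\<in>UNIV. \<mu> i * (\<epsilon> / lapse (p x))) \<le> F1"
    and L: "\<And>x. x \<in> S \<Longrightarrow> \<epsilon> / lapse (p x) \<le> R" and R: "R \<ge> 1"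
    and lf: "\<And>x. x \<in> S \<Longrightarrow> (lf has_derivative (\<lambda>h. \<gamma>f x \<bullet> h)) (at x)" "\<And>x. x \<in> S \<Longrightarrow> norm (\<gamma>f x) \<le> K"
      "\<And>x z r. ball x r \<subseteq> S \<Longrightarrow> z \<in> ball x r \<Longrightarrow> \<bar>lf z - lf x - \<gamma>f x \<bullet> (z - x)\<bar> \<le> K * (norm (z - x))\<^sup>2"
    and O: "open O'" "\<And>x. x \<in> S \<Longrightarrow> T_of \<epsilon> x \<in> O'"
    and lg: "\<And>x. x \<in> O' \<Longrightarrow> (lg has_derivative (\<lambda>h. \<gamma>g x \<bullet> h)) (at x)" "\<And>x. x \<in> O' \<Longrightarrow> norm (\<gamma>g x) \<le> K"
      "\<And>x. x \<in> O' \<Longrightarrow> isCont \<gamma>g x"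
      "\<And>x z r. ball x r \<subseteq> O' \<Longrightarrow> z \<in> ball x r \<Longrightarrow> \<bar>lg z - lg x - \<gamma>g x \<bullet> (z - x)\<bar> \<le> K * (norm (z - x))\<^sup>2"
    and r: "r > 0" "cball y r \<subseteq> S"
    and db: "diag_basis (G_mat (p y)) (A_of \<epsilon> (p y) - H y) e \<mu>"
  defines "C1 \<equiv> R\<^sup>2 * (20 + 6 * real CARD('n) + 3 * (real CARD('n) + 2) + 20 * K)"
  shows "r ^ 4 * (\<mu> j * (\<epsilon> / lapse (p y))) \<le>
     8 * C1 * (r ^ 4 + 36 * r\<^sup>2) + 2 * r ^ 4 + r ^ 4 * (F1 * (8 * C1 + 1) ^ CARD('n))"
proof -
  define w where "w = (\<lambda>x. A_of \<epsilon> (p x) - H x)"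
  define \<zeta> where "\<zeta> = (\<lambda>x. r\<^sup>2 - (x - y) \<bullet> (x - y))"
  have yS: "y \<in> S" using r by auto
  have K0: "K \<ge> 0" using lf(2)[OF yS] norm_ge_zero[of "\<gamma>f y"] by linarith
  have C1: "C1 \<ge> 1"
  proof -
    have "1 * 1 \<le> R\<^sup>2 * (20 + 6 * real CARD('n) + 3 * (real CARD('n) + 2) + 20 * K)"
      using R K0 by (intro mult_mono) (auto simp: one_le_power)
    then show ?thesis by (simp add: C1_def)
  qed
  have QA: "v \<bullet> (A_of \<epsilon> (p x) *v v) = (lapse (p x) / \<epsilon>) * (v \<bullet> (G_mat (p x) *v v))" for v x
    by (simp add: A_of_def scaleR_matrix_vector_assoc[symmetric])
  have Apos: "v \<bullet> (A_of \<epsilon> (p x) *v v) > 0" if "x \<in> S" "v \<noteq> 0" for v x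
    using pos_def_G[OF P[OF that(1)]] lapse_pos[OF P[OF that(1)]] \<epsilon> that(2) unfolding QA by (simp add: pos_def_def)
  \<comment> \<open>The cutoff vanishes on the sphere of radius \<open>r\<close>, so a positive
    maximum is attained in the open ball.\<close>
  define F where "F = (\<lambda>(x, v). (\<zeta> x)\<^sup>2 * ((v \<bullet> (w x *v v)) / (v \<bullet> (A_of \<epsilon> (p x) *v v))))"
  let ?K = "cball y r \<times> (sphere 0 1 :: (real^'n) set)"
  have cA: "continuous_on S (\<lambda>x. A_of \<epsilon> (p x))"
    by (rule continuous_on_A_of[OF P])
  have cH: "continuous_on S H"
  proof -
    have "continuous_on S (\<lambda>x. H x $ i $ j)" for i j
    proof -
      have "continuous_on S (\<lambda>x. (H x *v axis j 1) $ i)" by (intro continuous_intros continuous_Hv)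
      then show ?thesis by (simp add: matrix_vector_mult_basis column_def)
    qed
    then have "continuous_on S (\<lambda>x. \<chi> i j. H x $ i $ j)" by (intro continuous_on_vec_lambda)
    then show ?thesis by simp
  qed
  have quadc: "continuous_on ?K (\<lambda>z. snd z \<bullet> (B (fst z) *v snd z))" if "continuous_on S B" for B :: "real^'n \<Rightarrow> real^'n^'n"
  proof -
    have "continuous_on ?K (\<lambda>z. B (fst z))"
      by (rule continuous_on_compose2[OF that]) (use r in \<open>auto intro!: continuous_intros\<close>)
    then show ?thesis unfolding matrix_vector_mult_def by (intro continuous_intros continuous_on_vec_lambda)
  qed
  have q1: "continuous_on ?K (\<lambda>z. snd z \<bullet> (w (fst z) *v snd z))"
    unfolding w_def by (rule quadc[OF continuous_on_diff[OF cA cH]])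
  have q2: "continuous_on ?K (\<lambda>z. (\<zeta> (fst z))\<^sup>2)"
    unfolding \<zeta>_def by (intro continuous_intros)
  have q3: "\<forall>z\<in>?K. snd z \<bullet> (A_of \<epsilon> (p (fst z)) *v snd z) \<noteq> 0"
  proof
    fix z assume "z \<in> ?K"
    then have "fst z \<in> S" "snd z \<noteq> 0" using r by auto
    then show "snd z \<bullet> (A_of \<epsilon> (p (fst z)) *v snd z) \<noteq> 0" using Apos by (metis less_irrefl)
  qed
  have "continuous_on ?K F"
    unfolding F_def case_prod_beta
    by (rule continuous_on_mult[OF q2 continuous_on_divide[OF q1 quadc[OF cA] q3]])
  moreover have "compact ?K" by (intro compact_Times) auto
  moreover have "(y, axis j 1) \<in> ?K" using r by (simp add: norm_axis_1)
  ultimately obtain z0 where z0: "z0 \<in> ?K" "\<And>z. z \<in> ?K \<Longrightarrow> F z \<le> F z0"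
    using continuous_attains_sup[of ?K F] by blast
  define x0 where "x0 = fst z0"
  define v0 where "v0 = snd z0"
  have xv: "x0 \<in> cball y r" "norm v0 = 1" using z0(1) by (auto simp: x0_def v0_def)
  define M where "M = F z0"
  have FM: "(\<zeta> x)\<^sup>2 * (v \<bullet> (w x *v v)) \<le> M * (v \<bullet> (A_of \<epsilon> (p x) *v v))" if x: "x \<in> cball y r" for x v
  proof (cases "v = 0")
    case False
    define v' where "v' = v /\<^sub>R norm v"
    have v: "v = norm v *\<^sub>R v'" using False by (simp add: v'_def)
    have "(x, v') \<in> ?K" using x False by (simp add: v'_def)
    then have "F (x, v') \<le> M" unfolding M_def by (rule z0(2))
    moreover have pos: "v' \<bullet> (A_of \<epsilon> (p x) *v v') > 0"
      using Apos[of x v'] x r False by (auto simp: v'_def)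
    ultimately have "(\<zeta> x)\<^sup>2 * (v' \<bullet> (w x *v v')) \<le> M * (v' \<bullet> (A_of \<epsilon> (p x) *v v'))"
      by (simp add: F_def pos_divide_le_eq)
    then have "(norm v * norm v) * ((\<zeta> x)\<^sup>2 * (v' \<bullet> (w x *v v'))) \<le> (norm v * norm v) * (M * (v' \<bullet> (A_of \<epsilon> (p x) *v v')))"
      by (rule mult_left_mono) simp
    moreover have "v \<bullet> (B *v v) = (norm v * norm v) * (v' \<bullet> (B *v v'))" for B :: "real^'n^'n"
    proof -
      have "v \<bullet> (B *v v) = (norm v *\<^sub>R v') \<bullet> (B *v (norm v *\<^sub>R v'))" using v by simp
      then show ?thesis by (simp only: matrix_vector_mult_scaleR inner_scaleR_left inner_scaleR_right mult.assoc)
    qed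
    ultimately show ?thesis by (simp add: mult_ac)
  qed simp
  have eM: "(\<zeta> x)\<^sup>2 * (m i * (\<epsilon> / lapse (p x))) \<le> M"
    if x: "x \<in> cball y r" and dbx: "diag_basis (G_mat (p x)) (w x) b m" for x b m i
  proof -
    interpret X: diag_basis "G_mat (p x)" "w x" b m by fact
    have s: "lapse (p x) > 0" using lapse_pos[OF P] x r by blast
    have "(\<zeta> x)\<^sup>2 * m i \<le> M * (lapse (p x) / \<epsilon>)"
      using FM[OF x, of "b i"] unfolding QA X.orthonormal X.eigen_form by simp
    then have "(\<zeta> x)\<^sup>2 * m i * (\<epsilon> / lapse (p x)) \<le> M * (lapse (p x) / \<epsilon>) * (\<epsilon> / lapse (p x))"
      by (rule mult_right_mono) (use s \<epsilon> in simp)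
    then show ?thesis using s \<epsilon> by (simp add: mult.assoc)
  qed
  have zy: "\<zeta> y = r\<^sup>2" by (simp add: \<zeta>_def)
  have goal: "r ^ 4 * (\<mu> j * (\<epsilon> / lapse (p y))) \<le> M"
  proof -
    have "diag_basis (G_mat (p y)) (w y) e \<mu>" using db by (simp add: w_def)
    then have "(\<zeta> y)\<^sup>2 * (\<mu> j * (\<epsilon> / lapse (p y))) \<le> M"
      by (rule eM[rotated]) (use r in simp)
    moreover have "(\<zeta> y)\<^sup>2 = r ^ 4" unfolding zy by simp
    ultimately show ?thesis by simp
  qed
  have Mpos: "M > 0"
  proof -
    interpret Y: diag_basis "G_mat (p y)" "A_of \<epsilon> (p y) - H y" e \<mu> by fact
    have "\<mu> j > 0" by (rule Y.pos_def_eigen[OF pd[OF yS]])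
    then have "0 < r ^ 4 * (\<mu> j * (\<epsilon> / lapse (p y)))" using r \<epsilon> lapse_pos[OF P[OF yS]] by simp
    then show ?thesis using goal by linarith
  qed
  have x0S: "x0 \<in> S" using xv r by blast
  have zx0: "\<zeta> x0 \<noteq> 0"
  proof
    assume "\<zeta> x0 = 0"
    then have "M = 0" by (simp add: M_def F_def case_prod_beta x0_def)
    then show False using Mpos by simp
  qed
  have nx0: "norm (x0 - y) < r"
  proof (rule ccontr)
    assume "\<not> ?thesis"
    then have "norm (x0 - y) = r" using xv(1) by (simp add: dist_norm norm_minus_commute)
    then show False using zx0 by (simp add: \<zeta>_def power2_norm_eq_inner[symmetric])
  qed
  define s0 where "s0 = lapse (p x0)"
  have s0: "s0 > 0" using lapse_pos[OF P[OF x0S]] by (simp add: s0_def)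
  have wpd: "pos_def (w x0)" using pd[OF x0S] by (simp add: w_def)
  then have wsym: "sym_mat (w x0)" by (simp add: pos_def_def)
  have Gsym: "sym_mat (G_mat (p x0))" using pos_def_G[OF P[OF x0S]] by (simp add: pos_def_def)
  obtain b m where dbx: "diag_basis (G_mat (p x0)) (w x0) b m"
    using simultaneous_diagonalization[OF pos_def_G[OF P[OF x0S]] wsym] by blast
  interpret X: diag_basis "G_mat (p x0)" "w x0" b m by fact
  have mpos: "m i > 0" for i by (rule X.pos_def_eigen[OF wpd])
  obtain k where k: "\<And>i. m i \<le> m k"
    using Max_in[of "range m"] Max_ge[of "range m"] by (metis UNIV_I UNIV_not_empty finite finite_imageI image_is_empty imageE rangeI)
  define l where "l = (\<lambda>i. m i * (\<epsilon> / s0))"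
  have lpos: "l i > 0" for i using mpos s0 \<epsilon> by (simp add: l_def)
  have v0: "v0 \<noteq> 0" using xv(2) by auto
  \<comment> \<open>The maximal direction \<open>v0\<close> may be replaced by the eigenvector
    \<open>b k\<close> of the largest eigenvalue, whose quotient is at least as large. Hence
    \<open>b k\<close> is the direction to freeze.\<close>
  have Mle: "M \<le> (\<zeta> x0)\<^sup>2 * l k"
  proof -
    have "v0 \<bullet> (w x0 *v v0) \<le> (\<Sum>i\<in>UNIV. m k * (b i \<bullet> (G_mat (p x0) *v v0))\<^sup>2)"
      unfolding X.quad_expand[OF Gsym wsym] by (intro sum_mono mult_right_mono k) simp
    also have "\<dots> = m k * (v0 \<bullet> (G_mat (p x0) *v v0))"
      unfolding X.quad_expand_G sum_distrib_left[symmetric] ..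
    also have "\<dots> = l k * (v0 \<bullet> (A_of \<epsilon> (p x0) *v v0))"
      unfolding QA l_def s0_def[symmetric] using s0 \<epsilon> by simp
    finally have "(v0 \<bullet> (w x0 *v v0)) / (v0 \<bullet> (A_of \<epsilon> (p x0) *v v0)) \<le> l k"
      using Apos[OF x0S v0] by (simp add: pos_divide_le_eq)
    then have "(\<zeta> x0)\<^sup>2 * ((v0 \<bullet> (w x0 *v v0)) / (v0 \<bullet> (A_of \<epsilon> (p x0) *v v0))) \<le> (\<zeta> x0)\<^sup>2 * l k"
      by (rule mult_left_mono) simp
    then show ?thesis by (simp add: M_def F_def case_prod_beta x0_def v0_def)
  qed
  have Meq: "M = (\<zeta> x0)\<^sup>2 * l k"
    using Mle eM[OF xv(1) dbx, of k] by (simp add: l_def s0_def)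
  define E where "E = 1 + 36 * r\<^sup>2 / (\<zeta> x0)\<^sup>2"
  have Mz: "M / (\<zeta> x0)\<^sup>2 = l k" using Meq zx0 by simp
  note cut = cutoff_gradient_estimate[OF nx0 less_imp_le[OF Mpos]]
  have z0pos: "0 < \<zeta> x0" "\<zeta> x0 \<le> r\<^sup>2" unfolding \<zeta>_def by (rule cut(5), rule cut(6))
  have eta: "(\<zeta> x0)\<^sup>2 \<le> r ^ 4"
  proof -
    have "(\<zeta> x0)\<^sup>2 \<le> (r\<^sup>2)\<^sup>2" using z0pos by (intro power_mono) auto
    then show ?thesis by simp
  qed
  have rest: "0 \<le> 8 * C1 * (r ^ 4 + 36 * r\<^sup>2)" "0 \<le> 2 * r ^ 4" using C1 by auto
  have F1: "F1 > 0"
  proof -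
    have "0 < (\<Prod>i\<in>UNIV. l i)" using lpos by (intro prod_pos) auto
    also have "\<dots> \<le> F1" unfolding l_def s0_def by (rule prod[OF x0S dbx[unfolded w_def]])
    finally show ?thesis .
  qed
  have rest3: "0 \<le> r ^ 4 * (F1 * (8 * C1 + 1) ^ CARD('n))" using F1 C1 by simp
  consider "l k < 2" | "l k \<ge> 2" "l k < 8 * C1 * E" | "l k \<ge> 2" "l k \<ge> 8 * C1 * E" by linarith
  then have "M \<le> 8 * C1 * (r ^ 4 + 36 * r\<^sup>2) + 2 * r ^ 4 + r ^ 4 * (F1 * (8 * C1 + 1) ^ CARD('n))"
  proof cases
    case 1
    have "M \<le> r ^ 4 * 2" unfolding Meq using eta 1 lpos[of k] by (intro mult_mono) auto
    then show ?thesis using rest rest3 by linarith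
  next
    case 2
    have "M \<le> (\<zeta> x0)\<^sup>2 * (8 * C1 * E)" unfolding Meq using 2 by (intro mult_left_mono) auto
    also have "\<dots> = 8 * C1 * ((\<zeta> x0)\<^sup>2 + 36 * r\<^sup>2)"
      using zx0 by (simp add: E_def field_simps)
    also have "\<dots> \<le> 8 * C1 * (r ^ 4 + 36 * r\<^sup>2)" using eta C1 by (intro mult_left_mono) auto
    finally show ?thesis using rest rest3 by linarith
  next
    case 3
    \<comment> \<open>Any two points of \<open>ball x0 r1\<close> lie in the ball of radius
      \<open>2 * r1\<close> about the first of them, which is inside
      \<open>ball x0 (3 * r1)\<close>. The expansion of the data requires such a ball in the domain;
      \<open>r2\<close> plays the same part in the target.\<close>
    obtain r1 where r1: "r1 > 0" "ball x0 (3 * r1) \<subseteq> ball y r"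
    proof -
      have "x0 \<in> ball y r" using nx0 by (simp add: dist_norm norm_minus_commute)
      then obtain r' where "r' > 0" "ball x0 r' \<subseteq> ball y r" using open_contains_ball open_ball by blast
      then show ?thesis using that[of "r' / 3"] by simp
    qed
    obtain r2 where r2: "r2 > 0" "ball (T_of \<epsilon> x0) (3 * r2) \<subseteq> O'"
    proof -
      obtain r' where "r' > 0" "ball (T_of \<epsilon> x0) r' \<subseteq> O'" using O x0S open_contains_ball by blast
      then show ?thesis using that[of "r' / 3"] by simp
    qed
    define S' where "S' = ball x0 r1"
    have sub: "ball x (2 * r1) \<subseteq> ball y r" if "x \<in> S'" for x
    proof -
      have "ball x (2 * r1) \<subseteq> ball x0 (3 * r1)"
      proof
        fix q assume "q \<in> ball x (2 * r1)"
        then show "q \<in> ball x0 (3 * r1)" using that dist_triangle[of x0 q x] by (simp add: S'_def)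
      qed
      then show ?thesis using r1 by blast
    qed
    have S'y: "S' \<subseteq> ball y r" using r1 by (force simp: S'_def)
    have S'S: "S' \<subseteq> S" using S'y r(2) ball_subset_cball by blast
    have "C3_function S' u p H D" by (rule C3_function_subset) (use S'S in \<open>auto simp: S'_def\<close>)
    then interpret C': C3_function S' u p H D .
    have x0': "x0 \<in> S'" using r1 by (simp add: S'_def)
    have sdlf: "sdiff lf x v \<ge> - (2 * K * (norm v)\<^sup>2)" if "x \<in> S'" "x + v \<in> S'" "x - v \<in> S'" for x v
    proof -
      have bS: "ball x (2 * r1) \<subseteq> S" using sub[OF that(1)] r(2) ball_subset_cball by blast
      have in2: "z \<in> ball x (2 * r1)" if "z \<in> S'" for z
        using \<open>x \<in> S'\<close> that dist_triangle[of x z x0] unfolding S'_def by (simp add: dist_commute)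
      have "\<bar>lf (x + v) - lf x - \<gamma>f x \<bullet> v\<bar> \<le> K * (norm v)\<^sup>2" "\<bar>lf (x - v) - lf x + \<gamma>f x \<bullet> v\<bar> \<le> K * (norm v)\<^sup>2"
        using lf(3)[OF bS in2[OF that(2)]] lf(3)[OF bS in2[OF that(3)]] by simp_all
      then show ?thesis by (simp add: sdiff_def abs_le_iff)
    qed
    have lg2: "lg z - lg y' \<le> \<gamma>g y' \<bullet> (z - y') + K * (norm (z - y'))\<^sup>2"
      if "y' \<in> ball (T_of \<epsilon> x0) r2" "z \<in> ball (T_of \<epsilon> x0) r2" for y' z
    proof -
      let ?t = "T_of \<epsilon> x0"
      have "ball y' (2 * r2) \<subseteq> ball ?t (3 * r2)"
      proof
        fix q assume "q \<in> ball y' (2 * r2)"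
        then show "q \<in> ball ?t (3 * r2)" using that(1) dist_triangle[of ?t q y'] by simp
      qed
      then have "ball y' (2 * r2) \<subseteq> O'" using r2(2) by blast
      moreover have "z \<in> ball y' (2 * r2)" using that dist_triangle[of y' z ?t] by (simp add: dist_commute)
      ultimately have "\<bar>lg z - lg y' - \<gamma>g y' \<bullet> (z - y')\<bar> \<le> K * (norm (z - y'))\<^sup>2" by (rule lg(4))
      then show ?thesis by (simp add: abs_le_iff)
    qed
    define g\<rho> where "g\<rho> = (\<lambda>x. (- 4 * M / \<zeta> x ^ 3) *\<^sub>R (x - y))"
    define dg\<rho> where "dg\<rho> = (\<lambda>h. (- 4 * M / \<zeta> x0 ^ 3) *\<^sub>R h - (24 * M * ((x0 - y) \<bullet> h) / \<zeta> x0 ^ 4) *\<^sub>R (x0 - y))"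
    \<comment> \<open>Maximality gives \<open>w \<le> M / \<zeta>\<^sup>2\<close> times A; since
      \<open>w\<close> is A minus the Hessian, the Hessian is at least \<open>\<rho>\<close> times
      A.\<close>
    define \<rho> where "\<rho> = (\<lambda>x. 1 - M / (\<zeta> x)\<^sup>2)"
    have inb: "norm (x - y) < r" if "x \<in> S'" for x
      using that S'y by (auto simp: dist_norm norm_minus_commute)
    have \<rho>d: "(\<rho> has_derivative (\<lambda>h. g\<rho> x \<bullet> h)) (at x)" if "x \<in> S'" for x
      unfolding \<rho>_def g\<rho>_def \<zeta>_def by (rule cutoff_gradient_estimate(1)[OF inb[OF that] less_imp_le[OF Mpos]])
    have \<rho>2: "(g\<rho> has_derivative dg\<rho>) (at x0)" unfolding g\<rho>_def dg\<rho>_def \<zeta>_def by (rule cut(2))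
    have Qb: "Q \<epsilon> (b k) q = b k \<bullet> (A_of \<epsilon> q *v b k)" for q by (simp add: quad_A)
    have touch1: "b k \<bullet> (H x *v b k) \<ge> \<rho> x * Q \<epsilon> (b k) (p x)" if x: "x \<in> S'" for x
    proof -
      have xc: "x \<in> cball y r" using x S'y by force
      have zp: "\<zeta> x > 0" unfolding \<zeta>_def by (rule cutoff_gradient_estimate(5)[OF inb[OF x] less_imp_le[OF Mpos]])
      have "(\<zeta> x)\<^sup>2 * (b k \<bullet> (w x *v b k)) \<le> M * Q \<epsilon> (b k) (p x)" using FM[OF xc, of "b k"] by (simp add: Qb)
      then have "b k \<bullet> (w x *v b k) \<le> M * Q \<epsilon> (b k) (p x) / (\<zeta> x)\<^sup>2" using zp by (simp add: pos_le_divide_eq mult.commute)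
      moreover have "b k \<bullet> (w x *v b k) = Q \<epsilon> (b k) (p x) - b k \<bullet> (H x *v b k)"
        by (simp add: w_def matrix_vector_mult_diff_rdistrib inner_diff_right Qb)
      ultimately show ?thesis by (simp add: \<rho>_def left_diff_distrib)
    qed
    have Qx0: "Q \<epsilon> (b k) (p x0) = s0 / \<epsilon>" unfolding Qb QA X.orthonormal s0_def by simp
    have \<rho>x0: "\<rho> x0 = 1 - l k" by (simp add: \<rho>_def Mz)
    have wq: "b k \<bullet> (w x0 *v b k) = m k" using X.eigen_form[of k k] by simp
    have touch2: "b k \<bullet> (H x0 *v b k) = \<rho> x0 * Q \<epsilon> (b k) (p x0)"
    proof -
      have "b k \<bullet> (H x0 *v b k) = Q \<epsilon> (b k) (p x0) - m k"
        using wq by (simp add: w_def matrix_vector_mult_diff_rdistrib inner_diff_right Qb)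
      moreover have "(1 - m k * (\<epsilon> / s0)) * (s0 / \<epsilon>) = s0 / \<epsilon> - m k"
        using s0 \<epsilon> by (simp add: left_diff_distrib diff_divide_distrib)
      ultimately show ?thesis unfolding Qx0 \<rho>x0 l_def by (simp only:)
    qed
    have mu: "m i = l i * (lapse (p x0) / \<epsilon>)" for i using s0 \<epsilon> by (simp add: l_def s0_def)
    have dbw: "diag_basis (G_mat (p x0)) (A_of \<epsilon> (p x0) - H x0) b m" using dbx by (simp add: w_def)
    note key = C'.key_inequality[where \<epsilon>=\<epsilon> and \<xi>="b k" and e=b and \<mu>=m and G="G_mat (p x0)" and lf=lf and lg=lg
        and \<gamma>f="\<gamma>f x0" and \<gamma>g=\<gamma>g and \<rho>=\<rho> and g\<rho>=g\<rho> and dg\<rho>=dg\<rho> and Kf=K and Kg=K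
        and V="ball (T_of \<epsilon> x0) r2" and N="real CARD('n) + 2",
        OF x0' P[OF subsetD[OF S'S]] pd[OF subsetD[OF S'S]] dbw lndet[OF subsetD[OF S'S]]
        lf(1)[OF x0S] sdlf open_ball _ _ _ lg2 \<rho>d \<rho>2 touch1 touch2, unfolded \<rho>x0 mu]
    have He: "H x0 *v b i = ((1 - l i) * (lapse (p x0) / \<epsilon>)) *\<^sub>R (G_mat (p x0) *v b i)" for i
    proof -
      have "H x0 *v b i = A_of \<epsilon> (p x0) *v b i - w x0 *v b i"
        by (simp add: w_def matrix_vector_mult_diff_rdistrib)
      also have "\<dots> = (lapse (p x0) / \<epsilon> - m i) *\<^sub>R (G_mat (p x0) *v b i)"
        unfolding X.eigen A_of_def by (simp add: scaleR_matrix_vector_assoc[symmetric] scaleR_diff_left)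
      also have "lapse (p x0) / \<epsilon> - m i = (1 - l i) * (lapse (p x0) / \<epsilon>)" by (simp add: mu left_diff_distrib diff_divide_distrib)
      finally show ?thesis .
    qed
    have E0: "E \<ge> 0" by (simp add: E_def)
    define Sg where "Sg = (\<Sum>i\<in>UNIV - {k}. 1 / l i)"
    have est: "(l k - 1)\<^sup>2 * Sg \<le> C1 * ((l k)\<^sup>2 + l k * E * (Sg + 1))"
      unfolding Sg_def C1_def
    proof (rule point_estimate[OF P[OF x0S] \<epsilon> X.orthonormal He lpos _ _ _ E0])
      show "1 \<le> l k" using 3 by simp
      show "norm (g\<rho> x0) \<le> l k * E" unfolding g\<rho>_def E_def Mz[symmetric] \<zeta>_def by (rule cut(3))
      show "dg\<rho> v \<bullet> v \<ge> - (l k * E * (norm v)\<^sup>2)" for v unfolding dg\<rho>_def E_def Mz[symmetric] \<zeta>_def by (rule cut(4))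
      show "norm (\<gamma>g (T_of \<epsilon> x0)) \<le> K" by (rule lg(2)[OF O(2)[OF x0S]])
      show "norm (\<gamma>f x0) \<le> K" by (rule lf(2)[OF x0S])
      show "K \<le> K" "K \<le> K" by simp_all
      show "0 \<le> real CARD('n) + 2" by simp
      show "\<epsilon> / lapse (p x0) \<le> R" by (rule L[OF x0S])
      show "1 \<le> R" by (rule R)
    qed (rule key, use r2 O x0S lg in auto)
    have Sg0: "Sg \<ge> 0" unfolding Sg_def using lpos by (intro sum_nonneg) (simp add: less_imp_le)
    \<comment> \<open>This uses \<open>l k \<ge> 2\<close>. Half of the resulting
      \<open>Sg / 4\<close> absorbs the cutoff term, which is at most \<open>(Sg + 1) / 8\<close>
      times \<open>(l k)\<^sup>2\<close> because \<open>8 * C1 * E \<le> l k\<close>.\<close>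
    have "(l k)\<^sup>2 / 4 \<le> (l k - 1)\<^sup>2"
    proof -
      have "(l k / 2)\<^sup>2 \<le> (l k - 1)\<^sup>2" using 3 by (intro power_mono) auto
      then show ?thesis by (simp add: power_divide)
    qed
    then have a1: "(l k)\<^sup>2 / 4 * Sg \<le> (l k - 1)\<^sup>2 * Sg" using Sg0 by (rule mult_right_mono)
    have "C1 * (l k * E) * (Sg + 1) \<le> (l k)\<^sup>2 / 8 * (Sg + 1)"
    proof (rule mult_right_mono)
      have "l k * (8 * C1 * E) \<le> l k * l k" using 3 by (intro mult_left_mono) auto
      then show "C1 * (l k * E) \<le> (l k)\<^sup>2 / 8" by (simp add: power2_eq_square mult_ac)
    qed (use Sg0 in simp)
    moreover have "C1 * ((l k)\<^sup>2 + l k * E * (Sg + 1)) = C1 * (l k)\<^sup>2 + C1 * (l k * E) * (Sg + 1)"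
      by (simp only: distrib_left mult.assoc)
    ultimately have "(l k)\<^sup>2 / 4 * Sg \<le> C1 * (l k)\<^sup>2 + (l k)\<^sup>2 / 8 * (Sg + 1)"
      using a1 est by linarith
    moreover have "(l k)\<^sup>2 * (C1 + (Sg + 1) / 8) = C1 * (l k)\<^sup>2 + (l k)\<^sup>2 / 8 * (Sg + 1)"
      by (simp add: distrib_left mult.commute)
    ultimately have "(l k)\<^sup>2 * (Sg / 4) \<le> (l k)\<^sup>2 * (C1 + (Sg + 1) / 8)" by simp
    then have "Sg / 4 \<le> C1 + (Sg + 1) / 8" using lpos[of k] by simp
    then have Sgb: "Sg \<le> 8 * C1 + 1" by (simp add: field_simps)
    \<comment> \<open>Each reciprocal is at most the sum \<open>Sg\<close>, so a bound on
      \<open>Sg\<close> together with the bounded product bounds the largest eigenvalue.\<close>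
    have "l k = (\<Prod>i\<in>UNIV. l i) * (\<Prod>i\<in>UNIV - {k}. 1 / l i)"
    proof -
      have "(\<Prod>i\<in>UNIV. l i) = l k * (\<Prod>i\<in>UNIV - {k}. l i)" by (rule prod.remove) auto
      moreover have "(\<Prod>i\<in>UNIV - {k}. l i) * (\<Prod>i\<in>UNIV - {k}. 1 / l i) = 1"
        unfolding prod.distrib[symmetric] by (rule prod.neutral) (use lpos in \<open>simp add: less_imp_neq[symmetric]\<close>)
      ultimately show ?thesis by (simp add: mult.assoc)
    qed
    also have "\<dots> \<le> F1 * (8 * C1 + 1) ^ CARD('n)"
    proof (rule mult_mono)
      show "(\<Prod>i\<in>UNIV. l i) \<le> F1" unfolding l_def s0_def by (rule prod[OF x0S dbx[unfolded w_def]])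
      have le: "1 / l i \<le> 8 * C1 + 1" if "i \<in> UNIV - {k}" for i
      proof -
        have "1 / l i \<le> Sg" unfolding Sg_def using that lpos by (intro member_le_sum) (auto simp: less_imp_le)
        then show ?thesis using Sgb by linarith
      qed
      have "(\<Prod>i\<in>UNIV - {k}. 1 / l i) \<le> (\<Prod>i\<in>UNIV - {k}. 8 * C1 + 1)"
        by (rule prod_mono) (use le lpos in \<open>auto simp: less_imp_le\<close>)
      also have "\<dots> = (8 * C1 + 1) ^ card (UNIV - {k})" by simp
      also have "\<dots> \<le> (8 * C1 + 1) ^ CARD('n)"
        using C1 by (intro power_increasing card_mono) auto
      finally show "(\<Prod>i\<in>UNIV - {k}. 1 / l i) \<le> (8 * C1 + 1) ^ CARD('n)" .
      show "0 \<le> (\<Prod>i\<in>UNIV - {k}. 1 / l i)" using lpos by (intro prod_nonneg) (simp add: less_imp_le)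
    qed (use F1 in simp)
    finally have "l k \<le> F1 * (8 * C1 + 1) ^ CARD('n)" .
    then have "M \<le> r ^ 4 * (F1 * (8 * C1 + 1) ^ CARD('n))"
      unfolding Meq using eta lpos[of k] by (intro mult_mono) auto
    then show ?thesis using rest by linarith
  qed
  then show ?thesis using goal by linarith
qed

end

text \<open>Translates the bound into one for DT. A frame vector of \<open>w\<close> against the
  induced metric is an eigenvector of DT with eigenvalue \<open>l i = \<mu> i * L\<close>, because
  \<open>dm\<close> inverts A, and the product of the \<open>l i\<close> is
  \<open>f / (g o T)\<close>.\<close>

lemma eigenvalue_bounds:
  fixes \<Omega> \<Omega>s :: "(real^'n) set" and f g u :: "real^'n \<Rightarrow> real"
  assumes \<Omega>: "open \<Omega>" and \<Omega>s: "open \<Omega>s" "bounded \<Omega>s" "\<Omega>s \<noteq> {}"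
    and f: "m > 0" "\<And>x. x \<in> \<Omega> \<Longrightarrow> m \<le> f x" "\<And>x. x \<in> \<Omega> \<Longrightarrow> f x \<le> M"
    and g: "m' > 0" "\<And>x. x \<in> \<Omega>s \<Longrightarrow> m' \<le> g x" "\<And>x. x \<in> \<Omega>s \<Longrightarrow> g x \<le> M'"
    and R0: "\<And>x y. x \<in> \<Omega> \<Longrightarrow> y \<in> \<Omega>s \<Longrightarrow> norm (x - y) \<le> R0" "R0 \<ge> 0"
    and lf: "\<And>x. x \<in> \<Omega> \<Longrightarrow> ((\<lambda>x. ln (f x)) has_derivative (\<lambda>h. \<gamma>f x \<bullet> h)) (at x)" "\<And>x. x \<in> \<Omega> \<Longrightarrow> norm (\<gamma>f x) \<le> K"
      "\<And>x z r. ball x r \<subseteq> \<Omega> \<Longrightarrow> z \<in> ball x r \<Longrightarrow> \<bar>ln (f z) - ln (f x) - \<gamma>f x \<bullet> (z - x)\<bar> \<le> K * (norm (z - x))\<^sup>2"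
    and lg: "\<And>x. x \<in> \<Omega>s \<Longrightarrow> ((\<lambda>x. ln (g x)) has_derivative (\<lambda>h. \<gamma>g x \<bullet> h)) (at x)" "\<And>x. x \<in> \<Omega>s \<Longrightarrow> norm (\<gamma>g x) \<le> K"
      "\<And>x. x \<in> \<Omega>s \<Longrightarrow> isCont \<gamma>g x"
      "\<And>x z r. ball x r \<subseteq> \<Omega>s \<Longrightarrow> z \<in> ball x r \<Longrightarrow> \<bar>ln (g z) - ln (g x) - \<gamma>g x \<bullet> (z - x)\<bar> \<le> K * (norm (z - x))\<^sup>2"
    and \<epsilon>: "0 < \<epsilon>" "\<epsilon> \<le> 1"
    and u: "Ck_on 3 \<Omega> u" "c_concave_on \<epsilon> \<Omega> \<Omega>s u" "T_map \<epsilon> u ` \<Omega> \<subseteq> \<Omega>s"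
    and eq: "\<And>x. x \<in> \<Omega> \<Longrightarrow> det (w_mat \<epsilon> u x) = \<epsilon>\<^sup>2 / L_fun \<epsilon> u x ^ (CARD('n) + 2) * (f x / g (T_map \<epsilon> u x))"
    and r: "r > 0" "cball y r \<subseteq> \<Omega>"
  defines "C1 \<equiv> (1 + R0)\<^sup>2 * (20 + 6 * real CARD('n) + 3 * (real CARD('n) + 2) + 20 * K)"
  obtains l :: "'n \<Rightarrow> real" where "eigenvals (jacobian (T_map \<epsilon> u) (at y)) = (\<lambda>i. complex_of_real (l i)) ` UNIV"
    "\<And>i. l i > 0" "(\<Prod>i\<in>UNIV. l i) \<ge> m / M'"
    "\<And>i. r ^ 4 * l i \<le> 8 * C1 * (r ^ 4 + 36 * r\<^sup>2) + 2 * r ^ 4 + r ^ 4 * ((M / m') * (8 * C1 + 1) ^ CARD('n))"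
proof -
  obtain D where "C3_function \<Omega> u (grad u) (hessian u) D" using C31_imp_C3_function[OF \<Omega> u(1)] .
  then interpret C3_function \<Omega> u "grad u" "hessian u" D .
  let ?p = "grad u" and ?H = "hessian u" and ?n = "CARD('n)"
  have L_eq: "L_fun \<epsilon> u x = \<epsilon> / lapse (?p x)" for x
    by (simp add: L_fun_def lapse_def power2_norm_eq_inner)
  have w_eq: "w_mat \<epsilon> u x = A_of \<epsilon> (?p x) - ?H x" for x
    by (simp add: w_mat_def A_mat_def A_of_def G_mat_def L_eq vec_eq_iff)
  have T_eq: "T_map \<epsilon> u = T_of \<epsilon>"
    by (simp add: fun_eq_iff T_map_def T_of_def m_of_def L_eq)
  have supp: "?p x \<bullet> ?p x < 1 \<and> (\<forall>v. v \<bullet> (?H x *v v) \<le> v \<bullet> (A_of \<epsilon> (?p x) *v v))" if x: "x \<in> \<Omega>" for x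
  proof -
    obtain y0 where "\<And>z. z \<in> \<Omega> \<Longrightarrow> u z - u x \<le> cost \<epsilon> z y0 - cost \<epsilon> x y0"
      using c_concave_support[OF u(2) \<Omega>s(2,3) x] by blast
    from support_point[OF x \<epsilon>(1) this] show ?thesis by blast
  qed
  have P: "?p x \<bullet> ?p x < 1" if "x \<in> \<Omega>" for x using supp[OF that] by blast
  have TO: "T_of \<epsilon> x \<in> \<Omega>s" if "x \<in> \<Omega>" for x using u(3) that by (auto simp: T_eq)
  have s: "lapse (?p x) > 0" if "x \<in> \<Omega>" for x using lapse_pos[OF P[OF that]] .
  have fpos: "f x > 0" if "x \<in> \<Omega>" for x using f(1) f(2)[OF that] by linarith
  have gpos: "g x > 0" if "x \<in> \<Omega>s" for x using g(1) g(2)[OF that] by linarith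
  have det: "det (A_of \<epsilon> (?p x) - ?H x) = \<epsilon>\<^sup>2 / (\<epsilon> / lapse (?p x)) ^ (?n + 2) * (f x / g (T_of \<epsilon> x))" if "x \<in> \<Omega>" for x
    using eq[OF that] unfolding w_eq L_eq T_eq .
  have pd: "pos_def (A_of \<epsilon> (?p x) - ?H x)" if x: "x \<in> \<Omega>" for x
  proof (rule pos_def_of_psd)
    have "sym_mat (A_of \<epsilon> (?p x))"
      by (simp add: sym_mat_def A_of_def G_mat_def transpose_def vec_eq_iff mult.commute)
    then show "sym_mat (A_of \<epsilon> (?p x) - ?H x)"
      using H_sym[OF x] by (simp add: sym_mat_def transpose_def vec_eq_iff)
    show "v \<bullet> ((A_of \<epsilon> (?p x) - ?H x) *v v) \<ge> 0" for v
      using supp[OF x] by (simp add: matrix_vector_mult_diff_rdistrib inner_diff_right)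
    have "0 < \<epsilon>\<^sup>2 / (\<epsilon> / lapse (?p x)) ^ (?n + 2) * (f x / g (T_of \<epsilon> x))"
      using \<epsilon> s[OF x] fpos[OF x] gpos[OF TO[OF x]] by (intro mult_pos_pos divide_pos_pos zero_less_power) auto
    then show "det (A_of \<epsilon> (?p x) - ?H x) \<noteq> 0" unfolding det[OF x] by linarith
  qed
  \<comment> \<open>All explicit dependence of the right side on \<open>\<epsilon>\<close> sits in
    an additive constant, which differentiation removes; the power of L leaves the coefficient
    \<open>n + 2\<close> of the logarithm of the lapse.\<close>
  have lndet: "ln (det (A_of \<epsilon> (?p x) - ?H x)) = (2 * ln \<epsilon> - (real ?n + 2) * ln \<epsilon>) + (real ?n + 2) * ln (lapse (?p x)) + ln (f x) - ln (g (T_of \<epsilon> x))"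
    if x: "x \<in> \<Omega>" for x
  proof -
    have "ln (det (A_of \<epsilon> (?p x) - ?H x)) = ln (\<epsilon>\<^sup>2 / (\<epsilon> / lapse (?p x)) ^ (?n + 2)) + ln (f x / g (T_of \<epsilon> x))"
      unfolding det[OF x] using \<epsilon> s[OF x] fpos[OF x] gpos[OF TO[OF x]] by (intro ln_mult_pos) auto
    also have "ln (f x / g (T_of \<epsilon> x)) = ln (f x) - ln (g (T_of \<epsilon> x))"
      using fpos[OF x] gpos[OF TO[OF x]] by (intro ln_divide_pos) auto
    also have "ln (\<epsilon>\<^sup>2 / (\<epsilon> / lapse (?p x)) ^ (?n + 2)) = ln (\<epsilon>\<^sup>2) - ln ((\<epsilon> / lapse (?p x)) ^ (?n + 2))"
      using \<epsilon> s[OF x] by (intro ln_divide_pos) auto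
    also have "ln (\<epsilon>\<^sup>2) = 2 * ln \<epsilon>" using \<epsilon> ln_realpow[of \<epsilon> 2] by simp
    also have "ln ((\<epsilon> / lapse (?p x)) ^ (?n + 2)) = (real ?n + 2) * ln (\<epsilon> / lapse (?p x))"
      using \<epsilon> s[OF x] ln_realpow[of "\<epsilon> / lapse (?p x)" "?n + 2"] by (simp add: add.commute)
    also have "ln (\<epsilon> / lapse (?p x)) = ln \<epsilon> - ln (lapse (?p x))" using \<epsilon> s[OF x] by (intro ln_divide_pos) auto
    finally show ?thesis by (simp add: algebra_simps)
  qed
  \<comment> \<open>The metric has determinant \<open>(lapse (?p x))\<^sup>2\<close>, and
    \<open>L * lapse (?p x) = \<epsilon>\<close>, so all powers of L and \<open>\<epsilon>\<close>
    cancel.\<close>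
  have prod: "(\<Prod>i\<in>UNIV. \<mu> i * (\<epsilon> / lapse (?p x))) = f x / g (T_of \<epsilon> x)"
    if x: "x \<in> \<Omega>" and db: "diag_basis (G_mat (?p x)) (A_of \<epsilon> (?p x) - ?H x) e \<mu>" for x e \<mu>
  proof -
    define L where "L = \<epsilon> / lapse (?p x)"
    have L: "L > 0" "L * lapse (?p x) = \<epsilon>" using \<epsilon> s[OF x] by (auto simp: L_def)
    have "(lapse (?p x))\<^sup>2 * (\<Prod>i\<in>UNIV. \<mu> i) = \<epsilon>\<^sup>2 / L ^ (?n + 2) * (f x / g (T_of \<epsilon> x))"
      using diag_basis.det_eq[OF db] unfolding det[OF x] det_G[OF P[OF x]] lapse_sq[OF P[OF x]] L_def by simp
    then have "L ^ (?n + 2) * ((lapse (?p x))\<^sup>2 * (\<Prod>i\<in>UNIV. \<mu> i)) = \<epsilon>\<^sup>2 * (f x / g (T_of \<epsilon> x))" using L by simp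
    moreover have "L ^ (?n + 2) * ((lapse (?p x))\<^sup>2 * (\<Prod>i\<in>UNIV. \<mu> i)) = (L * lapse (?p x))\<^sup>2 * (L ^ ?n * (\<Prod>i\<in>UNIV. \<mu> i))"
      by (simp add: power_add power_mult_distrib power2_eq_square mult_ac)
    ultimately have "\<epsilon>\<^sup>2 * (L ^ ?n * (\<Prod>i\<in>UNIV. \<mu> i)) = \<epsilon>\<^sup>2 * (f x / g (T_of \<epsilon> x))" unfolding L(2) by (simp only:)
    then have "L ^ ?n * (\<Prod>i\<in>UNIV. \<mu> i) = f x / g (T_of \<epsilon> x)"
      by (rule iffD1[OF mult_left_cancel, rotated]) (use \<epsilon> in simp)
    then show ?thesis by (simp add: prod.distrib L_def[symmetric] mult.commute)
  qed
  have fg: "m / M' \<le> f x / g (T_of \<epsilon> x)" "f x / g (T_of \<epsilon> x) \<le> M / m'" if x: "x \<in> \<Omega>" for x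
    using f(2)[OF x] f(3)[OF x] g(2)[OF TO[OF x]] g(3)[OF TO[OF x]] f(1) g(1) fpos[OF x] gpos[OF TO[OF x]]
    by (intro frac_le; linarith)+
  \<comment> \<open>From \<open>L\<^sup>2 = \<epsilon>\<^sup>2 + |x - T x|^2\<close> with
    \<open>\<epsilon> \<le> 1\<close>. Here the inclusion of the range of T in the bounded target
    enters.\<close>
  have LR: "\<epsilon> / lapse (?p x) \<le> 1 + R0" if x: "x \<in> \<Omega>" for x
  proof -
    define L where "L = \<epsilon> / lapse (?p x)"
    have L: "L > 0" "L * lapse (?p x) = \<epsilon>" using \<epsilon> s[OF x] by (auto simp: L_def)
    have "x - T_of \<epsilon> x = L *\<^sub>R ?p x" by (simp add: T_of_def m_of_def L_def)
    then have "L * norm (?p x) \<le> R0" using R0(1)[OF x TO[OF x]] L by simp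
    then have "(L * norm (?p x))\<^sup>2 \<le> R0\<^sup>2" using L by (intro power_mono) auto
    moreover have "L\<^sup>2 = (L * lapse (?p x))\<^sup>2 + (L * norm (?p x))\<^sup>2"
      unfolding power_mult_distrib lapse_sq[OF P[OF x]] by (simp add: power2_norm_eq_inner algebra_simps)
    moreover have "\<epsilon>\<^sup>2 \<le> 1" using \<epsilon> by (simp add: power_le_one)
    ultimately have "L\<^sup>2 \<le> 1 + R0\<^sup>2" unfolding L(2) by linarith
    also have "\<dots> \<le> (1 + R0)\<^sup>2" using R0(2) by (simp add: power2_eq_square algebra_simps)
    finally have "L \<le> 1 + R0" by (rule power2_le_imp_le) (use R0(2) in simp)
    then show ?thesis by (simp add: L_def)
  qed
  have y: "y \<in> \<Omega>" using r by auto
  have "sym_mat (A_of \<epsilon> (?p y) - ?H y)" using pd[OF y] by (simp add: pos_def_def)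
  then obtain e \<mu> where db: "diag_basis (G_mat (?p y)) (A_of \<epsilon> (?p y) - ?H y) e \<mu>"
    using simultaneous_diagonalization[OF pos_def_G[OF P[OF y]]] by blast
  interpret B: diag_basis "G_mat (?p y)" "A_of \<epsilon> (?p y) - ?H y" e \<mu> by fact
  define l where "l = (\<lambda>i. \<mu> i * (\<epsilon> / lapse (?p y)))"
  have lpos: "l i > 0" for i
    using B.pos_def_eigen[OF pd[OF y], of i] \<epsilon> s[OF y] by (simp add: l_def)
  have J: "jacobian (T_map \<epsilon> u) (at y) *v e i = l i *\<^sub>R e i" for i
  proof -
    have d: "(T_map \<epsilon> u has_derivative (\<lambda>h. h - dm \<epsilon> (?p y) (?H y *v h))) (at y)"
      unfolding T_eq by (rule T_deriv[OF y P[OF y]])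
    then have "T_map \<epsilon> u differentiable (at y)" by (rule differentiableI)
    then have "(T_map \<epsilon> u has_derivative (\<lambda>h. jacobian (T_map \<epsilon> u) (at y) *v h)) (at y)" by (simp add: jacobian_works)
    from has_derivative_unique[OF this d]
    have "jacobian (T_map \<epsilon> u) (at y) *v e i = e i - dm \<epsilon> (?p y) (?H y *v e i)" by (rule fun_cong)
    also have "?H y *v e i = (lapse (?p y) / \<epsilon> - \<mu> i) *\<^sub>R (G_mat (?p y) *v e i)"
    proof -
      have "?H y *v e i = A_of \<epsilon> (?p y) *v e i - (A_of \<epsilon> (?p y) - ?H y) *v e i"
        by (simp add: matrix_vector_mult_diff_rdistrib)
      then show ?thesis
        unfolding B.eigen unfolding A_of_def by (simp add: scaleR_matrix_vector_assoc[symmetric] scaleR_diff_left)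
    qed
    also have "dm \<epsilon> (?p y) ((lapse (?p y) / \<epsilon> - \<mu> i) *\<^sub>R (G_mat (?p y) *v e i)) = ((lapse (?p y) / \<epsilon> - \<mu> i) * (\<epsilon> / lapse (?p y))) *\<^sub>R e i"
      by (simp add: dm_linear dm_G[OF P[OF y]])
    also have "(lapse (?p y) / \<epsilon> - \<mu> i) * (\<epsilon> / lapse (?p y)) = 1 - l i"
      unfolding l_def left_diff_distrib using \<epsilon> s[OF y] by simp
    finally show ?thesis by (simp add: scaleR_diff_left)
  qed
  have "r ^ 4 * l i \<le> 8 * C1 * (r ^ 4 + 36 * r\<^sup>2) + 2 * r ^ 4 + r ^ 4 * ((M / m') * (8 * C1 + 1) ^ CARD('n))" for i
    unfolding l_def C1_def
  proof (rule interior_bound[where \<gamma>f=\<gamma>f and \<gamma>g=\<gamma>g and O'=\<Omega>s, OF \<epsilon>(1) P pd lndet _ LR _ lf(1,2) _ \<Omega>s(1) TO lg(1-3) _ r db])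
    show "\<bar>ln (f z) - ln (f x) - \<gamma>f x \<bullet> (z - x)\<bar> \<le> K * (norm (z - x))\<^sup>2"
      if "ball x r \<subseteq> \<Omega>" "z \<in> ball x r" for x z r using lf(3)[OF that] .
    show "\<bar>ln (g z) - ln (g x) - \<gamma>g x \<bullet> (z - x)\<bar> \<le> K * (norm (z - x))\<^sup>2"
      if "ball x r \<subseteq> \<Omega>s" "z \<in> ball x r" for x z r using lg(4)[OF that] .
    show "(\<Prod>i\<in>UNIV. \<mu> i * (\<epsilon> / lapse (?p x))) \<le> M / m'"
      if "x \<in> \<Omega>" "diag_basis (G_mat (?p x)) (A_of \<epsilon> (?p x) - ?H x) e \<mu>" for x e \<mu>
      using prod[OF that] fg(2)[OF that(1)] by simp
    show "1 \<le> 1 + R0" using R0(2) by simp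
  qed
  moreover have "m / M' \<le> (\<Prod>i\<in>UNIV. l i)" unfolding l_def prod[OF y db] by (rule fg(1)[OF y])
  ultimately show ?thesis using that[OF eigenvals_diagonalizable[OF db J] lpos] by blast
qed

section \<open>Choice of a constant independent of the solution\<close>

theorem corollary1:
  fixes \<Omega> \<Omega>s :: "(real^'n) set"
    and f g :: "real^'n \<Rightarrow> real"
    and d :: real
  assumes "CARD('n) \<ge> 2"
    and "bounded_domain \<Omega>" and "bounded_domain \<Omega>s"
    and "C11_on \<Omega> f" and "C11_on \<Omega>s g"
    and "\<exists>m>0. \<exists>M. \<forall>x\<in>\<Omega>. m \<le> f x \<and> f x \<le> M"
    and "\<exists>m>0. \<exists>M. \<forall>y\<in>\<Omega>s. m \<le> g y \<and> g y \<le> M"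
    and "integral \<Omega> f = integral \<Omega>s g"
    and "d > 0"
  shows "\<exists>C>0. \<forall>\<epsilon> u \<Omega>'.
    0 < \<epsilon> \<longrightarrow> \<epsilon> \<le> 1 \<longrightarrow>
    C31_on \<Omega> u \<longrightarrow> c_concave_on \<epsilon> \<Omega> \<Omega>s u \<longrightarrow>
    T_map \<epsilon> u ` \<Omega> \<subseteq> \<Omega>s \<longrightarrow>
    (\<forall>x\<in>\<Omega>. det (w_mat \<epsilon> u x) =
        \<epsilon>\<^sup>2 / L_fun \<epsilon> u x ^ (CARD('n) + 2) * (f x / g (T_map \<epsilon> u x))) \<longrightarrow>
    compact (closure \<Omega>') \<longrightarrow> closure \<Omega>' \<subseteq> \<Omega> \<longrightarrow> setdist \<Omega>' (frontier \<Omega>) = d \<longrightarrow>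
    (\<forall>x\<in>\<Omega>'.
        (\<forall>z \<in> eigenvals (jacobian (T_map \<epsilon> u) (at x)). z \<in> \<real> \<and> Re z > 0) \<and>
        inverse C \<le> Min (Re ` eigenvals (jacobian (T_map \<epsilon> u) (at x))) \<and>
        Min (Re ` eigenvals (jacobian (T_map \<epsilon> u) (at x)))
          \<le> Max (Re ` eigenvals (jacobian (T_map \<epsilon> u) (at x))) \<and>
        Max (Re ` eigenvals (jacobian (T_map \<epsilon> u) (at x))) \<le> C)"
proof -
  have \<Omega>: "open \<Omega>" "bounded \<Omega>" "\<Omega> \<noteq> {}" and \<Omega>s: "open \<Omega>s" "bounded \<Omega>s" "\<Omega>s \<noteq> {}"
    using assms(2,3) by (auto simp: bounded_domain_def)
  obtain m M where f: "m > 0" "\<And>x. x \<in> \<Omega> \<Longrightarrow> m \<le> f x" "\<And>x. x \<in> \<Omega> \<Longrightarrow> f x \<le> M" using assms(6) by blast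
  obtain m' M' where g: "m' > 0" "\<And>x. x \<in> \<Omega>s \<Longrightarrow> m' \<le> g x" "\<And>x. x \<in> \<Omega>s \<Longrightarrow> g x \<le> M'" using assms(7) by blast
  obtain x1 y1 where "x1 \<in> \<Omega>" "y1 \<in> \<Omega>s" using \<Omega> \<Omega>s by blast
  then have MM: "M > 0" "M' > 0" using f(1) f(2,3)[of x1] g(1) g(2,3)[of y1] by linarith+
  obtain B B' where B: "\<forall>x\<in>\<Omega>. norm x \<le> B" "\<forall>x\<in>\<Omega>s. norm x \<le> B'"
    using \<Omega>(2) \<Omega>s(2) unfolding bounded_iff by blast
  have R0: "norm (x - y) \<le> \<bar>B\<bar> + \<bar>B'\<bar>" if "x \<in> \<Omega>" "y \<in> \<Omega>s" for x y
    using norm_triangle_ineq4[of x y] bspec[OF B(1) that(1)] bspec[OF B(2) that(2)] by linarith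
  obtain Kf where Kf: "Kf \<ge> 0" "\<And>x. x \<in> \<Omega> \<Longrightarrow> norm (grad f x /\<^sub>R f x) \<le> Kf"
    "\<And>x. x \<in> \<Omega> \<Longrightarrow> ((\<lambda>x. ln (f x)) has_derivative (\<lambda>h. (grad f x /\<^sub>R f x) \<bullet> h)) (at x)"
    "\<And>x. x \<in> \<Omega> \<Longrightarrow> isCont (\<lambda>x. grad f x /\<^sub>R f x) x"
    "\<And>x y r. ball x r \<subseteq> \<Omega> \<Longrightarrow> y \<in> ball x r \<Longrightarrow> \<bar>ln (f y) - ln (f x) - (grad f x /\<^sub>R f x) \<bullet> (y - x)\<bar> \<le> Kf * (norm (y - x))\<^sup>2"
    by (rule C11_ln_bounds[OF \<Omega>(1) assms(4) f(1) f(2)], assumption, rule that, assumption+)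
  obtain Kg where Kg: "Kg \<ge> 0" "\<And>x. x \<in> \<Omega>s \<Longrightarrow> norm (grad g x /\<^sub>R g x) \<le> Kg"
    "\<And>x. x \<in> \<Omega>s \<Longrightarrow> ((\<lambda>x. ln (g x)) has_derivative (\<lambda>h. (grad g x /\<^sub>R g x) \<bullet> h)) (at x)"
    "\<And>x. x \<in> \<Omega>s \<Longrightarrow> isCont (\<lambda>x. grad g x /\<^sub>R g x) x"
    "\<And>x y r. ball x r \<subseteq> \<Omega>s \<Longrightarrow> y \<in> ball x r \<Longrightarrow> \<bar>ln (g y) - ln (g x) - (grad g x /\<^sub>R g x) \<bullet> (y - x)\<bar> \<le> Kg * (norm (y - x))\<^sup>2"
    by (rule C11_ln_bounds[OF \<Omega>s(1) assms(5) g(1) g(2)], assumption, rule that, assumption+)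
  define K where "K = Kf + Kg"
  have Kle: "Kf \<le> K" "Kg \<le> K" using Kf(1) Kg(1) by (auto simp: K_def)
  have lf: "norm (grad f x /\<^sub>R f x) \<le> K" if "x \<in> \<Omega>" for x using Kf(2)[OF that] Kle by linarith
  have lf': "\<bar>ln (f y) - ln (f x) - (grad f x /\<^sub>R f x) \<bullet> (y - x)\<bar> \<le> K * (norm (y - x))\<^sup>2" if "ball x r \<subseteq> \<Omega>" "y \<in> ball x r" for x y r
    using Kf(5)[OF that] mult_right_mono[OF Kle(1), of "(norm (y - x))\<^sup>2"] by simp
  have lg: "norm (grad g x /\<^sub>R g x) \<le> K" if "x \<in> \<Omega>s" for x using Kg(2)[OF that] Kle by linarith
  have lg': "\<bar>ln (g y) - ln (g x) - (grad g x /\<^sub>R g x) \<bullet> (y - x)\<bar> \<le> K * (norm (y - x))\<^sup>2" if "ball x r \<subseteq> \<Omega>s" "y \<in> ball x r" for x y r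
    using Kg(5)[OF that] mult_right_mono[OF Kle(2), of "(norm (y - x))\<^sup>2"] by simp
  \<comment> \<open>Strictly less than the distance to the frontier, so that closed balls of radius
    \<open>r\<close> about points of \<open>\<Omega>'\<close> miss the frontier; being connected and
    meeting \<open>\<Omega>\<close>, they lie inside.\<close>
  define r where "r = d / 2"
  have r: "r > 0" using assms(9) by (simp add: r_def)
  define R0 where "R0 = \<bar>B\<bar> + \<bar>B'\<bar>"
  define C1 where "C1 = (1 + R0)\<^sup>2 * (20 + 6 * real CARD('n) + 3 * (real CARD('n) + 2) + 20 * K)"
  define b where "b = 8 * C1 * (r ^ 4 + 36 * r\<^sup>2) + 2 * r ^ 4 + r ^ 4 * ((M / m') * (8 * C1 + 1) ^ CARD('n))"
  \<comment> \<open>The upper bound, made at least 1 so that powers of it increase with the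
    exponent.\<close>
  define \<Lambda> where "\<Lambda> = max 1 (b / r ^ 4)"
  \<comment> \<open>The second summand is the reciprocal of the lower bound: the product is at least
    \<open>m / M'\<close>, and the other eigenvalues contribute at most
    \<open>\<Lambda> ^ CARD('n)\<close> to it.\<close>
  define C where "C = \<Lambda> + \<Lambda> ^ CARD('n) / (m / M')"
  have \<Lambda>: "\<Lambda> \<ge> 1" by (simp add: \<Lambda>_def)
  have F0: "m / M' > 0" using f(1) MM by simp
  have "\<Lambda> ^ CARD('n) / (m / M') > 0" using \<Lambda> by (intro divide_pos_pos F0) auto
  then have Cpos: "C > 0" using \<Lambda> unfolding C_def by linarith
  show ?thesis
  proof (intro exI[of _ C] conjI allI impI ballI Cpos)
    fix \<epsilon> :: real and u :: "real^'n \<Rightarrow> real" and \<Omega>' :: "(real^'n) set" and x :: "real^'n"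
    assume \<epsilon>: "0 < \<epsilon>" "\<epsilon> \<le> 1" and u: "C31_on \<Omega> u" "c_concave_on \<epsilon> \<Omega> \<Omega>s u" "T_map \<epsilon> u ` \<Omega> \<subseteq> \<Omega>s"
      and eq: "\<forall>x\<in>\<Omega>. det (w_mat \<epsilon> u x) = \<epsilon>\<^sup>2 / L_fun \<epsilon> u x ^ (CARD('n) + 2) * (f x / g (T_map \<epsilon> u x))"
      and \<Omega>': "closure \<Omega>' \<subseteq> \<Omega>" "setdist \<Omega>' (frontier \<Omega>) = d" and x: "x \<in> \<Omega>'"
    have x\<Omega>: "x \<in> \<Omega>" using x \<Omega>'(1) closure_subset by blast
    have "cball x r \<inter> frontier \<Omega> = {}"
    proof -
      have False if "z \<in> cball x r" "z \<in> frontier \<Omega>" for z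
        using setdist_le_dist[OF x that(2)] that(1) \<Omega>'(2) assms(9) by (simp add: r_def)
      then show ?thesis by blast
    qed
    moreover have "cball x r \<inter> \<Omega> \<noteq> {}" using x\<Omega> r by force
    ultimately have cb: "cball x r \<subseteq> \<Omega>"
      using connected_Int_frontier[OF connected_cball, of x r \<Omega>] by blast
    have u3: "Ck_on 3 \<Omega> u" using u(1) by (simp add: C31_on_def)
    let ?E = "eigenvals (jacobian (T_map \<epsilon> u) (at x))"
    obtain l :: "'n \<Rightarrow> real" where E: "?E = (\<lambda>i. complex_of_real (l i)) ` UNIV"
      and l: "\<And>i. l i > 0" "(\<Prod>i\<in>UNIV. l i) \<ge> m / M'" "\<And>i. r ^ 4 * l i \<le> b"
    proof (rule eigenvalue_bounds[OF \<Omega>(1) \<Omega>s f g R0[folded R0_def] _ Kf(3) lf _ Kg(3) lg Kg(4) _ \<epsilon> u3 u(2,3) eq[rule_format] r cb,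
          folded C1_def, folded b_def])
      show "0 \<le> R0" by (simp add: R0_def)
      show "\<bar>ln (f z) - ln (f x) - (grad f x /\<^sub>R f x) \<bullet> (z - x)\<bar> \<le> K * (norm (z - x))\<^sup>2"
        if "ball x r \<subseteq> \<Omega>" "z \<in> ball x r" for x z r using lf'[OF that] .
      show "\<bar>ln (g z) - ln (g x) - (grad g x /\<^sub>R g x) \<bullet> (z - x)\<bar> \<le> K * (norm (z - x))\<^sup>2"
        if "ball x r \<subseteq> \<Omega>s" "z \<in> ball x r" for x z r using lg'[OF that] .
    qed (assumption | rule that)+
    have up: "l i \<le> \<Lambda>" for i
    proof -
      have "l i \<le> b / r ^ 4" using l(3)[of i] r by (simp add: pos_le_divide_eq mult.commute)
      then show ?thesis by (simp add: \<Lambda>_def)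
    qed
    have low: "inverse C \<le> l i" for i
    proof -
      have "m / M' \<le> (\<Prod>j\<in>UNIV. l j)" by (rule l(2))
      also have "\<dots> = l i * (\<Prod>j\<in>UNIV - {i}. l j)" by (rule prod.remove) auto
      also have "\<dots> \<le> l i * \<Lambda> ^ CARD('n)"
      proof (rule mult_left_mono)
        have "(\<Prod>j\<in>UNIV - {i}. l j) \<le> (\<Prod>j\<in>UNIV - {i}. \<Lambda>)"
          by (rule prod_mono) (use l(1) up in \<open>auto simp: less_imp_le\<close>)
        also have "\<dots> = \<Lambda> ^ card (UNIV - {i})" by simp
        also have "\<dots> \<le> \<Lambda> ^ CARD('n)" using \<Lambda> by (intro power_increasing card_mono) auto
        finally show "(\<Prod>j\<in>UNIV - {i}. l j) \<le> \<Lambda> ^ CARD('n)" .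
      qed (use l(1)[of i] in simp)
      finally have le: "m / M' \<le> l i * \<Lambda> ^ CARD('n)" .
      have "\<Lambda> ^ CARD('n) > 0" using \<Lambda> by simp
      then have "(m / M') / \<Lambda> ^ CARD('n) \<le> l i" using le by (simp only: pos_divide_le_eq)
      moreover have "inverse C \<le> inverse (\<Lambda> ^ CARD('n) / (m / M'))"
      proof (rule le_imp_inverse_le)
        show "0 < \<Lambda> ^ CARD('n) / (m / M')" using \<Lambda> by (intro divide_pos_pos F0) auto
        show "\<Lambda> ^ CARD('n) / (m / M') \<le> C" unfolding C_def using \<Lambda> by linarith
      qed
      ultimately show ?thesis by (simp add: inverse_eq_divide mult.commute)
    qed
    have "\<Lambda> ^ CARD('n) / (m / M') > 0" using \<Lambda> by (intro divide_pos_pos F0) auto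
    then have \<Lambda>C: "\<Lambda> \<le> C" unfolding C_def by linarith
    have ReE: "Re ` ?E = range l" unfolding E by (simp add: image_image)
    show "z \<in> \<real>" "Re z > 0" if "z \<in> ?E" for z
      using that l(1) unfolding E by auto
    show "inverse C \<le> Min (Re ` ?E)" unfolding ReE using low by simp
    show "Min (Re ` ?E) \<le> Max (Re ` ?E)" unfolding ReE by (meson Max_ge Min_le finite finite_imageI order_trans rangeI)
    show "Max (Re ` ?E) \<le> C" unfolding ReE using up \<Lambda>C by (auto intro: order_trans)
  qed
qed

end
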